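(* Let $r>0$, $d\ge 1$, and let $\gamma=(\gamma_j)_{j\in\mathbb Z}$, $\alpha=(\alpha_j)_{j\in\mathbb Z}$, $\omega=(\omega_j)_{j\in\mathbb Z}$ be strictly positive symmetric sequences with $\gamma_0=\omega_0=\alpha_0=1$, $\gamma_j\ge 1$ for all $j\in\mathbb Z$, $(\omega_n/\gamma_n)_{n\in\mathbb N_0}$ and $(\alpha_n)_{n\in\mathbb N_0}$ both non-increasing, and $\sum_{j\in\mathbb Z}\alpha_j<\infty$. Let $\Phi_m=\max_{k\in\mathbb N}\{\frac{\omega_k}{\gamma_k}\min(1,\frac1{m\alpha_k})\}$ for $m\in\mathbb N$. Let $\delta_k^\alpha$, $K_{nm}^\alpha$, the estimators $\widehat\lambda_k$ and the partially adaptive dimension parameter $\widetilde k$ be as defined in the context. Then there is a constant $C>0$, not depending on $n$ and $m$, such that for any $n,m\in\mathbb N$, $$\sup_{\lambda\in\Lambda_\gamma^r}\ \sup_{f\in\mathcal F_\alpha^d}\mathbb E\big[\|\widehat\lambda_{\widetilde k}-\lambda\|_\omega^2\big]\ \le\ C\left(\min_{0\le k\le K_{nm}^\alpha}\max\Big\{\frac{\omega_k}{\gamma_k},\frac{\delta_k^\alpha}{n}\Big\}+\Phi_m+\frac1m+\frac1n\right).$$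
   Context: Notation. $\mathbb N=\{1,2,\dots\}$; $a\vee b=\max(a,b)$, $a\wedge b=\min(a,b)$; $\mathbb L^2=\mathbb L^2([0,1),dx)$; $\mathbf e_j(t)=\exp(2\pi i j t)$; for $g\in\mathbb L^2$, $[g]_j=\int_0^1 g(t)\mathbf e_j(-t)\,dt$. A sequence $(a_j)_{j\in\mathbb Z}$ is symmetric if $a_{-j}=a_j$. For a strictly positive symmetric sequence $\omega$, $\|g\|_\omega^2=\sum_{j\in\mathbb Z}\omega_j|[g]_j|^2$ and $\langle g,h\rangle_\omega=\sum_{j\in\mathbb Z}\omega_j[g]_j\overline{[h]_j}$. Observation model. $\lambda\in\mathbb L^2$ is a non-negative intensity function and $f\in\mathbb L^2$ a probability density on $[0,1)$, both unknown. Let $\widetilde N_i=\sum_j\delta_{x_{ij}}$, $i=1,\dots,n$, be independent Poisson point processes on $[0,1)$ with intensity function $\lambda$ (with respect to Lebesgue measure), and let $\epsilon_{ij}$ be i.i.d. with density $f$, independent of the $\widetilde N_i$. One observes $N_i=\sum_j\delta_{y_{ij}}$, $i=1,\dots,n$, where $y_{ij}=x_{ij}+\epsilon_{ij}-\lfloor x_{ij}+\epsilon_{ij}\rfloor$, so that $N_1,\dots,N_n$ are i.i.d. Poisson point processes on $[0,1)$ with intensity function the circular convolution $\ell(t)=(\lambda\star f)(t)=\int_0^1\lambda((t-\epsilon)-\lfloor t-\epsilon\rfloor)f(\epsilon)\,d\epsilon$. In addition, one observes an i.i.d. sample $Y_1,\dots,Y_m$ with density $f$, independent of $N_1,\dots,N_n$.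 $\mathbb E$ denotes expectation under the law of the observations given by $(\lambda,f)$. Estimator. For $k\in\mathbb N_0$, $$\widehat\lambda_k=\sum_{0\le|j|\le k}\frac{\widehat{[\ell]}_j}{\widehat{[f]}_j}\mathbf 1_{\Omega_j}\mathbf e_j,\quad \widehat{[\ell]}_j=\frac1n\sum_{i=1}^n\int_0^1\mathbf e_j(-t)\,dN_i(t),\quad \widehat{[f]}_j=\frac1m\sum_{i=1}^m\mathbf e_j(-Y_i),\quad \Omega_j=\{|\widehat{[f]}_j|^2\ge1/m\}.$$ Classes. $\Lambda_\gamma^r=\{\lambda\in\mathbb L^2:\lambda\ge0,\ \sum_{j\in\mathbb Z}\gamma_j|[\lambda]_j|^2\le r\}$ and $\mathcal F_\alpha^d=\{f\in\mathbb L^2: f\ge0,\ [f]_0=1,\ d^{-1}\le|[f]_j|^2/\alpha_j\le d\ \text{for all } j\in\mathbb Z\}$. Partially adaptive choice (the sequence $\alpha$ and the constant $d$ are known). For $k\in\mathbb N_0$ let $$\Delta_k^\alpha=\max_{0\le j\le k}\omega_j\alpha_j^{-1},\qquad \delta_k^\alpha=(2k+1)\Delta_k^\alpha\frac{\log(\Delta_k^\alpha\vee(k+3))}{\log(k+3)}.$$ With $\omega_j^+=\max_{0\le i\le j}\omega_i$ and the convention $\inf\emptyset=\infty$, let $$N_n^\alpha=\Big(\inf\Big\{1\le j\le n:\frac{\alpha_j}{2j+1}<\frac{\log(n+3)\,\omega_j^+}{n}\Big\}-1\Big)\wedge n,$$ $$M_m^\alpha=\Big(\inf\{1\le j\le m:\alpha_j<640\,d\,m^{-1}\log(m+1)\}-1\Big)\wedge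 m,$$ and $K_{nm}^\alpha=N_n^\alpha\wedge M_m^\alpha$. For $t\in\mathbb L^2$ define the contrast $\Upsilon(t)=\|t\|_\omega^2-2\,\mathrm{Re}\langle\widehat\lambda_{n\wedge m},t\rangle_\omega$, and the random penalties $\widetilde{\mathrm{pen}}_k=\frac{165}{2}\,d\,(\widehat{[\ell]}_0\vee1)\,\frac{\delta_k^\alpha}{n}$. Finally $$\widetilde k=\operatorname*{arg\,min}_{0\le k\le K_{nm}^\alpha}\{\Upsilon(\widehat\lambda_k)+\widetilde{\mathrm{pen}}_k\}.$$ *)

theory Defs
  imports "HOL-Probability.Probability"
begin

section \<open>Fourier coefficients and weighted norms\<close>

definition exp_basis :: "int \<Rightarrow> real \<Rightarrow> complex" where
  "exp_basis j t = exp (2 * complex_of_real pi * \<i> * of_int j * complex_of_real t)"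

definition fourier_coeff :: "(real \<Rightarrow> complex) \<Rightarrow> int \<Rightarrow> complex" where
  "fourier_coeff g j = (LINT t:{0..<1}|lborel. g t * exp_basis j (- t))"

text \<open>Functions on \<open>[0,1)\<close> are represented by functions on the reals whose values
  outside \<open>[0,1)\<close> are irrelevant.\<close>

definition square_integrable :: "(real \<Rightarrow> real) \<Rightarrow> bool" where
  "square_integrable g \<longleftrightarrow>
     set_borel_measurable lborel {0..<1} g \<and> set_integrable lborel {0..<1} (\<lambda>t. (g t)\<^sup>2)"

text \<open>Taken in the extended non-negative reals, so that a divergent sum is \<open>\<infinity>\<close> and not 0.\<close>

definition wnorm2 :: "(int \<Rightarrow> real) \<Rightarrow> (real \<Rightarrow> complex) \<Rightarrow> ennreal" where
  "wnorm2 \<omega> g = (\<Sum>\<^sub>\<infinity>j. ennreal (\<omega> j * (cmod (fourier_coeff g j))\<^sup>2))"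

definition winner :: "(int \<Rightarrow> real) \<Rightarrow> (real \<Rightarrow> complex) \<Rightarrow> (real \<Rightarrow> complex) \<Rightarrow> complex" where
  "winner \<omega> g h = (\<Sum>\<^sub>\<infinity>j. of_real (\<omega> j) * fourier_coeff g j * cnj (fourier_coeff h j))"

definition intensity_class :: "(int \<Rightarrow> real) \<Rightarrow> real \<Rightarrow> (real \<Rightarrow> real) set" where
  "intensity_class \<gamma> r = {lam. square_integrable lam \<and>
     (AE t in lborel. t \<in> {0..<1} \<longrightarrow> 0 \<le> lam t) \<and>
     wnorm2 \<gamma> (\<lambda>t. complex_of_real (lam t)) \<le> ennreal r}"

definition density_class :: "(int \<Rightarrow> real) \<Rightarrow> real \<Rightarrow> (real \<Rightarrow> real) set" where
  "density_class \<alpha> d = {f. square_integrable f \<and>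
     (AE t in lborel. t \<in> {0..<1} \<longrightarrow> 0 \<le> f t) \<and>
     fourier_coeff (\<lambda>t. complex_of_real (f t)) 0 = 1 \<and>
     (\<forall>j. 1 / d \<le> (cmod (fourier_coeff (\<lambda>t. complex_of_real (f t)) j))\<^sup>2 / \<alpha> j \<and>
          (cmod (fourier_coeff (\<lambda>t. complex_of_real (f t)) j))\<^sup>2 / \<alpha> j \<le> d)}"

section \<open>Point processes\<close>

text \<open>The smallest sigma-algebra on the measures on \<open>K\<close> making all evaluations
  \<open>N \<mapsto> N(A)\<close> measurable; as \<^const>\<open>subprob_algebra\<close>, without the bound on
  the total mass.\<close>

definition measure_algebra :: "'a measure \<Rightarrow> 'a measure measure" where
  "measure_algebra K =
     (SUP A\<in>sets K. vimage_algebra {N. sets N = sets K} (\<lambda>N. emeasure N A) borel)"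

text \<open>The sum of the Dirac measures at \<open>x 0, \<dots>, x (k - 1)\<close>, with multiplicities.\<close>

definition dirac_sum :: "nat \<Rightarrow> (nat \<Rightarrow> real) \<Rightarrow> real measure" where
  "dirac_sum k x = distr (count_space {..<k}) borel x"

lemma emeasure_dirac_sum:
  assumes "A \<in> sets borel"
  shows "emeasure (dirac_sum k x) A = of_nat (card {j. j < k \<and> x j \<in> A})"
proof -
  have "x -` A \<inter> {..<k} = {j. j < k \<and> x j \<in> A}" by auto
  then show ?thesis
    unfolding dirac_sum_def using assms
    by (simp add: emeasure_distr) (subst emeasure_count_space_finite, auto)
qed

text \<open>A Poisson point process on \<open>[0,1)\<close> with intensity function \<open>g\<close>, as a random measure on
  the reals that is carried by \<open>[0,1)\<close>.  The mean is allowed to be 0, which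
  \<^const>\<open>poisson_pmf\<close> is not made for.\<close>

definition poisson_point_process ::
  "'w measure \<Rightarrow> ('w \<Rightarrow> real measure) \<Rightarrow> (real \<Rightarrow> real) \<Rightarrow> bool" where
  "poisson_point_process M N g \<longleftrightarrow>
     N \<in> measurable M (measure_algebra borel) \<and>
     (\<forall>w\<in>space M. emeasure (N w) (- {0..<1}) = 0) \<and>
     (\<forall>A\<in>sets borel. \<forall>k::nat.
        measure M {w \<in> space M. emeasure (N w) A = of_nat k} =
          exp (- (LINT t:(A \<inter> {0..<1})|lborel. g t)) *
            (LINT t:(A \<inter> {0..<1})|lborel. g t) ^ k / fact k) \<and>
     (\<forall>A::nat \<Rightarrow> real set. range A \<subseteq> sets borel \<longrightarrow> disjoint_family A \<longrightarrow>
        prob_space.indep_vars M (\<lambda>_. borel) (\<lambda>i w. emeasure (N w) (A i)) UNIV)"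

section \<open>Observation model\<close>

text \<open>Independence of two random variables whose value types may differ
  (\<^const>\<open>prob_space.indep_var\<close> requires a common one).\<close>

definition (in prob_space) indep_pair ::
  "'b measure \<Rightarrow> ('a \<Rightarrow> 'b) \<Rightarrow> 'c measure \<Rightarrow> ('a \<Rightarrow> 'c) \<Rightarrow> bool" where
  "indep_pair S X T Y \<longleftrightarrow> random_variable S X \<and> random_variable T Y \<and>
     indep_set {X -` A \<inter> space M | A. A \<in> sets S} {Y -` B \<inter> space M | B. B \<in> sets T}"

text \<open>\<open>\<nu> i w\<close> is the number of points of the \<open>i\<close>-th unobserved process and
  \<open>x i j w\<close>, \<open>j < \<nu> i w\<close>, are its points; the other \<open>x i j w\<close> are dummies.\<close>

definition hidden_process ::
  "(nat \<Rightarrow> 'w \<Rightarrow> nat) \<Rightarrow> (nat \<Rightarrow> nat \<Rightarrow> 'w \<Rightarrow> real) \<Rightarrow> nat \<Rightarrow> 'w \<Rightarrow> real measure" where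
  "hidden_process \<nu> x i w = dirac_sum (\<nu> i w) (\<lambda>j. x i j w)"

definition observed_process ::
  "(nat \<Rightarrow> 'w \<Rightarrow> nat) \<Rightarrow> (nat \<Rightarrow> nat \<Rightarrow> 'w \<Rightarrow> real) \<Rightarrow> (nat \<Rightarrow> nat \<Rightarrow> 'w \<Rightarrow> real) \<Rightarrow>
     nat \<Rightarrow> 'w \<Rightarrow> real measure" where
  "observed_process \<nu> x \<epsilon> i w = dirac_sum (\<nu> i w) (\<lambda>j. frac (x i j w + \<epsilon> i j w))"

text \<open>The errors are independent of the hidden processes together with the enumeration of
  their points: an enumeration that depended on the errors would destroy the independence
  of a point and its own error.\<close>

locale deconvolution_model = prob_space M
  for M :: "'w measure" +
  fixes n m :: nat
    and lam f :: "real \<Rightarrow> real"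
    and \<nu> :: "nat \<Rightarrow> 'w \<Rightarrow> nat"
    and x \<epsilon> :: "nat \<Rightarrow> nat \<Rightarrow> 'w \<Rightarrow> real"
    and Y :: "nat \<Rightarrow> 'w \<Rightarrow> real"
  assumes hidden_poisson:
      "\<And>i. i \<in> {1..n} \<Longrightarrow> poisson_point_process M (hidden_process \<nu> x i) lam"
    and hidden_indep:
      "indep_vars (\<lambda>_. measure_algebra borel) (hidden_process \<nu> x) {1..n}"
    and error_density:
      "\<And>i j. i \<in> {1..n} \<Longrightarrow>
         distributed M lborel (\<epsilon> i j) (\<lambda>t. ennreal (f t * indicator {0..<1} t))"
    and error_indep:
      "indep_vars (\<lambda>_. borel) (\<lambda>(i, j). \<epsilon> i j) ({1..n} \<times> UNIV)"
    and error_indep_hidden: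
      "indep_pair
         (PiM {1..n} (\<lambda>_. count_space UNIV) \<Otimes>\<^sub>M PiM ({1..n} \<times> UNIV) (\<lambda>_. borel))
         (\<lambda>w. (\<lambda>i\<in>{1..n}. \<nu> i w, \<lambda>p\<in>{1..n} \<times> UNIV. x (fst p) (snd p) w))
         (PiM ({1..n} \<times> UNIV) (\<lambda>_. borel))
         (\<lambda>w. \<lambda>p\<in>{1..n} \<times> UNIV. \<epsilon> (fst p) (snd p) w)"
    and sample_density:
      "\<And>l. l \<in> {1..m} \<Longrightarrow>
         distributed M lborel (Y l) (\<lambda>t. ennreal (f t * indicator {0..<1} t))"
    and sample_indep:
      "indep_vars (\<lambda>_. borel) Y {1..m}"
    and sample_indep_observed:
      "indep_pair
         (PiM {1..m} (\<lambda>_. borel)) (\<lambda>w. \<lambda>l\<in>{1..m}. Y l w)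
         (PiM {1..n} (\<lambda>_. measure_algebra borel))
         (\<lambda>w. \<lambda>i\<in>{1..n}. observed_process \<nu> x \<epsilon> i w)"

section \<open>The estimator\<close>

text \<open>From here on \<open>N 1, \<dots>, N n\<close> and \<open>Y 1, \<dots>, Y m\<close> are realised observations.\<close>

definition ell_hat :: "nat \<Rightarrow> (nat \<Rightarrow> real measure) \<Rightarrow> int \<Rightarrow> complex" where
  "ell_hat n N j = (1 / of_nat n) * (\<Sum>i=1..n. (LINT t:{0..<1}|N i. exp_basis j (- t)))"

definition f_hat :: "nat \<Rightarrow> (nat \<Rightarrow> real) \<Rightarrow> int \<Rightarrow> complex" where
  "f_hat m Y j = (1 / of_nat m) * (\<Sum>i=1..m. exp_basis j (- Y i))"

definition lambda_hat ::
  "nat \<Rightarrow> nat \<Rightarrow> (nat \<Rightarrow> real measure) \<Rightarrow> (nat \<Rightarrow> real) \<Rightarrow> nat \<Rightarrow> real \<Rightarrow> complex" where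
  "lambda_hat n m N Y k t =
     (\<Sum>j\<in>{- int k..int k}.
        ell_hat n N j / f_hat m Y j *
        (if (cmod (f_hat m Y j))\<^sup>2 \<ge> 1 / real m then 1 else 0) * exp_basis j t)"

section \<open>The partially adaptive dimension parameter\<close>

definition Delta_alpha :: "(int \<Rightarrow> real) \<Rightarrow> (int \<Rightarrow> real) \<Rightarrow> nat \<Rightarrow> real" where
  "Delta_alpha \<omega> \<alpha> k = Max ((\<lambda>j. \<omega> (int j) / \<alpha> (int j)) ` {0..k})"

definition delta_alpha :: "(int \<Rightarrow> real) \<Rightarrow> (int \<Rightarrow> real) \<Rightarrow> nat \<Rightarrow> real" where
  "delta_alpha \<omega> \<alpha> k =
     (2 * real k + 1) * Delta_alpha \<omega> \<alpha> k *
     (ln (max (Delta_alpha \<omega> \<alpha> k) (real k + 3)) / ln (real k + 3))"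

definition omega_plus :: "(int \<Rightarrow> real) \<Rightarrow> nat \<Rightarrow> real" where
  "omega_plus \<omega> j = Max ((\<lambda>i. \<omega> (int i)) ` {0..j})"

text \<open>The infimum is taken in \<^typ>\<open>enat\<close>, where \<open>Inf {} = \<infinity>\<close> and \<open>\<infinity> - 1 = \<infinity>\<close>;
  the minimum with \<open>n\<close> (or \<open>m\<close>) is finite.\<close>

definition N_alpha :: "(int \<Rightarrow> real) \<Rightarrow> (int \<Rightarrow> real) \<Rightarrow> nat \<Rightarrow> nat" where
  "N_alpha \<omega> \<alpha> n = the_enat (min (Inf (enat ` {j. 1 \<le> j \<and> j \<le> n \<and>
      \<alpha> (int j) / (2 * real j + 1) < ln (real n + 3) * omega_plus \<omega> j / real n}) - 1) (enat n))"

definition M_alpha :: "(int \<Rightarrow> real) \<Rightarrow> real \<Rightarrow> nat \<Rightarrow> nat" where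
  "M_alpha \<alpha> d m = the_enat (min (Inf (enat ` {j. 1 \<le> j \<and> j \<le> m \<and>
      \<alpha> (int j) < 640 * d * (1 / real m) * ln (real m + 1)}) - 1) (enat m))"

definition K_alpha :: "(int \<Rightarrow> real) \<Rightarrow> (int \<Rightarrow> real) \<Rightarrow> real \<Rightarrow> nat \<Rightarrow> nat \<Rightarrow> nat" where
  "K_alpha \<omega> \<alpha> d n m = min (N_alpha \<omega> \<alpha> n) (M_alpha \<alpha> d m)"

text \<open>The contrast is evaluated only at trigonometric polynomials \<open>t\<close>, whose weighted norm
  is finite.\<close>

definition contrast ::
  "(int \<Rightarrow> real) \<Rightarrow> nat \<Rightarrow> nat \<Rightarrow> (nat \<Rightarrow> real measure) \<Rightarrow> (nat \<Rightarrow> real) \<Rightarrow>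
     (real \<Rightarrow> complex) \<Rightarrow> real" where
  "contrast \<omega> n m N Y t =
     enn2real (wnorm2 \<omega> t) - 2 * Re (winner \<omega> (lambda_hat n m N Y (min n m)) t)"

text \<open>\<open>ell_hat n N 0\<close> is real, being the mean number of observed points.\<close>

definition pen_tilde ::
  "(int \<Rightarrow> real) \<Rightarrow> (int \<Rightarrow> real) \<Rightarrow> real \<Rightarrow> nat \<Rightarrow> (nat \<Rightarrow> real measure) \<Rightarrow> nat \<Rightarrow> real" where
  "pen_tilde \<omega> \<alpha> d n N k =
     165 / 2 * d * max (Re (ell_hat n N 0)) 1 * (delta_alpha \<omega> \<alpha> k / real n)"

definition is_k_tilde ::
  "(int \<Rightarrow> real) \<Rightarrow> (int \<Rightarrow> real) \<Rightarrow> real \<Rightarrow> nat \<Rightarrow> nat \<Rightarrow> (nat \<Rightarrow> real measure) \<Rightarrow>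
     (nat \<Rightarrow> real) \<Rightarrow> nat \<Rightarrow> bool" where
  "is_k_tilde \<omega> \<alpha> d n m N Y =
     is_arg_min (\<lambda>k. contrast \<omega> n m N Y (lambda_hat n m N Y k) + pen_tilde \<omega> \<alpha> d n N k)
       (\<lambda>k. k \<le> K_alpha \<omega> \<alpha> d n m)"

text \<open>Since \<open>\<omega> / \<gamma>\<close> is bounded and \<open>\<alpha>\<close> tends to 0 in the setting of the theorem, this
  supremum is finite and attained.\<close>

definition Phi :: "(int \<Rightarrow> real) \<Rightarrow> (int \<Rightarrow> real) \<Rightarrow> (int \<Rightarrow> real) \<Rightarrow> nat \<Rightarrow> real" where
  "Phi \<omega> \<gamma> \<alpha> m =
     (SUP k\<in>{1::nat..}. \<omega> (int k) / \<gamma> (int k) * min 1 (1 / (real m * \<alpha> (int k))))"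

end

(* Write X j for the error of the estimated coefficient of the observed intensity.  The choice of
   k_tilde is a penalised choice in the Gaussian-sequence style, so everything reduces to bounding,
   uniformly in k, the excess of Delta k * (sum of |X j|^2 over |j| <= k) over half of the penalty.

   Only the Laplace transform E exp (sum of u over the observed points) <= exp (n * integral of
   exp u - 1) is used about the processes; it follows from the definition of the Poisson process by
   conditioning on the hidden points.  The deviation inequality for the sum of |X j|^2, usually quoted
   from Talagrand, is obtained by linearising the square with a Gaussian vector truncated to a ball:
   the expectation of the resulting Gaussian quadratic form is computed by eliminating the coordinates
   one by one, and the threshold is governed by the trace of the covariance, the exponent by its row
   sums, which are bounded since alpha is summable.

   The sample Y enters through the same Laplace bound.  Where some f_hat is off by a factor, an event
   of probability O(m^-4), the Cauchy-Schwarz inequality makes independence of the two samples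
   unnecessary. *)

theory Submission
  imports Defs
begin

section \<open>Gaussian vectors\<close>

text \<open>The quantity exp u - 1 - u in the Laplace bound is of order u^2 only for bounded u,
  while linearising a square by a Gaussian vector g produces functions u that are linear in g; hence
  the truncation. The ball has to be large enough to keep half of the tilted Gaussian mass and small
  enough for |u| \<le> 1/5. Both are possible if (2k + 1)^2 times the logarithmic factor of the
  penalty is O(n), which follows from the definition of \<open>N_alpha\<close> and from (2k + 1)
  \<alpha> k \<le> \<open>A\<close>.

  The constants of the procedure enter as follows. The real or imaginary part of
  \<open>f_hat\<close> j deviates by |f j| / sqrt 32 with probability at most 2 exp (- m |f j|^2 /
  128), and 640 = 5 * 128 turns this into 2 (m + 1)^(-5); one power is lost to the number of
  frequencies. Otherwise |f_hat j| is at least 3/4 |f j|, so the noise enters the loss with the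
  factor 2 (4/3)^2 d. With the threshold 5 this gives 160/9 \<le> 165/8, a quarter of 165/2: one
  factor 1/2 is the half of the penalty, the other allows the estimated mean number of points to be
  too small.\<close>

definition gauss :: "real measure" where
  "gauss = density lborel (\<lambda>x. ennreal (std_normal_density x))"

lemma prob_space_gauss: "prob_space gauss"
  unfolding gauss_def by (rule prob_space_normal_density) simp

interpretation gauss: prob_space gauss by (rule prob_space_gauss)

lemma sets_gauss [simp, measurable_cong]: "sets gauss = sets borel"
  by (simp add: gauss_def)

lemma space_gauss [simp]: "space gauss = UNIV"
  by (simp add: gauss_def)

text \<open>Completing the square turns the integrand into a constant times the normal density with
  mean y / (1 - a) and standard deviation 1 / sqrt (1 - a), whose total mass is 1.\<close>

lemma nn_integral_gauss_exp_quadratic: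
  assumes "a < 1"
  shows "(\<integral>\<^sup>+x. ennreal (exp (a * x\<^sup>2 / 2 + y * x)) \<partial>gauss) =
    ennreal ((1 - a) powr (- 1 / 2) * exp (y\<^sup>2 / (2 * (1 - a))))"
proof -
  define c where "c = 1 - a"
  have c: "c > 0" "a = 1 - c" using assms by (auto simp: c_def)
  have pw: "c powr (- 1 / 2) = 1 / sqrt c"
    using c by (simp add: powr_minus_divide powr_half_sqrt)
  have eq: "std_normal_density x * exp (a * x\<^sup>2 / 2 + y * x) =
      c powr (- 1 / 2) * exp (y\<^sup>2 / (2 * c)) * normal_density (y / c) (1 / sqrt c) x" for x
  proof -
    have "- x\<^sup>2 / 2 + (a * x\<^sup>2 / 2 + y * x) = y\<^sup>2 / (2 * c) + - (x - y / c)\<^sup>2 / (2 * (1 / sqrt c)\<^sup>2)"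
      unfolding c(2) using c(1) by (simp add: power_divide field_simps power2_eq_square)
    hence "exp (- x\<^sup>2 / 2) * exp (a * x\<^sup>2 / 2 + y * x) =
        exp (y\<^sup>2 / (2 * c)) * exp (- (x - y / c)\<^sup>2 / (2 * (1 / sqrt c)\<^sup>2))"
      by (metis exp_add)
    moreover have "1 / sqrt (2 * pi) = c powr (-1/2) * (1 / sqrt (2 * pi * (1 / sqrt c)\<^sup>2))"
      unfolding pw using c(1) by (simp add: real_sqrt_mult real_sqrt_divide power_divide)
    ultimately show ?thesis
      unfolding std_normal_density_def normal_density_def by (simp add: mult_ac)
  qed
  have pr: "prob_space (density lborel (\<lambda>x. ennreal (normal_density (y / c) (1 / sqrt c) x)))"
    using c by (intro prob_space_normal_density) simp
  have "(\<integral>\<^sup>+x. ennreal (exp (a * x\<^sup>2 / 2 + y * x)) \<partial>gauss) =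
      (\<integral>\<^sup>+x. ennreal (std_normal_density x * exp (a * x\<^sup>2 / 2 + y * x)) \<partial>lborel)"
    unfolding gauss_def
    by (subst nn_integral_density) (auto simp: ennreal_mult' normal_density_nonneg)
  also have "\<dots> = (\<integral>\<^sup>+x. ennreal (c powr (- 1 / 2) * exp (y\<^sup>2 / (2 * c))) *
      ennreal (normal_density (y / c) (1 / sqrt c) x) \<partial>lborel)"
    by (simp add: eq ennreal_mult' normal_density_nonneg)
  also have "\<dots> = ennreal (c powr (- 1 / 2) * exp (y\<^sup>2 / (2 * c))) *
      (\<integral>\<^sup>+x. ennreal (normal_density (y / c) (1 / sqrt c) x) \<partial>lborel)"
    by (subst nn_integral_cmult) auto
  also have "(\<integral>\<^sup>+x. ennreal (normal_density (y / c) (1 / sqrt c) x) \<partial>lborel) = 1"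
    using prob_space.emeasure_space_1[OF pr] by (simp add: emeasure_density)
  finally show ?thesis by (simp add: c_def)
qed

abbreviation gauss_pi :: "'i set \<Rightarrow> ('i \<Rightarrow> real) measure" where
  "gauss_pi I \<equiv> PiM I (\<lambda>_. gauss)"

interpretation gauss_product: product_sigma_finite "\<lambda>_::'i. gauss"
  by unfold_locales

lemma prob_space_gauss_pi: "prob_space (gauss_pi I)"
  by (rule prob_space_PiM) (rule prob_space_gauss)

text \<open>The coordinates are independent. The case a = 0 is the Laplace transform of the Gaussian
  vector; a = 1/2 controls what lies outside a ball.\<close>

lemma nn_integral_gauss_pi_exp_linear:
  assumes "finite I" and "a < 1"
  shows "(\<integral>\<^sup>+g. ennreal (exp (\<Sum>i\<in>I. a * (g i)\<^sup>2 / 2 + y i * g i)) \<partial>gauss_pi I) =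
    ennreal ((1 - a) powr (- real (card I) / 2) * exp ((\<Sum>i\<in>I. (y i)\<^sup>2) / (2 * (1 - a))))"
proof -
  have "(\<integral>\<^sup>+g. ennreal (exp (\<Sum>i\<in>I. a * (g i)\<^sup>2 / 2 + y i * g i)) \<partial>gauss_pi I) =
      (\<integral>\<^sup>+g. (\<Prod>i\<in>I. ennreal (exp (a * (g i)\<^sup>2 / 2 + y i * g i))) \<partial>gauss_pi I)"
    using assms by (simp add: exp_sum prod_ennreal)
  also have "\<dots> = (\<Prod>i\<in>I. \<integral>\<^sup>+x. ennreal (exp (a * x\<^sup>2 / 2 + y i * x)) \<partial>gauss)"
    using assms by (intro gauss_product.product_nn_integral_prod) auto
  also have "\<dots> = (\<Prod>i\<in>I. ennreal ((1 - a) powr (- 1 / 2) * exp ((y i)\<^sup>2 / (2 * (1 - a)))))"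
    using assms by (simp add: nn_integral_gauss_exp_quadratic)
  also have "\<dots> = ennreal ((\<Prod>i\<in>I. (1 - a) powr (- 1 / 2)) * (\<Prod>i\<in>I. exp ((y i)\<^sup>2 / (2 * (1 - a)))))"
    by (simp add: prod_ennreal prod.distrib)
  also have "(\<Prod>i\<in>I. (1 - a) powr (- 1 / 2)) = (1 - a) powr (- real (card I) / 2)"
    using assms by (simp add: powr_powr flip: powr_realpow)
  also have "(\<Prod>i\<in>I. exp ((y i)\<^sup>2 / (2 * (1 - a)))) = exp ((\<Sum>i\<in>I. (y i)\<^sup>2) / (2 * (1 - a)))"
    using assms by (simp add: exp_sum sum_divide_distrib)
  finally show ?thesis .
qed

text \<open>The integral over the whole space is exp (|y|^2 / 2). Outside the ball the factor exp
  ((|g|^2 - R) / 4) is at least 1; inserting it bounds the part cut off by 2^(card I / 2) * exp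
  (|y|^2 - R / 4), and \<open>R\<close> is chosen so that this is at most half of the whole.\<close>

lemma gauss_pi_ball_lower_bound:
  assumes "finite I" and "I \<noteq> {}"
    and R: "R \<ge> 5 * real (card I) + 2 * (\<Sum>i\<in>I. (y i)\<^sup>2)"
  shows "ennreal (exp ((\<Sum>i\<in>I. (y i)\<^sup>2) / 2) / 2) \<le>
    (\<integral>\<^sup>+g. ennreal (exp (\<Sum>i\<in>I. y i * g i)) * indicator {g. (\<Sum>i\<in>I. (g i)\<^sup>2) \<le> R} g \<partial>gauss_pi I)"
    (is "?lhs \<le> ?J")
proof -
  let ?s = "\<Sum>i\<in>I. (y i)\<^sup>2"
  let ?e = "\<lambda>g. exp (\<Sum>i\<in>I. (1/2) * (g i)\<^sup>2 / 2 + y i * g i)" and ?p = "(1/2) powr (- real (card I) / 2)"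
  let ?b = "\<lambda>g. ennreal (exp (\<Sum>i\<in>I. y i * g i)) * indicator {g. (\<Sum>i\<in>I. (g i)\<^sup>2) \<le> R} g"
  have [measurable]: "(\<lambda>g. \<Sum>i\<in>I. y i * g i) \<in> borel_measurable (gauss_pi I)"
    "(\<lambda>g. \<Sum>i\<in>I. (g i)\<^sup>2) \<in> borel_measurable (gauss_pi I)"
    using assms by (auto intro!: borel_measurable_sum)
  have card: "card I \<ge> 1" using assms by (simp add: Suc_leI card_gt_0_iff)
  define T where "T = (\<integral>\<^sup>+g. ennreal (?e g) \<partial>gauss_pi I)"
  have "ennreal (exp (?s / 2)) = (\<integral>\<^sup>+g. ennreal (exp (\<Sum>i\<in>I. y i * g i)) \<partial>gauss_pi I)"
    using nn_integral_gauss_pi_exp_linear[OF assms(1), of 0 y] by simp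
  also have "\<dots> \<le> (\<integral>\<^sup>+g. ?b g +
      ennreal (exp (- R / 4)) * ennreal (?e g) \<partial>gauss_pi I)"
  proof (rule nn_integral_mono)
    fix g
    show "ennreal (exp (\<Sum>i\<in>I. y i * g i)) \<le> ?b g +
        ennreal (exp (- R / 4)) * ennreal (?e g)"
    proof (cases "(\<Sum>i\<in>I. (g i)\<^sup>2) \<le> R")
      case False
      have "exp (\<Sum>i\<in>I. y i * g i) \<le> exp (- R / 4) * ?e g"
        using False by (simp add: sum.distrib flip: exp_add sum_divide_distrib)
      thus ?thesis using False by (simp flip: ennreal_mult')
    qed simp
  qed
  also have "\<dots> = ?J + ennreal (exp (- R / 4)) * T"
    unfolding T_def using assms(1)
    by (subst nn_integral_add) (auto simp: nn_integral_cmult)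
  also have "T = ennreal (?p * exp ?s)"
    unfolding T_def by (subst nn_integral_gauss_pi_exp_linear[OF assms(1)]) auto
  also have "ennreal (exp (- R / 4)) * \<dots> = ennreal (exp (- R / 4) * (?p * exp ?s))"
    by (simp flip: ennreal_mult')
  also have "\<dots> \<le> ennreal (exp (?s / 2) / 2)"
  proof (rule ennreal_leI)
    have l2: "ln 2 \<le> (1::real)" using ln_2_less_1 by simp
    have pw: "?p = exp (real (card I) / 2 * ln 2)"
      by (simp add: powr_def ln_div)
    have "exp (- R / 4) * (?p * exp ?s) =
        exp (- R / 4 + real (card I) / 2 * ln 2 + ?s)"
      unfolding pw by (simp flip: exp_add)
    also have "\<dots> \<le> exp (?s / 2 - ln 2)"
    proof -
      \<comment> \<open>Since \<open>I\<close> is nonempty, the ln 2 that produces the factor 1/2 is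
        absorbed into card I * ln 2.\<close>
      have "real (card I) / 2 * ln 2 + ln 2 \<le> real (card I) / 2 * ln 2 + real (card I) * ln 2"
        using card by simp
      also have "\<dots> = (3/2) * real (card I) * ln 2" by (simp add: algebra_simps)
      also have "ln 2 \<le> (25/36::real)" using ln2_le_25_over_36 .
      hence "(3/2) * real (card I) * ln 2 \<le> (3/2) * real (card I) * (25/36)" 
        by (intro mult_left_mono) auto
      finally have "real (card I) / 2 * ln 2 + ln 2 \<le> 5/4 * real (card I)" by simp
      thus ?thesis using R by simp
    qed
    also have "\<dots> = exp (?s / 2) / 2" by (simp add: exp_diff)
    finally show "exp (- R / 4) * (?p * exp ?s) \<le> exp (?s / 2) / 2" .
  qed
  finally have fin: "ennreal (exp (?s / 2)) \<le> ?J + ennreal (exp (?s / 2) / 2)"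
    by (simp add: add_left_mono)
  have split: "ennreal (exp (?s / 2)) = ennreal (exp (?s / 2) / 2) + ennreal (exp (?s / 2) / 2)"
    by (subst ennreal_plus[symmetric]) auto
  show ?thesis
    using fin unfolding split by (simp add: ennreal_add_left_cancel_le add.commute)
qed

text \<open>Integrating out one coordinate replaces the matrix by a Schur complement.  This does not
  increase the absolute row sums, and what it adds to a diagonal entry is paid for by the
  decrease of the row sum; hence the invariant on \<open>A j j + c * (\<Sum>l\<in>I. \<bar>A j l\<bar>)\<close>.\<close>

lemma nn_integral_gauss_pi_exp_quadratic_form:
  fixes A :: "'i \<Rightarrow> 'i \<Rightarrow> real"
  assumes "finite I" and r: "0 \<le> r" "r < 1" and B: "B < 1"
    and c: "c = r * (1 + r) / (1 - r)\<^sup>2"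
  assumes sym: "\<And>i j. i \<in> I \<Longrightarrow> j \<in> I \<Longrightarrow> A i j = A j i"
    and row: "\<And>j. j \<in> I \<Longrightarrow> (\<Sum>l\<in>I. \<bar>A j l\<bar>) \<le> r"
    and diag: "\<And>j. j \<in> I \<Longrightarrow> A j j + c * (\<Sum>l\<in>I. \<bar>A j l\<bar>) \<le> B"
  shows "(\<integral>\<^sup>+g. ennreal (exp ((\<Sum>i\<in>I. \<Sum>j\<in>I. A i j * g i * g j) / 2)) \<partial>gauss_pi I)
    \<le> ennreal ((1 - B) powr (- real (card I) / 2))"
  using assms(1) sym row diag
proof (induction I arbitrary: A rule: finite_induct)
  case empty
  interpret prob_space "gauss_pi {}" by (rule prob_space_gauss_pi)
  show ?case using B by (simp add: emeasure_space_1)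
next
  case (insert i I A)
  let ?J = "insert i I"
  define p where "p = 1 - A i i"
  have c0: "c \<ge> 0" using r c by simp
  have Aii: "\<bar>A i i\<bar> + (\<Sum>l\<in>I. \<bar>A i l\<bar>) \<le> r"
    using insert.prems(2)[of i] insert.hyps by simp
  have Aii1: "\<bar>A i i\<bar> \<le> r" using Aii by (smt (verit) sum_nonneg abs_ge_zero)
  have p: "p \<ge> 1 - r" "p > 0" "p \<le> 1 + r" using Aii1 r by (auto simp: p_def)
  have "A i i + c * (\<Sum>l\<in>?J. \<bar>A i l\<bar>) \<le> B" using insert.prems(3) by blast
  hence AiiB: "A i i \<le> B" using c0
    by (smt (verit) mult_nonneg_nonneg sum_nonneg abs_ge_zero)
  \<comment> \<open>The matrix 1 - \<open>A'\<close> is the Schur complement of 1 -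
    \<open>A\<close>: integrating exp (A i i * x^2 / 2 + s g * x) over x gives p powr (-1/2) * exp
    ((s g)^2 / (2 p)), so (s g)^2 / p is added to the form.\<close>
  define A' where "A' = (\<lambda>j l. A j l + A i j * A i l / p)"
  have IH: "(\<integral>\<^sup>+g. ennreal (exp ((\<Sum>i\<in>I. \<Sum>j\<in>I. A' i j * g i * g j) / 2)) \<partial>gauss_pi I)
      \<le> ennreal ((1 - B) powr (- real (card I) / 2))"
  proof (rule insert.IH)
    show "A' j l = A' l j" if "j \<in> I" "l \<in> I" for j l
      using insert.prems(1)[of j l] that by (simp add: A'_def mult.commute)
    \<comment> \<open>Row j loses its entry |A i j| and gains at most |A i j| / p times the rest of
      row i, which is at most r - |A i i|. Since p \<le> 1 + r, the net loss is at least the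
      subtracted term.\<close>
    have rowA': "(\<Sum>l\<in>I. \<bar>A' j l\<bar>) \<le> (\<Sum>l\<in>?J. \<bar>A j l\<bar>) - \<bar>A i j\<bar> * ((1 - r) / (1 + r))"
      if j: "j \<in> I" for j
    proof -
      have "(\<Sum>l\<in>I. \<bar>A' j l\<bar>) \<le> (\<Sum>l\<in>I. \<bar>A j l\<bar> + \<bar>A i j\<bar> / p * \<bar>A i l\<bar>)"
        unfolding A'_def using p
        by (intro sum_mono order.trans[OF abs_triangle_ineq]) (auto simp: abs_mult)
      also have "\<dots> = (\<Sum>l\<in>I. \<bar>A j l\<bar>) + \<bar>A i j\<bar> / p * (\<Sum>l\<in>I. \<bar>A i l\<bar>)"
        by (simp add: sum.distrib sum_distrib_left)
      also have "\<dots> \<le> (\<Sum>l\<in>I. \<bar>A j l\<bar>) + \<bar>A i j\<bar> / p * (r - \<bar>A i i\<bar>)"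
        using Aii p by (intro add_left_mono mult_left_mono) auto
      also have "\<dots> \<le> (\<Sum>l\<in>I. \<bar>A j l\<bar>) + \<bar>A i j\<bar> * (1 - (1 - r) / (1 + r))"
      proof -
        have "(1 - r) / (1 + r) \<le> (1 - r) / p"
          using p r by (intro divide_left_mono) auto
        also have "\<dots> \<le> (p - (r - \<bar>A i i\<bar>)) / p"
          using p by (intro divide_right_mono) (auto simp: p_def)
        also have "\<dots> = 1 - (r - \<bar>A i i\<bar>) / p" using p by (simp add: diff_divide_distrib)
        finally have "(r - \<bar>A i i\<bar>) / p \<le> 1 - (1 - r) / (1 + r)" by simp
        from mult_left_mono[OF this, of "\<bar>A i j\<bar>"] show ?thesis by simp
      qed
      also have "\<dots> = (\<Sum>l\<in>?J. \<bar>A j l\<bar>) - \<bar>A i j\<bar> * ((1 - r) / (1 + r))"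
        using insert.hyps insert.prems(1)[of j i] j by (simp add: algebra_simps)
      finally show ?thesis .
    qed
    show "(\<Sum>l\<in>I. \<bar>A' j l\<bar>) \<le> r" if "j \<in> I" for j
    proof -
      have "\<bar>A i j\<bar> * ((1 - r) / (1 + r)) \<ge> 0" using r by simp
      thus ?thesis using rowA'[OF that] insert.prems(2)[of j] that by simp
    qed
    show "A' j j + c * (\<Sum>l\<in>I. \<bar>A' j l\<bar>) \<le> B" if j: "j \<in> I" for j
    proof -
      have "\<bar>A i j\<bar> \<le> (\<Sum>l\<in>I. \<bar>A i l\<bar>)"
        using j insert.hyps by (intro member_le_sum) auto
      hence Aij: "\<bar>A i j\<bar> \<le> r" using Aii by simp
      have "A i j * A i j / p = \<bar>A i j\<bar> * (\<bar>A i j\<bar> / p)" by simp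
      also have "\<dots> \<le> \<bar>A i j\<bar> * (r / (1 - r))"
        using Aij p r by (intro mult_left_mono frac_le) auto
      \<comment> \<open>This identity determines \<open>c\<close>: the increase of the diagonal
        entry is at most |A i j| * r / (1 - r), exactly \<open>c\<close> times the guaranteed
        decrease of the row sum.\<close>
      also have "r / (1 - r) = c * ((1 - r) / (1 + r))"
      proof -
        have "r / u = r * v / u\<^sup>2 * (u / v)" if "u \<noteq> 0" "v \<noteq> 0" for u v :: real
          using that by (simp add: power2_eq_square)
        from this[of "1 - r" "1 + r"] show ?thesis unfolding c using r by linarith
      qed
      finally have "A' j j \<le> A j j + c * (\<bar>A i j\<bar> * ((1 - r) / (1 + r)))"
        by (simp add: A'_def algebra_simps)
      moreover have "c * (\<Sum>l\<in>I. \<bar>A' j l\<bar>) \<le> c * ((\<Sum>l\<in>?J. \<bar>A j l\<bar>) - \<bar>A i j\<bar> * ((1 - r) / (1 + r)))"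
        using rowA'[OF j] c0 by (rule mult_left_mono)
      ultimately show ?thesis
        using insert.prems(3)[of j] j by (simp add: right_diff_distrib)
    qed
  qed
  define q where "q = (\<lambda>g. \<Sum>j\<in>I. \<Sum>l\<in>I. A j l * g j * g l)"
  define s where "s = (\<lambda>g::'i\<Rightarrow>real. \<Sum>j\<in>I. A i j * g j)"
  have [measurable]: "q \<in> borel_measurable (gauss_pi I)" "s \<in> borel_measurable (gauss_pi I)"
    unfolding q_def s_def by (auto intro!: borel_measurable_sum)
  have expand: "(\<Sum>j\<in>?J. \<Sum>l\<in>?J. A j l * (g(i := x)) j * (g(i := x)) l) = A i i * x\<^sup>2 + 2 * x * s g + q g"
    for g x
  proof -
    have "A i l * x * (if l = i then x else g l) = x * (A i l * g l)"
      "A l i * (if l = i then x else g l) * x = x * (A i l * g l)" if "l \<in> I" for l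
      using insert.hyps insert.prems(1)[of l i] that by auto
    hence off: "(\<Sum>l\<in>I. A i l * x * (if l = i then x else g l)) = x * s g"
      "(\<Sum>j\<in>I. A j i * (if j = i then x else g j) * x) = x * s g"
      by (auto simp: s_def sum_distrib_left intro!: sum.cong)
    have qq: "(\<Sum>j\<in>I. \<Sum>l\<in>I. A j l * (if j = i then x else g j) * (if l = i then x else g l)) = q g"
      unfolding q_def using insert.hyps by (intro sum.cong refl) auto
    show ?thesis
      using insert.hyps by (simp add: sum.distrib off qq power2_eq_square)
  qed
  have q': "q g + (s g)\<^sup>2 / p = (\<Sum>j\<in>I. \<Sum>l\<in>I. A' j l * g j * g l)" for g
    unfolding q_def s_def A'_def
    by (simp add: power2_eq_square sum_product sum_divide_distrib algebra_simps flip: sum.distrib)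
  have "(\<integral>\<^sup>+g. ennreal (exp ((\<Sum>i\<in>?J. \<Sum>j\<in>?J. A i j * g i * g j) / 2)) \<partial>gauss_pi ?J) =
      (\<integral>\<^sup>+g. \<integral>\<^sup>+x. ennreal (exp ((\<Sum>j\<in>?J. \<Sum>l\<in>?J. A j l * (g(i := x)) j * (g(i := x)) l) / 2)) \<partial>gauss \<partial>gauss_pi I)"
    using insert.hyps by (intro gauss_product.product_nn_integral_insert) auto
  also have "\<dots> = (\<integral>\<^sup>+g. ennreal (exp (q g / 2)) *
      (\<integral>\<^sup>+x. ennreal (exp (A i i * x\<^sup>2 / 2 + s g * x)) \<partial>gauss) \<partial>gauss_pi I)"
  proof (rule nn_integral_cong)
    fix g
    have "(\<integral>\<^sup>+x. ennreal (exp ((\<Sum>j\<in>?J. \<Sum>l\<in>?J. A j l * (g(i := x)) j * (g(i := x)) l) / 2)) \<partial>gauss) =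
      (\<integral>\<^sup>+x. ennreal (exp (q g / 2)) * ennreal (exp (A i i * x\<^sup>2 / 2 + s g * x)) \<partial>gauss)"
      unfolding expand by (simp add: ennreal_mult'[symmetric] exp_add[symmetric] add_divide_distrib algebra_simps)
    thus "(\<integral>\<^sup>+x. ennreal (exp ((\<Sum>j\<in>?J. \<Sum>l\<in>?J. A j l * (g(i := x)) j * (g(i := x)) l) / 2)) \<partial>gauss) =
      ennreal (exp (q g / 2)) * (\<integral>\<^sup>+x. ennreal (exp (A i i * x\<^sup>2 / 2 + s g * x)) \<partial>gauss)"
      by (simp add: nn_integral_cmult)
  qed
  also have "\<dots> = (\<integral>\<^sup>+g. ennreal (p powr (- 1 / 2)) *
      ennreal (exp ((\<Sum>j\<in>I. \<Sum>l\<in>I. A' j l * g j * g l) / 2)) \<partial>gauss_pi I)"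
    using AiiB B unfolding q'[symmetric]
    by (subst nn_integral_gauss_exp_quadratic)
      (auto simp: p_def add_divide_distrib exp_add simp flip: ennreal_mult' intro!: nn_integral_cong)
  also have "\<dots> = ennreal (p powr (- 1 / 2)) *
      (\<integral>\<^sup>+g. ennreal (exp ((\<Sum>j\<in>I. \<Sum>l\<in>I. A' j l * g j * g l) / 2)) \<partial>gauss_pi I)"
    by (intro nn_integral_cmult) auto
  also have "\<dots> \<le> ennreal ((1 - B) powr (- 1 / 2)) * ennreal ((1 - B) powr (- real (card I) / 2))"
    using IH AiiB B by (intro mult_mono ennreal_leI powr_mono2') (auto simp: p_def)
  also have "\<dots> = ennreal ((1 - B) powr (- real (card ?J) / 2))"
    using insert.hyps
    by (simp add: ennreal_mult'[symmetric] powr_add[symmetric] diff_divide_distrib)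
  finally show ?case .
qed

section \<open>Laplace transforms of Poisson processes\<close>

lemma (in prob_space) indep_pair_distr:
  assumes "indep_pair S X T Y"
  shows "distr M (S \<Otimes>\<^sub>M T) (\<lambda>w. (X w, Y w)) = distr M S X \<Otimes>\<^sub>M distr M T Y"
proof (rule pair_measure_eqI[symmetric])
  from assms have [measurable]: "X \<in> measurable M S" "Y \<in> measurable M T"
    and ind: "indep_set {X -` A \<inter> space M | A. A \<in> sets S} {Y -` B \<inter> space M | B. B \<in> sets T}"
    by (auto simp: indep_pair_def)
  show "sigma_finite_measure (distr M S X)" "sigma_finite_measure (distr M T Y)"
    by (auto intro!: prob_space_imp_sigma_finite prob_space_distr)
  show "sets (distr M S X \<Otimes>\<^sub>M distr M T Y) = sets (distr M (S \<Otimes>\<^sub>M T) (\<lambda>w. (X w, Y w)))"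
    by (simp cong: sets_pair_measure_cong)
  fix A B assume "A \<in> sets (distr M S X)" "B \<in> sets (distr M T Y)"
  hence A [measurable]: "A \<in> sets S" and B [measurable]: "B \<in> sets T" by auto
  have "emeasure (distr M (S \<Otimes>\<^sub>M T) (\<lambda>w. (X w, Y w))) (A \<times> B) =
      emeasure M ((\<lambda>w. (X w, Y w)) -` (A \<times> B) \<inter> space M)"
    by (rule emeasure_distr) auto
  also have "(\<lambda>w. (X w, Y w)) -` (A \<times> B) \<inter> space M = (X -` A \<inter> space M) \<inter> (Y -` B \<inter> space M)"
    by auto
  also have "emeasure M \<dots> = emeasure M (X -` A \<inter> space M) * emeasure M (Y -` B \<inter> space M)"
  proof -
    have "prob ((X -` A \<inter> space M) \<inter> (Y -` B \<inter> space M)) =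
        prob (X -` A \<inter> space M) * prob (Y -` B \<inter> space M)"
      by (rule indep_setD[OF ind]) (use A B in blast)+
    thus ?thesis by (simp add: emeasure_eq_measure flip: ennreal_mult')
  qed
  finally show "emeasure (distr M S X) A * emeasure (distr M T Y) B =
      emeasure (distr M (S \<Otimes>\<^sub>M T) (\<lambda>w. (X w, Y w))) (A \<times> B)"
    by (simp add: emeasure_distr)
qed

definition intensity_measure :: "(real \<Rightarrow> real) \<Rightarrow> real measure" where
  "intensity_measure g = density lborel (\<lambda>t. ennreal (g t * indicator {0..<1} t))"

text \<open>The intensity measure of an observed process, written as the image of a product measure
  under addition modulo 1. Its integrals are double integrals over a hidden point and its
  error.\<close>

definition convolution_measure :: "(real \<Rightarrow> real) \<Rightarrow> (real \<Rightarrow> real) \<Rightarrow> real measure" where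
  "convolution_measure g f =
     distr (intensity_measure g \<Otimes>\<^sub>M intensity_measure f) borel (\<lambda>(s, e). frac (s + e))"

lemma sets_intensity_measure [simp, measurable_cong]: "sets (intensity_measure g) = sets borel"
  by (simp add: intensity_measure_def)

lemma space_intensity_measure [simp]: "space (intensity_measure g) = UNIV"
  by (simp add: intensity_measure_def)

lemma sets_convolution_measure [simp, measurable_cong]: "sets (convolution_measure g f) = sets borel"
  by (simp add: convolution_measure_def)

lemma borel_measurable_frac [measurable]: "(frac :: real \<Rightarrow> real) \<in> borel_measurable borel"
  unfolding frac_def by measurable

lemma borel_measurable_set_integrable_mult:
  fixes g :: "real \<Rightarrow> real"
  assumes "set_integrable lborel {0..<1} g"
  shows "(\<lambda>t. g t * indicator {0..<1} t) \<in> borel_measurable lborel"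
  using borel_measurable_integrable[OF assms[unfolded set_integrable_def]] by (simp add: mult.commute)

lemma integral_intensity_measure:
  fixes u :: "real \<Rightarrow> 'b::{banach, second_countable_topology}"
  assumes "set_integrable lborel {0..<1} g" "AE t in lborel. t \<in> {0..<1} \<longrightarrow> 0 \<le> g t"
    and "u \<in> borel_measurable borel"
  shows "integral\<^sup>L (intensity_measure g) u = (LINT t:{0..<1}|lborel. g t *\<^sub>R u t)"
proof -
  have "AE t in lborel. 0 \<le> g t * indicator {0..<1} t"
    using assms(2) by eventually_elim (auto simp: indicator_def)
  thus ?thesis
    unfolding intensity_measure_def set_lebesgue_integral_def
    using assms(3) borel_measurable_set_integrable_mult[OF assms(1)]
    by (subst integral_density) (auto simp: mult.commute)
qed

lemma finite_measure_intensity_measure: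
  assumes g: "set_integrable lborel {0..<1} g" "AE t in lborel. t \<in> {0..<1} \<longrightarrow> 0 \<le> g t"
  shows "finite_measure (intensity_measure g)"
proof
  have i: "integrable lborel (\<lambda>t. g t * indicator {0..<1} t)"
    using g(1) by (simp add: set_integrable_def mult.commute)
  have "emeasure (intensity_measure g) UNIV = (\<integral>\<^sup>+t. ennreal (g t * indicator {0..<1} t) \<partial>lborel)"
    unfolding intensity_measure_def using borel_measurable_integrable[OF i]
    by (simp add: emeasure_density)
  also have "\<dots> = ennreal (LINT t|lborel. g t * indicator {0..<1} t)"
    using g(2) by (intro nn_integral_eq_integral i) (auto elim!: eventually_mono simp: indicator_def)
  finally show "emeasure (intensity_measure g) (space (intensity_measure g)) \<noteq> \<infinity>" by simp
qed

lemma finite_measure_convolution_measure: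
  assumes "finite_measure (intensity_measure g)" "finite_measure (intensity_measure f)"
  shows "finite_measure (convolution_measure g f)"
proof -
  interpret G: finite_measure "intensity_measure g" by fact
  interpret F: finite_measure "intensity_measure f" by fact
  have "finite_measure (intensity_measure g \<Otimes>\<^sub>M intensity_measure f)"
    by (intro finite_measure_pair_measure assms)
  thus ?thesis unfolding convolution_measure_def
    by (rule finite_measure.finite_measure_distr) measurable
qed

lemma integral_convolution_measure:
  fixes u :: "real \<Rightarrow> 'b::{banach, second_countable_topology}"
  assumes "finite_measure (intensity_measure g)" "finite_measure (intensity_measure f)"
    and [measurable]: "u \<in> borel_measurable borel" and b: "\<And>t. norm (u t) \<le> b"
  shows "integral\<^sup>L (convolution_measure g f) u =
    (\<integral>s. (\<integral>e. u (frac (s + e)) \<partial>intensity_measure f) \<partial>intensity_measure g)"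
proof -
  interpret G: finite_measure "intensity_measure g" by fact
  interpret F: finite_measure "intensity_measure f" by fact
  interpret GF: finite_measure "intensity_measure g \<Otimes>\<^sub>M intensity_measure f"
    by (intro finite_measure_pair_measure assms)
  interpret pair_sigma_finite "intensity_measure g" "intensity_measure f" ..
  have i: "integrable (intensity_measure g \<Otimes>\<^sub>M intensity_measure f) (\<lambda>z. u (frac (fst z + snd z)))"
    by (rule GF.integrable_const_bound[of _ b]) (auto simp: b)
  show ?thesis
    unfolding convolution_measure_def using integral_fst'[OF i]
    by (subst integral_distr) (auto simp: case_prod_beta)
qed

text \<open>The count is a function of the measure alone and defined for every measure, so that it
  is measurable on \<open>measure_algebra borel\<close> and independence of the processes passes to
  it.\<close>

definition num_points :: "real measure \<Rightarrow> real set \<Rightarrow> nat" where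
  "num_points N A = nat \<lfloor>enn2real (emeasure N A)\<rfloor>"

lemma num_points_dirac_sum:
  "A \<in> sets borel \<Longrightarrow> num_points (dirac_sum k y) A = card {j. j < k \<and> y j \<in> A}"
  by (simp add: num_points_def emeasure_dirac_sum)

lemma measurable_emeasure_measure_algebra:
  "A \<in> sets K \<Longrightarrow> (\<lambda>N. emeasure N A) \<in> borel_measurable (measure_algebra K)"
  unfolding measure_algebra_def
  by (auto intro!: measurable_SUP1 measurable_vimage_algebra1)

lemma measurable_num_points [measurable]:
  "A \<in> sets borel \<Longrightarrow> (\<lambda>N. num_points N A) \<in> measurable (measure_algebra borel) (count_space UNIV)"
  unfolding num_points_def
  by (rule measurable_compose[OF measurable_emeasure_measure_algebra]) auto

text \<open>The generating function of the Poisson law, summed from the exponential series. By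
  \<open>fin\<close> the events that the count equals k cover the space.\<close>

lemma nn_integral_power_poisson_count:
  assumes "prob_space M" and "poisson_point_process M N g"
    and A: "A \<in> sets borel" and z: "z \<ge> 0"
    and fin: "\<And>w. w \<in> space M \<Longrightarrow> \<exists>k::nat. emeasure (N w) A = of_nat k"
    and pos: "(LINT t:(A \<inter> {0..<1})|lborel. g t) \<ge> 0"
  shows "(\<integral>\<^sup>+w. ennreal (z ^ num_points (N w) A) \<partial>M) =
    ennreal (exp ((z - 1) * (LINT t:(A \<inter> {0..<1})|lborel. g t)))"
proof -
  interpret prob_space M by fact
  let ?\<mu> = "LINT t:(A \<inter> {0..<1})|lborel. g t"
  have N [measurable]: "N \<in> measurable M (measure_algebra borel)"
    and pr: "\<And>k::nat. measure M {w \<in> space M. emeasure (N w) A = of_nat k} = exp (- ?\<mu>) * ?\<mu> ^ k / fact k"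
    using assms by (auto simp: poisson_point_process_def)
  have [measurable]: "(\<lambda>w. emeasure (N w) A) \<in> borel_measurable M"
    using measurable_compose[OF N measurable_emeasure_measure_algebra[OF A]] .
  have "(\<integral>\<^sup>+w. ennreal (z ^ num_points (N w) A) \<partial>M) =
      (\<integral>\<^sup>+w. (\<Sum>k. ennreal (z ^ k) * indicator {w \<in> space M. emeasure (N w) A = of_nat k} w) \<partial>M)"
  proof (rule nn_integral_cong)
    fix w assume w: "w \<in> space M"
    then obtain k :: nat where k: "emeasure (N w) A = of_nat k" using fin by blast
    hence ck: "num_points (N w) A = k" by (simp add: num_points_def)
    have "(\<Sum>i. ennreal (z ^ i) * indicator {w \<in> space M. emeasure (N w) A = of_nat i} w) =
        (\<Sum>i. if i = k then ennreal (z ^ i) else 0)"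
      using w k by (intro suminf_cong) (auto simp: indicator_def)
    also have "\<dots> = ennreal (z ^ k)"
      using sums_If_finite_set[of "{k}" "\<lambda>i. ennreal (z ^ i)"] by (simp add: sums_iff)
    finally show "ennreal (z ^ num_points (N w) A) =
        (\<Sum>i. ennreal (z ^ i) * indicator {w \<in> space M. emeasure (N w) A = of_nat i} w)"
      by (simp add: ck)
  qed
  also have "\<dots> = (\<Sum>k. ennreal (z ^ k) * emeasure M {w \<in> space M. emeasure (N w) A = of_nat k})"
    by (subst nn_integral_suminf) (auto simp: nn_integral_cmult)
  also have "\<dots> = (\<Sum>k. ennreal (exp (- ?\<mu>) * ((z * ?\<mu>) ^ k /\<^sub>R fact k)))"
    using z by (intro suminf_cong)
      (simp add: emeasure_eq_measure pr power_mult_distrib field_simps flip: ennreal_mult')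
  also have "\<dots> = ennreal (\<Sum>k. exp (- ?\<mu>) * ((z * ?\<mu>) ^ k /\<^sub>R fact k))"
    using z pos exp_converges[of "z * ?\<mu>"] 
    by (intro suminf_ennreal2 summable_mult) (auto simp: sums_iff)
  also have "(\<Sum>k. exp (- ?\<mu>) * ((z * ?\<mu>) ^ k /\<^sub>R fact k)) = exp (- ?\<mu>) * exp (z * ?\<mu>)"
    using sums_mult[OF exp_converges[of "z * ?\<mu>"], of "exp (- ?\<mu>)"] by (simp add: sums_iff)
  also have "\<dots> = exp ((z - 1) * ?\<mu>)"
    by (simp add: algebra_simps flip: exp_add)
  finally show ?thesis .
qed

text \<open>Since only an upper bound on the Laplace transform is needed, the integrand is rounded up to a
  multiple of \<open>\<delta>\<close>, and no limit theorem for the processes is involved.\<close>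

definition level_set :: "(real \<Rightarrow> real) \<Rightarrow> real \<Rightarrow> nat \<Rightarrow> real set" where
  "level_set h \<delta> a = {t. nat \<lceil>h t / \<delta>\<rceil> = a}"

text \<open>The product, over the points, of the values of \<open>h\<close> rounded up to a multiple
  of \<open>\<delta>\<close>. Grouping the points by level makes it a function of the counts in
  disjoint sets, and these are independent.\<close>

definition step_product :: "(real \<Rightarrow> real) \<Rightarrow> real \<Rightarrow> nat \<Rightarrow> real measure \<Rightarrow> real" where
  "step_product h \<delta> K N = (\<Prod>a\<le>K. (\<delta> * real a) ^ num_points N (level_set h \<delta> a))"

lemma level_set_borel [measurable]:
  assumes [measurable]: "h \<in> borel_measurable borel"
  shows "level_set h \<delta> a \<in> sets borel"
proof -
  have "(\<lambda>t. nat \<lceil>h t / \<delta>\<rceil>) -` {a} \<inter> space borel \<in> sets borel"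
    by (rule measurable_sets[where A = "count_space UNIV"]) measurable
  thus ?thesis by (simp add: level_set_def vimage_def)
qed

lemma measurable_step_product [measurable]:
  assumes [measurable]: "h \<in> borel_measurable borel"
  shows "step_product h \<delta> K \<in> borel_measurable (measure_algebra borel)"
  unfolding step_product_def[abs_def] by measurable

lemma level_bounds:
  fixes v :: real
  assumes "0 \<le> v" "v \<le> b" "\<delta> > 0" "b / \<delta> \<le> real K"
  shows "nat \<lceil>v / \<delta>\<rceil> \<le> K" "v \<le> \<delta> * real (nat \<lceil>v / \<delta>\<rceil>)" "\<delta> * real (nat \<lceil>v / \<delta>\<rceil>) \<le> v + \<delta>"
proof -
  have b: "0 \<le> v / \<delta>" "v / \<delta> \<le> b / \<delta>" using assms by (auto intro: divide_right_mono)
  thus "nat \<lceil>v / \<delta>\<rceil> \<le> K" using assms(4) by linarith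
  have "v / \<delta> \<le> real (nat \<lceil>v / \<delta>\<rceil>)" "real (nat \<lceil>v / \<delta>\<rceil>) \<le> v / \<delta> + 1" using b by linarith+
  from this[THEN mult_left_mono, of \<delta>] \<open>\<delta> > 0\<close>
  show "v \<le> \<delta> * real (nat \<lceil>v / \<delta>\<rceil>)" "\<delta> * real (nat \<lceil>v / \<delta>\<rceil>) \<le> v + \<delta>"
    by (simp_all add: distrib_left)
qed

lemma prod_le_step_product:
  assumes h: "h \<in> borel_measurable borel"
    and b: "\<And>t. 0 \<le> h t" "\<And>t. h t \<le> b" and \<delta>: "\<delta> > 0" "b / \<delta> \<le> real K"
  shows "(\<Prod>j<k. h (y j)) \<le> step_product h \<delta> K (dirac_sum k y)"
proof -
  let ?a = "\<lambda>t. nat \<lceil>h t / \<delta>\<rceil>"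
  note a = level_bounds[OF b(1) b(2) \<delta>]
  have "(\<Prod>j<k. h (y j)) \<le> (\<Prod>j<k. \<delta> * real (?a (y j)))"
    using a(2) b by (intro prod_mono) auto
  also have "\<dots> = (\<Prod>a\<le>K. \<Prod>j | j \<in> {..<k} \<and> ?a (y j) = a. \<delta> * real (?a (y j)))"
    using a(1) by (intro prod.group[symmetric]) auto
  also have "\<dots> = (\<Prod>a\<le>K. \<Prod>j | j < k \<and> y j \<in> level_set h \<delta> a. \<delta> * real a)"
    by (intro prod.cong refl) (auto simp: level_set_def)
  also have "\<dots> = step_product h \<delta> K (dirac_sum k y)"
    using h by (simp add: step_product_def num_points_dirac_sum)
  finally show ?thesis .
qed

text \<open>The counts in the level sets are independent Poisson variables, so the expectation is a
  product of generating functions. Their exponents add up to the integral of the rounded function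
  minus 1 over the levels up to \<open>K\<close>, which include all values of \<open>h\<close>;
  rounding adds at most \<open>\<delta>\<close>.\<close>

lemma nn_integral_step_product:
  fixes \<nu> :: "'w \<Rightarrow> nat" and y :: "nat \<Rightarrow> 'w \<Rightarrow> real"
  assumes "prob_space M" and P: "poisson_point_process M (\<lambda>w. dirac_sum (\<nu> w) (\<lambda>j. y j w)) g"
    and h [measurable]: "h \<in> borel_measurable borel"
    and b: "\<And>t. 0 \<le> h t" "\<And>t. h t \<le> b" and \<delta>: "\<delta> > 0" "b / \<delta> \<le> real K"
    and g: "set_integrable lborel {0..<1} g" "AE t in lborel. t \<in> {0..<1} \<longrightarrow> 0 \<le> g t"
  shows "(\<integral>\<^sup>+w. ennreal (step_product h \<delta> K (dirac_sum (\<nu> w) (\<lambda>j. y j w))) \<partial>M) \<le>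
    ennreal (exp (\<integral>t. h t + \<delta> - 1 \<partial>intensity_measure g))"
proof -
  interpret prob_space M by fact
  interpret \<Lambda>: finite_measure "intensity_measure g" using g by (rule finite_measure_intensity_measure)
  let ?N = "\<lambda>w. dirac_sum (\<nu> w) (\<lambda>j. y j w)"
  let ?L = "level_set h \<delta>"
  have mass: "(LINT t:(A \<inter> {0..<1})|lborel. g t) = measure (intensity_measure g) A" if "A \<in> sets borel" for A
  proof -
    have "measure (intensity_measure g) A = (\<integral>t. indicator A t \<partial>intensity_measure g)" by simp
    also have "\<dots> = (LINT t:{0..<1}|lborel. g t *\<^sub>R indicator A t)"
      using that by (intro integral_intensity_measure g) auto
    also have "\<dots> = (LINT t:(A \<inter> {0..<1})|lborel. g t)"
      by (simp add: set_lebesgue_integral_def indicator_inter_arith mult_ac)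
    finally show ?thesis by simp
  qed
  have "disjoint_family ?L" by (auto simp: disjoint_family_on_def level_set_def)
  moreover have "range ?L \<subseteq> sets borel" using level_set_borel[OF h] by auto
  ultimately have "indep_vars (\<lambda>_. borel) (\<lambda>i w. emeasure (?N w) (?L i)) UNIV"
    using P unfolding poisson_point_process_def by (elim conjE allE[of _ ?L]) simp
  hence "indep_vars (\<lambda>_. borel) (\<lambda>i w. emeasure (?N w) (?L i)) {..K}"
    by (rule indep_vars_subset) simp
  hence ind: "indep_vars (\<lambda>_. borel) (\<lambda>i w. ennreal ((\<delta> * real i) ^ nat \<lfloor>enn2real (emeasure (?N w) (?L i))\<rfloor>)) {..K}"
    by (rule indep_vars_compose2) measurable
  have "(\<integral>\<^sup>+w. ennreal (step_product h \<delta> K (?N w)) \<partial>M) =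
      (\<integral>\<^sup>+w. (\<Prod>a\<le>K. ennreal ((\<delta> * real a) ^ num_points (?N w) (?L a))) \<partial>M)"
    using \<delta>(1) by (simp add: step_product_def prod_ennreal)
  also have "\<dots> = (\<Prod>a\<le>K. \<integral>\<^sup>+w. ennreal ((\<delta> * real a) ^ num_points (?N w) (?L a)) \<partial>M)"
    using ind unfolding num_points_def by (intro indep_vars_nn_integral) auto
  also have "\<dots> = (\<Prod>a\<le>K. ennreal (exp ((\<delta> * real a - 1) * measure (intensity_measure g) (?L a))))"
  proof (intro prod.cong refl)
    fix a :: nat
    have "\<exists>k::nat. emeasure (?N w) (?L a) = of_nat k" for w
      by (simp only: emeasure_dirac_sum[OF level_set_borel[OF h]]) blast
    from nn_integral_power_poisson_count[OF \<open>prob_space M\<close> P level_set_borel[OF h] _ this, of "\<delta> * real a"]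
    show "(\<integral>\<^sup>+w. ennreal ((\<delta> * real a) ^ num_points (?N w) (?L a)) \<partial>M) =
        ennreal (exp ((\<delta> * real a - 1) * measure (intensity_measure g) (?L a)))"
      using \<delta>(1) by (simp add: mass)
  qed
  also have "\<dots> = ennreal (exp (\<Sum>a\<le>K. \<integral>t. (\<delta> * real a - 1) * indicator (?L a) t \<partial>intensity_measure g))"
    by (simp add: prod_ennreal exp_sum)
  also have "\<dots> \<le> ennreal (exp (\<integral>t. h t + \<delta> - 1 \<partial>intensity_measure g))"
  proof (intro ennreal_leI iffD2[OF exp_le_cancel_iff])
    have "(\<Sum>a\<le>K. \<integral>t. (\<delta> * real a - 1) * indicator (?L a) t \<partial>intensity_measure g) =
        (\<integral>t. (\<Sum>a\<le>K. (\<delta> * real a - 1) * indicator (?L a) t) \<partial>intensity_measure g)"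
      by (intro Bochner_Integration.integral_sum[symmetric] integrable_mult_right \<Lambda>.integrable_const_bound[of _ 1]) auto
    also have "\<dots> \<le> (\<integral>t. h t + \<delta> - 1 \<partial>intensity_measure g)"
    proof (rule integral_mono)
      show "integrable (intensity_measure g) (\<lambda>t. h t + \<delta> - 1)"
      proof (intro \<Lambda>.integrable_const_bound[of _ "b + \<delta> + 1"] AE_I2)
        show "norm (h t + \<delta> - 1) \<le> b + \<delta> + 1" for t
          using b(1)[of t] b(2)[of t] \<delta>(1) by (simp add: abs_le_iff)
      qed measurable
      fix t
      have "(\<Sum>a\<le>K. (\<delta> * real a - 1) * indicator (?L a) t) =
          (\<Sum>a\<le>K. if a = nat \<lceil>h t / \<delta>\<rceil> then \<delta> * real a - 1 else 0)"
        by (intro sum.cong) (auto simp: level_set_def)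
      thus "(\<Sum>a\<le>K. (\<delta> * real a - 1) * indicator (?L a) t) \<le> h t + \<delta> - 1"
        using level_bounds[OF b(1) b(2) \<delta>, of t] by simp
    qed (intro Bochner_Integration.integrable_sum integrable_mult_right \<Lambda>.integrable_const_bound[of _ 1], auto)
    finally show "(\<Sum>a\<le>K. \<integral>t. (\<delta> * real a - 1) * indicator (?L a) t \<partial>intensity_measure g) \<le>
        (\<integral>t. h t + \<delta> - 1 \<partial>intensity_measure g)" .
  qed
  finally show ?thesis .
qed

section \<open>The Laplace transform of the observed processes\<close>

lemma (in deconvolution_model) measurable_model:
  assumes "i \<in> {1..n}"
  shows "\<nu> i \<in> measurable M (count_space UNIV)" "x i j \<in> borel_measurable M" "\<epsilon> i j \<in> borel_measurable M"
proof -
  let ?H = "\<lambda>w. (\<lambda>i\<in>{1..n}. \<nu> i w, \<lambda>p\<in>{1..n} \<times> UNIV. x (fst p) (snd p) w)"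
  have H: "?H \<in> measurable M (PiM {1..n} (\<lambda>_. count_space UNIV) \<Otimes>\<^sub>M PiM ({1..n} \<times> UNIV) (\<lambda>_. borel))"
    using error_indep_hidden by (auto simp: indep_pair_def)
  show "\<nu> i \<in> measurable M (count_space UNIV)"
    using measurable_compose[OF measurable_compose[OF H measurable_fst] measurable_component_singleton[OF assms]] assms
    by simp
  show "x i j \<in> borel_measurable M"
    using measurable_compose[OF measurable_compose[OF H measurable_snd] measurable_component_singleton[of "(i, j)"]] assms
    by simp
  show "\<epsilon> i j \<in> borel_measurable M"
    using distributed_measurable[OF error_density[OF assms, of j]] by simp
qed

lemma (in deconvolution_model) distr_error:
  "i \<in> {1..n} \<Longrightarrow> distr M lborel (\<epsilon> i j) = intensity_measure f"
  using distributed_distr_eq_density[OF error_density] by (simp add: intensity_measure_def)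

text \<open>Given the hidden points and their enumeration, the errors are still i.i.d. with density
  f, so a hidden point s contributes the factor \<open>h s\<close>, the mean of exp u over its
  error. What remains is a product of \<open>h\<close> over the points of independent Poisson
  processes, to which the step products apply.\<close>

lemma (in deconvolution_model) nn_integral_exp_observed:
  assumes n: "n \<ge> 1"
    and lam: "set_integrable lborel {0..<1} lam" "AE t in lborel. t \<in> {0..<1} \<longrightarrow> 0 \<le> lam t"
    and u [measurable]: "u \<in> borel_measurable borel" and b: "\<And>t. \<bar>u t\<bar> \<le> b"
  shows "(\<integral>\<^sup>+w. ennreal (exp (\<Sum>i=1..n. \<Sum>j<\<nu> i w. u (frac (x i j w + \<epsilon> i j w)))) \<partial>M) \<le>
    ennreal (exp (real n * (LINT t|convolution_measure lam f. exp (u t) - 1)))"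
proof -
  note One_nat_def [simp del]
  let ?F = "intensity_measure f"
  note dist = distr_error and eps [measurable] = measurable_model(3)
  interpret F: prob_space ?F
    using prob_space_distr[of "\<epsilon> 1 0" lborel] dist[of 1 0] eps[of 1 0] n by auto
  interpret G: finite_measure "intensity_measure lam"
    using lam by (rule finite_measure_intensity_measure)
  let ?S1 = "PiM {1..n} (\<lambda>_. count_space (UNIV :: nat set))"
  let ?S2 = "PiM ({1..n} \<times> (UNIV :: nat set)) (\<lambda>_. borel :: real measure)"
  let ?H = "\<lambda>w. (\<lambda>i\<in>{1..n}. \<nu> i w, \<lambda>p\<in>{1..n} \<times> UNIV. x (fst p) (snd p) w)"
  let ?E = "\<lambda>w. \<lambda>p\<in>{1..n} \<times> UNIV. \<epsilon> (fst p) (snd p) w"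
  have H [measurable]: "?H \<in> measurable M (?S1 \<Otimes>\<^sub>M ?S2)" and E [measurable]: "?E \<in> measurable M ?S2"
    using error_indep_hidden by (auto simp: indep_pair_def)
  define h where "h = (\<lambda>s. \<integral>e. exp (u (frac (s + e))) \<partial>?F)"
  have h [measurable]: "h \<in> borel_measurable borel"
    unfolding h_def by measurable
  have hint: "integrable ?F (\<lambda>e. exp (u (frac (s + e))))" for s
    by (rule F.integrable_const_bound[of _ "exp b"]) (use b in \<open>auto simp: abs_le_iff\<close>)
  have h0: "h s \<ge> 0" for s unfolding h_def by (rule integral_nonneg_AE) simp
  have hb: "h s \<le> exp b" for s
  proof -
    have "h s \<le> (\<integral>e. exp b \<partial>?F)" unfolding h_def
      by (intro integral_mono hint) (use b in \<open>auto simp: abs_le_iff\<close>)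
    thus ?thesis using F.prob_space by simp
  qed
  \<comment> \<open>The integrand as a function of the hidden variables and of the errors
    separately, so that independence of the two groups can be used through Fubini's theorem.\<close>
  define G where "G = (\<lambda>z :: ((nat \<Rightarrow> nat) \<times> (nat \<times> nat \<Rightarrow> real)) \<times> (nat \<times> nat \<Rightarrow> real).
    \<Prod>i=1..n. \<Prod>j<fst (fst z) i. ennreal (exp (u (frac (snd (fst z) (i, j) + snd z (i, j))))))"
  have G [measurable]: "G \<in> borel_measurable ((?S1 \<Otimes>\<^sub>M ?S2) \<Otimes>\<^sub>M ?S2)"
    unfolding G_def
  proof (rule borel_measurable_prod_ennreal)
    fix i assume i: "i \<in> {1..n}"
    have c: "(\<lambda>z. fst (fst z) i) \<in> measurable ((?S1 \<Otimes>\<^sub>M ?S2) \<Otimes>\<^sub>M ?S2) (count_space UNIV)"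
      using measurable_compose[OF measurable_compose[OF measurable_fst measurable_fst] measurable_component_singleton[OF i]] .
    show "(\<lambda>z. \<Prod>j<fst (fst z) i. ennreal (exp (u (frac (snd (fst z) (i, j) + snd z (i, j))))))
      \<in> borel_measurable ((?S1 \<Otimes>\<^sub>M ?S2) \<Otimes>\<^sub>M ?S2)"
    \<comment> \<open>The number of factors is itself a coordinate of z; it takes countably many
      values, and for a fixed value k the product is measurable.\<close>
    proof (rule measurable_compose_countable[OF _ c])
      fix k :: nat
      have [measurable]: "(\<lambda>z. snd (fst z) (i, j)) \<in> borel_measurable ((?S1 \<Otimes>\<^sub>M ?S2) \<Otimes>\<^sub>M ?S2)"
        "(\<lambda>z. snd z (i, j)) \<in> borel_measurable ((?S1 \<Otimes>\<^sub>M ?S2) \<Otimes>\<^sub>M ?S2)" for j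
        using i measurable_compose[OF measurable_compose[OF measurable_fst measurable_snd] measurable_component_singleton]
          measurable_compose[OF measurable_snd measurable_component_singleton] by auto
      show "(\<lambda>z. \<Prod>j<k. ennreal (exp (u (frac (snd (fst z) (i, j) + snd z (i, j))))))
        \<in> borel_measurable ((?S1 \<Otimes>\<^sub>M ?S2) \<Otimes>\<^sub>M ?S2)"
        by measurable
    qed
  qed
  let ?J = "\<lambda>w. SIGMA i:{1..n}. {..<\<nu> i w}"
  have pe: "(\<integral>\<^sup>+w'. ennreal (exp (u (frac (c + \<epsilon> i j w')))) \<partial>M) = ennreal (h c)"
    if i: "i \<in> {1..n}" for i j c
  proof -
    have "(\<integral>\<^sup>+w'. ennreal (exp (u (frac (c + \<epsilon> i j w')))) \<partial>M) =
        (\<integral>\<^sup>+e. ennreal (exp (u (frac (c + e)))) \<partial>distr M lborel (\<epsilon> i j))"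
      using eps[OF i, of j] by (subst nn_integral_distr) auto
    thus ?thesis unfolding dist[OF i] h_def by (simp add: nn_integral_eq_integral[OF hint])
  qed
  have inner: "(\<integral>\<^sup>+w'. G (?H w, ?E w') \<partial>M) = (\<Prod>i=1..n. \<Prod>j<\<nu> i w. ennreal (h (x i j w)))" for w
  proof -
    have "(\<integral>\<^sup>+w'. G (?H w, ?E w') \<partial>M) =
        (\<integral>\<^sup>+w'. (\<Prod>p\<in>?J w. ennreal (exp (u (frac (x (fst p) (snd p) w + \<epsilon> (fst p) (snd p) w'))))) \<partial>M)"
      unfolding G_def
      by (intro nn_integral_cong) (simp add: prod.Sigma case_prod_unfold)
    also have "\<dots> = (\<Prod>p\<in>?J w. \<integral>\<^sup>+w'. ennreal (exp (u (frac (x (fst p) (snd p) w + \<epsilon> (fst p) (snd p) w')))) \<partial>M)"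
    proof (rule indep_vars_nn_integral)
      have "indep_vars (\<lambda>_. borel) (\<lambda>p. \<epsilon> (fst p) (snd p)) (?J w)"
        using indep_vars_subset[OF error_indep, of "?J w"] by (auto simp: case_prod_unfold)
      thus "indep_vars (\<lambda>_. borel)
          (\<lambda>p w'. ennreal (exp (u (frac (x (fst p) (snd p) w + \<epsilon> (fst p) (snd p) w'))))) (?J w)"
        by (rule indep_vars_compose2[where Y = "\<lambda>p e. ennreal (exp (u (frac (x (fst p) (snd p) w + e))))"])
          measurable
    qed auto
    also have "\<dots> = (\<Prod>p\<in>?J w. ennreal (h (x (fst p) (snd p) w)))"
      by (intro prod.cong refl pe) auto
    also have "\<dots> = (\<Prod>i=1..n. \<Prod>j<\<nu> i w. ennreal (h (x i j w)))"
      by (simp add: prod.Sigma case_prod_unfold)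
    finally show ?thesis .
  qed
  have "(\<integral>\<^sup>+w. ennreal (exp (\<Sum>i=1..n. \<Sum>j<\<nu> i w. u (frac (x i j w + \<epsilon> i j w)))) \<partial>M) =
      (\<integral>\<^sup>+w. G (?H w, ?E w) \<partial>M)"
    by (intro nn_integral_cong) (auto simp: G_def exp_sum prod_ennreal prod_nonneg intro!: prod.cong)
  also have "\<dots> = (\<integral>\<^sup>+z. G z \<partial>distr M ((?S1 \<Otimes>\<^sub>M ?S2) \<Otimes>\<^sub>M ?S2) (\<lambda>w. (?H w, ?E w)))"
    by (rule nn_integral_distr[OF measurable_Pair[OF H E], symmetric]) (simp add: G del: One_nat_def)
  also have "\<dots> = (\<integral>\<^sup>+s. \<integral>\<^sup>+t. G (s, t) \<partial>distr M ?S2 ?E \<partial>distr M (?S1 \<Otimes>\<^sub>M ?S2) ?H)"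
  proof -
    interpret E: prob_space "distr M ?S2 ?E" by (rule prob_space_distr) simp
    show ?thesis
      unfolding indep_pair_distr[OF error_indep_hidden] by (subst E.nn_integral_fst) auto
  qed
  also have "\<dots> = (\<integral>\<^sup>+w. \<integral>\<^sup>+t. G (?H w, t) \<partial>distr M ?S2 ?E \<partial>M)"
  proof -
    interpret E: prob_space "distr M ?S2 ?E" by (rule prob_space_distr) simp
    show ?thesis
      by (subst nn_integral_distr) (auto intro!: E.borel_measurable_nn_integral)
  qed
  also have "\<dots> = (\<integral>\<^sup>+w. \<integral>\<^sup>+w'. G (?H w, ?E w') \<partial>M \<partial>M)"
  proof (rule nn_integral_cong)
    fix w assume w: "w \<in> space M"
    have "(\<lambda>t. G (?H w, t)) \<in> borel_measurable ?S2"
      using measurable_space[OF H w] by (intro measurable_compose[OF _ G] measurable_Pair1') auto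
    thus "(\<integral>\<^sup>+t. G (?H w, t) \<partial>distr M ?S2 ?E) = (\<integral>\<^sup>+w'. G (?H w, ?E w') \<partial>M)"
      by (subst nn_integral_distr) auto
  qed
  also have "\<dots> = (\<integral>\<^sup>+w. (\<Prod>i=1..n. \<Prod>j<\<nu> i w. ennreal (h (x i j w))) \<partial>M)"
    by (simp add: inner)
  finally have eq: "(\<integral>\<^sup>+w. ennreal (exp (\<Sum>i=1..n. \<Sum>j<\<nu> i w. u (frac (x i j w + \<epsilon> i j w)))) \<partial>M) =
      (\<integral>\<^sup>+w. (\<Prod>i=1..n. \<Prod>j<\<nu> i w. ennreal (h (x i j w))) \<partial>M)" (is "?L = ?R") .
  have hi: "integrable (intensity_measure lam) (\<lambda>s. h s - 1)"
  proof (intro G.integrable_const_bound[of _ "exp b + 1"] AE_I2)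
    show "norm (h s - 1) \<le> exp b + 1" for s using h0[of s] hb[of s] by (simp add: abs_le_iff)
  qed measurable
  let ?I = "\<integral>s. h s - 1 \<partial>intensity_measure lam" and ?\<Lambda> = "measure (intensity_measure lam) (space (intensity_measure lam))"
  \<comment> \<open>Rounding costs \<open>\<delta>\<close> times the total mass of the intensity in
    each process; \<open>\<delta>\<close> tends to 0 afterwards.\<close>
  have step: "?L \<le> ennreal (exp (real n * (?I + \<delta> * ?\<Lambda>)))" if "\<delta> > 0" for \<delta>
  proof -
    obtain K :: nat where K: "exp b / \<delta> \<le> real K" using real_arch_simple by blast
    let ?sp = "\<lambda>i w. ennreal (step_product h \<delta> K (hidden_process \<nu> x i w))"
    have "?R \<le> (\<integral>\<^sup>+w. (\<Prod>i=1..n. ?sp i w) \<partial>M)"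
    proof (intro nn_integral_mono prod_mono_ennreal)
      fix w i assume "i \<in> {1..n}"
      have "(\<Prod>j<\<nu> i w. h (x i j w)) \<le> step_product h \<delta> K (hidden_process \<nu> x i w)"
        unfolding hidden_process_def by (rule prod_le_step_product[OF h h0 hb that K])
      thus "(\<Prod>j<\<nu> i w. ennreal (h (x i j w))) \<le> ?sp i w"
        by (simp add: prod_ennreal h0 ennreal_leI)
    qed
    also have "\<dots> = (\<Prod>i=1..n. \<integral>\<^sup>+w. ?sp i w \<partial>M)"
    proof (rule indep_vars_nn_integral)
      show "indep_vars (\<lambda>_. borel) ?sp {1..n}"
        by (rule indep_vars_compose2[OF hidden_indep]) measurable
    qed auto
    also have "\<dots> \<le> (\<Prod>i=1..n. ennreal (exp (\<integral>t. h t + \<delta> - 1 \<partial>intensity_measure lam)))"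
    proof (intro prod_mono_ennreal)
      fix i assume "i \<in> {1..n}"
      from hidden_poisson[OF this] show "(\<integral>\<^sup>+w. ?sp i w \<partial>M) \<le>
          ennreal (exp (\<integral>t. h t + \<delta> - 1 \<partial>intensity_measure lam))"
        unfolding hidden_process_def
        by (rule nn_integral_step_product[OF prob_space_axioms _ h h0 hb that K lam])
    qed
    also have "\<dots> = ennreal (exp (real n * (\<integral>t. h t + \<delta> - 1 \<partial>intensity_measure lam)))"
      by (simp add: ennreal_power exp_of_nat_mult)
    also have "(\<integral>t. h t + \<delta> - 1 \<partial>intensity_measure lam) = (\<integral>t. (h t - 1) + \<delta> \<partial>intensity_measure lam)"
      by (simp add: algebra_simps)
    also have "\<dots> = ?I + \<delta> * ?\<Lambda>"
      by (subst Bochner_Integration.integral_add[OF hi]) (simp_all add: mult.commute)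
    finally show ?thesis using eq by simp
  qed
  have "?L \<le> ennreal (exp (real n * ?I))"
  proof (rule tendsto_lowerbound)
    show "((\<lambda>\<delta>. ennreal (exp (real n * (?I + \<delta> * ?\<Lambda>)))) \<longlongrightarrow> ennreal (exp (real n * ?I))) (at_right 0)"
      by (rule tendsto_eq_intros refl | simp)+
    show "\<forall>\<^sub>F \<delta> in at_right 0. ?L \<le> ennreal (exp (real n * (?I + \<delta> * ?\<Lambda>)))"
      using step by (auto simp: eventually_at_right_field intro!: exI[of _ 1])
  qed simp
  also have "?I = (\<integral>s. (\<integral>e. exp (u (frac (s + e))) - 1 \<partial>?F) \<partial>intensity_measure lam)"
    using F.prob_space by (intro Bochner_Integration.integral_cong refl)
      (simp add: h_def Bochner_Integration.integral_diff[OF hint])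
  also have "\<dots> = (LINT t|convolution_measure lam f. exp (u t) - 1)"
  proof (rule integral_convolution_measure[symmetric])
    show "norm (exp (u t) - 1) \<le> exp b + 1" for t
      using b[of t] by (auto simp: abs_le_iff intro: order.trans[of _ "exp (u t)"]) (smt (verit) exp_gt_zero exp_le_cancel_iff)
  qed (auto intro: G.finite_measure_axioms F.finite_measure_axioms)
  finally show ?thesis .
qed

section \<open>Deviations of a bounded empirical measure\<close>

lemma exp_minus_linear_le:
  fixes x b :: real
  assumes "\<bar>x\<bar> \<le> b"
  shows "exp x - 1 - x \<le> exp b / 2 * x\<^sup>2"
proof -
  obtain t where t: "\<bar>t\<bar> \<le> \<bar>x\<bar>" "exp x = (\<Sum>m<2. x ^ m / fact m) + exp t / fact 2 * x ^ 2"
    using Maclaurin_exp_le[of x 2] by blast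
  have "exp t / 2 * x\<^sup>2 \<le> exp b / 2 * x\<^sup>2"
    using t(1) assms by (intro mult_right_mono divide_right_mono) auto
  thus ?thesis using t(2) by (simp add: numeral_2_eq_2)
qed

text \<open>A single term of the exponential series of |x|; one of the two exponentials equals exp
  |x|.\<close>

lemma abs_power_le_fact_exp:
  fixes x :: real
  shows "\<bar>x\<bar> ^ k \<le> fact k * (exp x + exp (- x))"
proof -
  obtain t where t: "exp \<bar>x\<bar> = (\<Sum>m<Suc k. \<bar>x\<bar> ^ m / fact m) + exp t / fact (Suc k) * \<bar>x\<bar> ^ (Suc k)"
    using Maclaurin_exp_le[of "\<bar>x\<bar>" "Suc k"] by blast
  have "\<bar>x\<bar> ^ k / fact k \<le> (\<Sum>m<Suc k. \<bar>x\<bar> ^ m / fact m)"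
    by (rule member_le_sum) auto
  also have "\<dots> \<le> exp \<bar>x\<bar>" unfolding t by (simp del: fact_Suc)
  also have "\<dots> \<le> exp x + exp (- x)" by (auto simp: abs_if)
  finally show ?thesis by (simp add: field_simps)
qed

text \<open>A bound on a mean that carries measurability and nonnegativity with it. Such bounds can
  be added, scaled and weakened by rules without integrability conditions.\<close>

definition (in prob_space) mean_le :: "('a \<Rightarrow> real) \<Rightarrow> real \<Rightarrow> bool" where
  "mean_le g b \<longleftrightarrow> g \<in> borel_measurable M \<and> (\<forall>w. 0 \<le> g w) \<and> 0 \<le> b \<and> (\<integral>\<^sup>+w. ennreal (g w) \<partial>M) \<le> ennreal b"

context prob_space
begin

lemma mean_le_add:
  assumes "mean_le g a" "mean_le h b"
  shows "mean_le (\<lambda>w. g w + h w) (a + b)"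
proof -
  have "(\<integral>\<^sup>+w. ennreal (g w + h w) \<partial>M) = (\<integral>\<^sup>+w. ennreal (g w) \<partial>M) + (\<integral>\<^sup>+w. ennreal (h w) \<partial>M)"
    using assms by (subst nn_integral_add[symmetric]) (auto simp: mean_le_def)
  also have "\<dots> \<le> ennreal a + ennreal b" using assms by (intro add_mono) (auto simp: mean_le_def)
  finally show ?thesis using assms by (auto simp: mean_le_def)
qed

lemma mean_le_cmult:
  assumes "mean_le g b" "c \<ge> 0"
  shows "mean_le (\<lambda>w. c * g w) (c * b)"
proof -
  have "(\<integral>\<^sup>+w. ennreal (c * g w) \<partial>M) = ennreal c * (\<integral>\<^sup>+w. ennreal (g w) \<partial>M)"
    using assms by (subst nn_integral_cmult[symmetric]) (auto simp: mean_le_def ennreal_mult)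
  also have "\<dots> \<le> ennreal c * ennreal b" using assms by (intro mult_left_mono) (auto simp: mean_le_def)
  finally show ?thesis using assms by (auto simp: mean_le_def ennreal_mult)
qed

lemma mean_le_const: "c \<ge> 0 \<Longrightarrow> mean_le (\<lambda>_. c) c"
  by (simp add: mean_le_def emeasure_space_1)

lemma mean_le_sum:
  assumes "finite I" "\<And>i. i \<in> I \<Longrightarrow> mean_le (g i) (b i)"
  shows "mean_le (\<lambda>w. \<Sum>i\<in>I. g i w) (\<Sum>i\<in>I. b i)"
  using assms by (induction I rule: finite_induct) (auto intro: mean_le_add mean_le_const)

lemma mean_le_trans: "mean_le g a \<Longrightarrow> a \<le> b \<Longrightarrow> mean_le g b"
  by (auto simp: mean_le_def intro: order.trans ennreal_leI)

lemma mean_le_mono: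
  assumes "mean_le h b" "g \<in> borel_measurable M" "\<And>w. 0 \<le> g w" "\<And>w. g w \<le> h w"
  shows "mean_le g b"
proof -
  have "(\<integral>\<^sup>+w. ennreal (g w) \<partial>M) \<le> (\<integral>\<^sup>+w. ennreal (h w) \<partial>M)"
    using assms by (intro nn_integral_mono ennreal_leI) auto
  thus ?thesis using assms by (auto simp: mean_le_def)
qed

text \<open>Cauchy-Schwarz, in the form \<open>2 X 1 \<le> s X\<^sup>2 + 1 / s\<close> with the optimal \<open>s\<close>.\<close>

lemma mean_le_indicator:
  assumes X: "mean_le (\<lambda>w. (X w)\<^sup>2) (a\<^sup>2)" "X \<in> borel_measurable M" "\<And>w. 0 \<le> X w"
    and E: "E \<in> sets M" "emeasure M E \<le> ennreal (p\<^sup>2)" and "a > 0" "p > 0"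
  shows "mean_le (\<lambda>w. X w * indicator E w) (a * p)"
proof -
  have "mean_le (indicator E) (p\<^sup>2)"
    using E by (simp add: mean_le_def ennreal_indicator)
  from mean_le_add[OF mean_le_cmult[OF X(1)] mean_le_cmult[OF this], of "p / (2 * a)" "a / (2 * p)"]
  have "mean_le (\<lambda>w. p / (2 * a) * (X w)\<^sup>2 + a / (2 * p) * indicator E w) (a * p)"
    using assms(6,7) by (simp add: power2_eq_square)
  thus ?thesis
  proof (rule mean_le_mono)
    fix w
    have "0 \<le> (sqrt (p / a) * X w - sqrt (a / p))\<^sup>2" by simp
    also have "\<dots> = p / a * (X w)\<^sup>2 - 2 * (sqrt (p / a) * sqrt (a / p)) * X w + a / p"
      using assms(6,7) by (simp add: power2_diff power_mult_distrib mult_ac)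
    also have "sqrt (p / a) * sqrt (a / p) = 1"
      using assms(6,7) by (simp add: real_sqrt_mult[symmetric])
    finally have "X w \<le> (p / a * (X w)\<^sup>2 + a / p) / 2" by simp
    thus "X w * indicator E w \<le> p / (2 * a) * (X w)\<^sup>2 + a / (2 * p) * indicator E w"
      using assms(6,7) by (cases "w \<in> E") (simp_all add: add_divide_distrib)
  qed (use X E in auto)
qed

end

text \<open>What the Poisson observations and the sample Y have in common: \<open>S u\<close> is the
  sum of u over all points observed, and its Laplace transform is at most that of a Poisson process
  with mean measure n times \<mu>. The index type in \<open>S_sum\<close> is that of the sines and
  cosines used below.\<close>

locale bounded_laplace = prob_space M + base: finite_measure \<mu>
  for M :: "'w measure" and \<mu> :: "real measure" +
  fixes n :: nat and S :: "(real \<Rightarrow> real) \<Rightarrow> 'w \<Rightarrow> real"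
  assumes n_pos: "n \<ge> 1"
    and sets_base [simp, measurable_cong]: "sets \<mu> = sets borel"
    and measurable_S [measurable]: "u \<in> borel_measurable borel \<Longrightarrow> S u \<in> borel_measurable M"
    and S_sum: "finite (I :: (bool \<times> int) set) \<Longrightarrow> S (\<lambda>t. \<Sum>i\<in>I. c i * \<phi> i t) w = (\<Sum>i\<in>I. c i * S (\<phi> i) w)"
    and laplace: "u \<in> borel_measurable borel \<Longrightarrow> (\<And>t. \<bar>u t\<bar> \<le> b) \<Longrightarrow>
      (\<integral>\<^sup>+w. ennreal (exp (S u w)) \<partial>M) \<le> ennreal (exp (real n * (LINT t|\<mu>. exp (u t) - 1)))"
begin

abbreviation mass :: real where "mass \<equiv> measure \<mu> (space \<mu>)"

definition dev :: "(real \<Rightarrow> real) \<Rightarrow> 'w \<Rightarrow> real" where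
  "dev u w = S u w / real n - (LINT t|\<mu>. u t)"

lemma measurable_dev [measurable]:
  assumes [measurable]: "u \<in> borel_measurable borel"
  shows "dev u \<in> borel_measurable M"
  unfolding dev_def[abs_def] by measurable

lemma integrable_base:
  fixes u :: "real \<Rightarrow> real"
  shows "u \<in> borel_measurable borel \<Longrightarrow> (\<And>t. \<bar>u t\<bar> \<le> b) \<Longrightarrow> integrable \<mu> u"
  by (rule base.integrable_const_bound[of _ b]) auto

lemma dev_sum:
  fixes I :: "(bool \<times> int) set"
  assumes "finite I" and "\<And>i. i \<in> I \<Longrightarrow> \<phi> i \<in> borel_measurable borel" and "\<And>i t. i \<in> I \<Longrightarrow> \<bar>\<phi> i t\<bar> \<le> b"
  shows "dev (\<lambda>t. \<Sum>i\<in>I. c i * \<phi> i t) w = (\<Sum>i\<in>I. c i * dev (\<phi> i) w)"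
proof -
  have "(LINT t|\<mu>. (\<Sum>i\<in>I. c i * \<phi> i t)) = (\<Sum>i\<in>I. c i * (LINT t|\<mu>. \<phi> i t))"
    using assms by (subst Bochner_Integration.integral_sum) (auto intro!: integrable_base)
  thus ?thesis using assms(1)
    by (simp add: dev_def S_sum right_diff_distrib sum_subtractf sum_divide_distrib)
qed

lemma dev_scale:
  assumes "u \<in> borel_measurable borel" and "\<And>t. \<bar>u t\<bar> \<le> b"
  shows "dev (\<lambda>t. c * u t) w = c * dev u w"
  using dev_sum[of "{(True, 0)}" "\<lambda>_. u" b "\<lambda>_. c"] assms by simp

text \<open>Centring turns exp u - 1 in the Laplace bound into exp u - 1 - u, which is of second
  order. The price is the factor exp b, so the bound is useful only for functions of bounded
  size.\<close>

lemma nn_integral_exp_dev: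
  assumes [measurable]: "u \<in> borel_measurable borel" and b: "\<And>t. \<bar>u t\<bar> \<le> b"
  shows "(\<integral>\<^sup>+w. ennreal (exp (real n * dev u w)) \<partial>M) \<le>
    ennreal (exp (real n * (exp b / 2 * (LINT t|\<mu>. (u t)\<^sup>2))))"
proof -
  have i1: "integrable \<mu> u" using b by (intro integrable_base) auto
  have i2: "integrable \<mu> (\<lambda>t. (u t)\<^sup>2)"
  proof (rule integrable_base)
    have "(u t)\<^sup>2 \<le> b\<^sup>2" for t using b[of t] by (metis abs_ge_zero power2_abs power_mono)
    thus "\<bar>(u t)\<^sup>2\<bar> \<le> b\<^sup>2" for t by simp
  qed auto
  have i3: "integrable \<mu> (\<lambda>t. exp (u t) - 1)"
  proof (rule integrable_base)
    show "\<bar>exp (u t) - 1\<bar> \<le> exp b + 1" for t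
    proof -
      have "exp (u t) \<le> exp b" using b[of t] by (simp add: abs_le_iff)
      thus ?thesis using exp_gt_zero[of "u t"] by linarith
    qed
  qed auto
  have n: "real n > 0" using n_pos by simp
  have "(\<integral>\<^sup>+w. ennreal (exp (real n * dev u w)) \<partial>M) =
      (\<integral>\<^sup>+w. ennreal (exp (- real n * (LINT t|\<mu>. u t))) * ennreal (exp (S u w)) \<partial>M)"
    using n by (intro nn_integral_cong) (simp add: dev_def right_diff_distrib exp_diff exp_minus divide_inverse mult.commute flip: ennreal_mult')
  also have "\<dots> = ennreal (exp (- real n * (LINT t|\<mu>. u t))) * (\<integral>\<^sup>+w. ennreal (exp (S u w)) \<partial>M)"
    by (intro nn_integral_cmult) measurable
  also have "\<dots> \<le> ennreal (exp (- real n * (LINT t|\<mu>. u t))) *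
      ennreal (exp (real n * (LINT t|\<mu>. exp (u t) - 1)))"
    by (intro mult_left_mono laplace[of u b] b) auto
  also have "\<dots> = ennreal (exp (real n * (LINT t|\<mu>. exp (u t) - 1 - u t)))"
    using i1 i3 by (simp add: ennreal_mult'[symmetric] exp_add[symmetric] right_diff_distrib)
  also have "\<dots> \<le> ennreal (exp (real n * (LINT t|\<mu>. exp b / 2 * (u t)\<^sup>2)))"
    using i1 i2 i3 n exp_minus_linear_le[OF b]
    by (intro ennreal_leI iffD2[OF exp_le_cancel_iff] mult_left_mono integral_mono) auto
  finally show ?thesis by simp
qed

lemma nn_integral_exp_scaled_dev:
  assumes [measurable]: "u \<in> borel_measurable borel" and u: "\<And>t. \<bar>u t\<bar> \<le> 1" and s: "\<bar>s\<bar> \<le> b"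
  shows "(\<integral>\<^sup>+w. ennreal (exp (real n * (s * dev u w))) \<partial>M) \<le>
    ennreal (exp (real n * (exp b / 2 * (s\<^sup>2 * mass))))"
proof -
  have u2: "(u t)\<^sup>2 \<le> 1" for t using u[of t] by (simp add: abs_square_le_1)
  have "(\<integral>\<^sup>+w. ennreal (exp (real n * (s * dev u w))) \<partial>M) =
      (\<integral>\<^sup>+w. ennreal (exp (real n * dev (\<lambda>t. s * u t) w)) \<partial>M)"
    using u by (simp add: dev_scale[of u 1])
  also have "\<dots> \<le> ennreal (exp (real n * (exp b / 2 * (LINT t|\<mu>. (s * u t)\<^sup>2))))"
  proof (rule nn_integral_exp_dev)
    show "\<bar>s * u t\<bar> \<le> b" for t
      using s u[of t] mult_mono[of "\<bar>s\<bar>" b "\<bar>u t\<bar>" 1] by (simp add: abs_mult)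
  qed measurable
  also have "\<dots> \<le> ennreal (exp (real n * (exp b / 2 * (s\<^sup>2 * mass))))"
  proof (intro ennreal_leI iffD2[OF exp_le_cancel_iff] mult_left_mono)
    have "(LINT t|\<mu>. (s * u t)\<^sup>2) = s\<^sup>2 * (LINT t|\<mu>. (u t)\<^sup>2)" by (simp add: power_mult_distrib)
    also have "\<dots> \<le> s\<^sup>2 * (LINT t|\<mu>. 1)"
      using u2 by (intro mult_left_mono integral_mono integrable_base[of _ 1]) auto
    finally show "(LINT t|\<mu>. (s * u t)\<^sup>2) \<le> s\<^sup>2 * mass" by simp
  qed auto
  finally show ?thesis .
qed

text \<open>At the scale 1 / sqrt n the exponent in the Laplace bound no longer depends on n: it is
  at most e/2 times the mass, hence at most twice the mass. A power is bounded by the sum of the two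
  exponentials.\<close>

lemma mean_abs_dev_power:
  assumes [measurable]: "u \<in> borel_measurable borel" and u: "\<And>t. \<bar>u t\<bar> \<le> 1"
  shows "mean_le (\<lambda>w. \<bar>dev u w\<bar> ^ k) (2 * fact k * exp (2 * mass) / sqrt (real n) ^ k)"
proof -
  define \<theta> where "\<theta> = 1 / sqrt (real n)"
  have n: "real n > 0" using n_pos by simp
  have \<theta>: "0 \<le> \<theta>" "\<theta> \<le> 1" "real n * \<theta>\<^sup>2 = 1" "real n * \<theta> = sqrt (real n)"
    using n n_pos by (auto simp: \<theta>_def power_divide real_div_sqrt)
  have "mean_le (\<lambda>w. exp (real n * (s * dev u w))) (exp (2 * mass))" if s: "\<bar>s\<bar> = \<theta>" for s
  proof -
    have "real n * (exp 1 / 2 * (s\<^sup>2 * mass)) = (real n * \<bar>s\<bar>\<^sup>2) * (exp 1 / 2 * mass)" by simp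
    also have "\<dots> \<le> 2 * mass" unfolding s \<theta>(3) using exp_le by (simp add: mult_right_mono)
    finally show ?thesis
      using nn_integral_exp_scaled_dev[OF assms, of s 1] s \<theta>
      by (auto simp: mean_le_def intro: order.trans ennreal_leI)
  qed
  from mean_le_cmult[OF mean_le_add[OF this this], of \<theta> "- \<theta>" "fact k / sqrt (real n) ^ k"] \<theta>
  have "mean_le (\<lambda>w. fact k / sqrt (real n) ^ k * (exp (real n * (\<theta> * dev u w)) + exp (real n * (- \<theta> * dev u w))))
      (2 * fact k * exp (2 * mass) / sqrt (real n) ^ k)" by (simp add: mult_ac)
  thus ?thesis
  proof (rule mean_le_mono)
    fix w
    have "\<bar>dev u w\<bar> ^ k = \<bar>sqrt (real n) * dev u w\<bar> ^ k / sqrt (real n) ^ k"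
      using n by (simp add: abs_mult power_mult_distrib)
    also have "\<dots> \<le> fact k * (exp (sqrt (real n) * dev u w) + exp (- (sqrt (real n) * dev u w))) / sqrt (real n) ^ k"
      by (intro divide_right_mono abs_power_le_fact_exp) auto
    finally show "\<bar>dev u w\<bar> ^ k \<le>
        fact k / sqrt (real n) ^ k * (exp (real n * (\<theta> * dev u w)) + exp (real n * (- \<theta> * dev u w)))"
      by (simp add: \<theta>(4)[symmetric] mult_ac)
  qed auto
qed

text \<open>A Chernoff bound with parameter t/2 for each sign. As exp (1/2) / 2 \<le> 1 and the mass
  is at most 1, the exponent is at most n (- t^2 / 2 + t^2 / 4).\<close>

lemma emeasure_dev_ge:
  assumes [measurable]: "u \<in> borel_measurable borel" and u: "\<And>t. \<bar>u t\<bar> \<le> 1"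
    and mass: "mass \<le> 1" and t: "0 \<le> t" "t \<le> 1"
  shows "emeasure M {w \<in> space M. t \<le> \<bar>dev u w\<bar>} \<le> ennreal (2 * exp (- real n * t\<^sup>2 / 4))"
proof -
  have *: "emeasure M {w \<in> space M. t \<le> s * dev u w} \<le> ennreal (exp (- real n * t\<^sup>2 / 4))"
    if s: "\<bar>s\<bar> = 1" for s
  proof -
    have s2: "s\<^sup>2 = 1" using s by (metis one_power2 power2_abs)
    let ?X = "\<lambda>w. exp (real n * (s * t / 2 * dev u w))" and ?c = "exp (- real n * t\<^sup>2 / 2)"
    have "emeasure M {w \<in> space M. t \<le> s * dev u w} =
        (\<integral>\<^sup>+w. indicator {w \<in> space M. t \<le> s * dev u w} w \<partial>M)"
      by simp
    also have "\<dots> \<le> (\<integral>\<^sup>+w. ennreal ?c * ennreal (?X w) \<partial>M)"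
    proof (rule nn_integral_mono)
      fix w assume "w \<in> space M"
      have "1 \<le> ?c * ?X w" if "t \<le> s * dev u w"
      proof -
        have "real n / 2 * (t * t) \<le> real n / 2 * (t * (s * dev u w))"
          using that t by (intro mult_left_mono) auto
        thus ?thesis by (simp add: power2_eq_square mult_ac flip: exp_add)
      qed
      thus "indicator {w \<in> space M. t \<le> s * dev u w} w \<le> ennreal ?c * ennreal (?X w)"
        by (auto simp: indicator_def simp flip: ennreal_mult')
    qed
    also have "\<dots> = ennreal ?c * (\<integral>\<^sup>+w. ennreal (?X w) \<partial>M)"
      by (intro nn_integral_cmult) measurable
    also have "\<dots> \<le> ennreal ?c * ennreal (exp (real n * (exp (1/2) / 2 * ((s * t / 2)\<^sup>2 * mass))))"
      using s t by (intro mult_left_mono nn_integral_exp_scaled_dev u) (auto simp: abs_mult)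
    also have "\<dots> \<le> ennreal (exp (- real n * t\<^sup>2 / 4))"
    proof -
      have "exp (1/2::real) \<le> 1 + 1/2 + (1/2)\<^sup>2" by (rule exp_bound) auto
      hence "exp (1/2) / 2 \<le> (1::real)" by (simp add: power2_eq_square)
      hence "exp (1/2) / 2 * ((s * t / 2)\<^sup>2 * mass) \<le> 1 * (t\<^sup>2 / 4 * 1)"
        using mass by (intro mult_mono) (auto simp: power_mult_distrib power_divide s2)
      hence "real n * (exp (1/2) / 2 * ((s * t / 2)\<^sup>2 * mass)) \<le> real n * (t\<^sup>2 / 4)"
        by (intro mult_left_mono) auto
      hence "- real n * t\<^sup>2 / 2 + real n * (exp (1/2) / 2 * ((s * t / 2)\<^sup>2 * mass)) \<le> - real n * t\<^sup>2 / 4"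
        by linarith
      hence "?c * exp (real n * (exp (1/2) / 2 * ((s * t / 2)\<^sup>2 * mass))) \<le> exp (- real n * t\<^sup>2 / 4)"
        unfolding exp_add[symmetric] by (rule iffD2[OF exp_le_cancel_iff])
      thus ?thesis by (simp only: ennreal_mult'[symmetric] exp_ge_zero ennreal_leI)
    qed
    finally show ?thesis .
  qed
  have "emeasure M {w \<in> space M. t \<le> \<bar>dev u w\<bar>} \<le>
      emeasure M ({w \<in> space M. t \<le> 1 * dev u w} \<union> {w \<in> space M. t \<le> (-1) * dev u w})"
    by (intro emeasure_mono) (auto simp: abs_if)
  also have "\<dots> \<le> emeasure M {w \<in> space M. t \<le> 1 * dev u w} + emeasure M {w \<in> space M. t \<le> (-1) * dev u w}"
    by (intro emeasure_subadditive) auto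
  also have "\<dots> \<le> ennreal (exp (- real n * t\<^sup>2 / 4)) + ennreal (exp (- real n * t\<^sup>2 / 4))"
    by (intro add_mono *) auto
  finally show ?thesis by (simp flip: ennreal_plus)
qed

end

section \<open>A deviation inequality for sums of squares\<close>

context bounded_laplace
begin

text \<open>For a fixed vector g in the ball the exponent is n times the deviation of one function
  u, a linear combination of the \<open>\<phi> p\<close> with coefficients of order sqrt (\<eta> /
  n). By Cauchy-Schwarz |u| \<le> 1/5, so the second-order bound holds with exp (1/5) \<le> 5/4. The
  quadratic form on the right is the integral of u^2 written out.\<close>

lemma nn_integral_exp_dev_ball:
  fixes I :: "(bool \<times> int) set" and \<phi> :: "bool \<times> int \<Rightarrow> real \<Rightarrow> real"
  assumes I: "finite I"
    and \<phi> [measurable]: "\<And>p. p \<in> I \<Longrightarrow> \<phi> p \<in> borel_measurable borel"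
    and \<phi>1: "\<And>p t. p \<in> I \<Longrightarrow> \<bar>\<phi> p t\<bar> \<le> 1"
    and \<eta>: "\<eta> \<ge> 0" and s: "\<bar>s\<bar> = 1"
    and g: "(\<Sum>p\<in>I. (g p)\<^sup>2) \<le> R" and R: "\<eta> / real n * real (card I) * R \<le> 1 / 25"
  shows "(\<integral>\<^sup>+w. ennreal (exp (s * (sqrt (\<eta> * real n) * (\<Sum>p\<in>I. g p * dev (\<phi> p) w)))) \<partial>M) \<le>
    ennreal (exp ((\<Sum>p\<in>I. \<Sum>q\<in>I. (5 / 4 * \<eta> * (LINT t|\<mu>. \<phi> p t * \<phi> q t)) * g p * g q) / 2))"
proof -
  define \<theta> where "\<theta> = sqrt (\<eta> / real n)"
  have n: "real n > 0" using n_pos by simp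
  have \<theta>: "\<theta>\<^sup>2 = \<eta> / real n" "\<theta> \<ge> 0" using \<eta> n by (auto simp: \<theta>_def)
  have sq: "sqrt (\<eta> * real n) = real n * \<theta>"
    using n \<theta>(2) by (intro real_sqrt_unique) (auto simp: power_mult_distrib \<theta>(1), simp add: power2_eq_square)
  define u where "u = (\<lambda>t. \<Sum>p\<in>I. (s * \<theta> * g p) * \<phi> p t)"
  have u [measurable]: "u \<in> borel_measurable borel" unfolding u_def by measurable
  have s2: "s\<^sup>2 = 1" using s by (metis one_power2 power2_abs)
  have ub: "\<bar>u t\<bar> \<le> 1 / 5" for t
  proof -
    have "(\<Sum>p\<in>I. g p * \<phi> p t)\<^sup>2 \<le> (\<Sum>p\<in>I. (g p)\<^sup>2) * (\<Sum>p\<in>I. (\<phi> p t)\<^sup>2)"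
      by (rule Cauchy_Schwarz_ineq_sum)
    also have "\<dots> \<le> R * real (card I)"
    proof (rule mult_mono[OF g])
      have "(\<Sum>p\<in>I. (\<phi> p t)\<^sup>2) \<le> (\<Sum>p\<in>I. 1)"
        using \<phi>1 by (intro sum_mono) (simp add: abs_square_le_1)
      thus "(\<Sum>p\<in>I. (\<phi> p t)\<^sup>2) \<le> real (card I)" by simp
      show "0 \<le> R" using g sum_nonneg[of I "\<lambda>p. (g p)\<^sup>2"] by simp
    qed (simp add: sum_nonneg)
    finally have "\<theta>\<^sup>2 * (\<Sum>p\<in>I. g p * \<phi> p t)\<^sup>2 \<le> \<theta>\<^sup>2 * (R * real (card I))"
      by (intro mult_left_mono) auto
    also have "\<dots> \<le> (1 / 5)\<^sup>2"
      using R unfolding \<theta>(1) by (simp add: mult_ac power_divide)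
    also have "\<theta>\<^sup>2 * (\<Sum>p\<in>I. g p * \<phi> p t)\<^sup>2 = (u t)\<^sup>2"
      unfolding u_def by (simp add: power_mult_distrib s2 mult.assoc sum_distrib_left[symmetric])
    finally show ?thesis using abs_le_square_iff[of "u t" "1 / 5"] by simp
  qed
  have dev_u: "dev u w = s * \<theta> * (\<Sum>p\<in>I. g p * dev (\<phi> p) w)" for w
    unfolding u_def by (subst dev_sum[OF I \<phi> \<phi>1]) (auto simp: sum_distrib_left mult.assoc)
  have "(\<integral>\<^sup>+w. ennreal (exp (s * (sqrt (\<eta> * real n) * (\<Sum>p\<in>I. g p * dev (\<phi> p) w)))) \<partial>M) =
      (\<integral>\<^sup>+w. ennreal (exp (real n * dev u w)) \<partial>M)"
    by (intro nn_integral_cong) (simp add: dev_u sq mult_ac)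
  also have "\<dots> \<le> ennreal (exp (real n * (exp (1 / 5) / 2 * (LINT t|\<mu>. (u t)\<^sup>2))))"
    by (intro nn_integral_exp_dev u ub)
  also have "\<dots> \<le> ennreal (exp (real n * ((5 / 4) / 2 * (LINT t|\<mu>. (u t)\<^sup>2))))"
  proof -
    have "exp (1/5::real) \<le> 1 + 1/5 + (1/5)\<^sup>2" by (rule exp_bound) auto
    hence e: "exp (1/5) \<le> (5/4::real)" by (simp add: power2_eq_square)
    show ?thesis
      using n e by (intro ennreal_leI iffD2[OF exp_le_cancel_iff] mult_left_mono mult_right_mono divide_right_mono)
        (auto intro!: integral_nonneg_AE)
  qed
  also have "(LINT t|\<mu>. (u t)\<^sup>2) = (LINT t|\<mu>. (\<Sum>p\<in>I. \<Sum>q\<in>I. (\<theta>\<^sup>2 * g p * g q) * (\<phi> p t * \<phi> q t)))"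
  proof (intro Bochner_Integration.integral_cong refl)
    fix t
    have "(u t)\<^sup>2 = (\<Sum>p\<in>I. \<Sum>q\<in>I. (s * \<theta> * g p) * \<phi> p t * ((s * \<theta> * g q) * \<phi> q t))"
      unfolding u_def power2_eq_square by (simp add: sum_product)
    also have "\<dots> = (\<Sum>p\<in>I. \<Sum>q\<in>I. (\<theta>\<^sup>2 * g p * g q) * (\<phi> p t * \<phi> q t))"
    proof (intro sum.cong refl)
      fix p q
      have "(s * \<theta> * g p) * \<phi> p t * ((s * \<theta> * g q) * \<phi> q t) = s\<^sup>2 * \<theta>\<^sup>2 * g p * g q * (\<phi> p t * \<phi> q t)"
        by (simp add: power2_eq_square)
      thus "(s * \<theta> * g p) * \<phi> p t * ((s * \<theta> * g q) * \<phi> q t) = (\<theta>\<^sup>2 * g p * g q) * (\<phi> p t * \<phi> q t)"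
        by (simp add: s2)
    qed
    finally show "(u t)\<^sup>2 = (\<Sum>p\<in>I. \<Sum>q\<in>I. (\<theta>\<^sup>2 * g p * g q) * (\<phi> p t * \<phi> q t))" .
  qed
  also have "\<dots> = (\<Sum>p\<in>I. \<Sum>q\<in>I. (\<theta>\<^sup>2 * g p * g q) * (LINT t|\<mu>. \<phi> p t * \<phi> q t))"
  proof -
    have "integrable \<mu> (\<lambda>t. \<phi> p t * \<phi> q t)" if "p \<in> I" "q \<in> I" for p q
      using that \<phi>1[OF that(1)] \<phi>1[OF that(2)] \<phi>[OF that(1)] \<phi>[OF that(2)]
      by (intro integrable_base[of _ 1]) (auto simp: abs_mult intro!: mult_le_one)
    thus ?thesis
      by (subst Bochner_Integration.integral_sum, force,
          intro sum.cong refl, subst Bochner_Integration.integral_sum) auto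
  qed
  also have "real n * ((5 / 4) / 2 * \<dots>) =
      (\<Sum>p\<in>I. \<Sum>q\<in>I. (5 / 4 * \<eta> * (LINT t|\<mu>. \<phi> p t * \<phi> q t)) * g p * g q) / 2"
    using n unfolding \<theta>(1) sum_distrib_left sum_divide_distrib
    by (intro sum.cong refl) simp
  finally show ?thesis .
qed

text \<open>A Gaussian vector, truncated to a ball so that the exponent stays in the range
  where the Laplace transform is controlled, linearizes the quadratic form.  This gives an
  exponent governed by the operator norm of the covariance, but a threshold governed by
  its trace only.\<close>

lemma emeasure_sum_dev_square_ge:
  fixes I :: "(bool \<times> int) set" and \<phi> :: "bool \<times> int \<Rightarrow> real \<Rightarrow> real"
  assumes I: "finite I" "I \<noteq> {}"
    and \<phi> [measurable]: "\<And>p. p \<in> I \<Longrightarrow> \<phi> p \<in> borel_measurable borel"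
    and \<phi>1: "\<And>p t. p \<in> I \<Longrightarrow> \<bar>\<phi> p t\<bar> \<le> 1"
    and row: "\<And>p. p \<in> I \<Longrightarrow> (\<Sum>q\<in>I. \<bar>LINT t|\<mu>. \<phi> p t * \<phi> q t\<bar>) \<le> B"
    and B: "B \<ge> 1" and L: "mass \<le> L" "L \<ge> 1"
    and \<eta>: "\<eta> > 0" "\<eta> \<le> 1 / (25 * B\<^sup>2)" "\<eta> \<le> 1 / (6 * L)"
    and q: "q > 0"
    and R: "\<eta> / real n * real (card I) * (5 * real (card I) + 2 * (\<eta> * real n * q)) \<le> 1 / 25"
  shows "emeasure M {w \<in> space M. q \<le> (\<Sum>p\<in>I. (dev (\<phi> p) w)\<^sup>2)} \<le>
    ennreal (2 * exp (\<eta> * (real (card I) * L - real n * q / 2)))"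
proof -
  define A where "A = (\<lambda>p q. 5 / 4 * \<eta> * (LINT t|\<mu>. \<phi> p t * \<phi> q t))"
  define R where "R = 5 * real (card I) + 2 * (\<eta> * real n * q)"
  define ball where "ball = {g :: bool \<times> int \<Rightarrow> real. (\<Sum>p\<in>I. (g p)\<^sup>2) \<le> R}"
  define Q where "Q = (\<lambda>w. \<Sum>p\<in>I. (dev (\<phi> p) w)\<^sup>2)"
  define y where "y = (\<lambda>w p. sqrt (\<eta> * real n) * dev (\<phi> p) w)"
  define F where "F = (\<lambda>w. \<integral>\<^sup>+g. (ennreal (exp (\<Sum>p\<in>I. y w p * g p)) + ennreal (exp (\<Sum>p\<in>I. - y w p * g p))) *
    indicator ball g \<partial>gauss_pi I)"
  have n: "real n > 0" using n_pos by simp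
  interpret G: prob_space "gauss_pi I" by (rule prob_space_gauss_pi)
  interpret P: pair_sigma_finite M "gauss_pi I" ..
  have [measurable]: "(\<lambda>g. \<Sum>p\<in>I. (g p)\<^sup>2) \<in> borel_measurable (gauss_pi I)"
    by measurable
  have ball_m [measurable]: "(indicator ball :: _ \<Rightarrow> ennreal) \<in> borel_measurable (gauss_pi I)"
  proof -
    have "(\<lambda>g. if (\<Sum>p\<in>I. (g p)\<^sup>2) \<le> R then 1 else 0 :: ennreal) \<in> borel_measurable (gauss_pi I)"
      by measurable
    moreover have "(\<lambda>g. if (\<Sum>p\<in>I. (g p)\<^sup>2) \<le> R then 1 else 0 :: ennreal) = indicator ball"
      by (auto simp: ball_def indicator_def fun_eq_iff)
    ultimately show ?thesis by simp
  qed
  have ym [measurable]: "(\<lambda>z. \<Sum>p\<in>I. y (fst z) p * snd z p) \<in> borel_measurable (M \<Otimes>\<^sub>M gauss_pi I)"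
    "(\<lambda>z. \<Sum>p\<in>I. - y (fst z) p * snd z p) \<in> borel_measurable (M \<Otimes>\<^sub>M gauss_pi I)"
    unfolding y_def by measurable
  have Qm [measurable]: "Q \<in> borel_measurable M" unfolding Q_def by measurable
  have yz: "(\<Sum>p\<in>I. (y w p)\<^sup>2) = \<eta> * real n * Q w" for w
    using \<eta>(1) n by (simp add: y_def Q_def power_mult_distrib sum_distrib_left)
  let ?e = "exp (\<eta> * real n * q / 2)"
  let ?q = "\<lambda>g. ennreal (exp ((\<Sum>p\<in>I. \<Sum>q\<in>I. A p q * g p * g q) / 2))"
  let ?cosh = "\<lambda>w g. ennreal (exp (\<Sum>p\<in>I. y w p * g p)) + ennreal (exp (\<Sum>p\<in>I. - y w p * g p))"
  have lower: "ennreal ?e \<le> F w" if Q: "q \<le> Q w" for w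
  proof -
    \<comment> \<open>The radius of the ball is fitted to vectors of squared length \<eta> n q, but
      \<open>y w\<close> may be longer; the factor \<open>c\<close> shrinks it to exactly this
      length. Undoing the shrinking is monotone only for cosh and not for a single exponential,
      which is why \<open>F\<close> contains both signs.\<close>
    define c where "c = sqrt (q / Q w)"
    have c: "0 \<le> c" "c \<le> 1" "c\<^sup>2 * Q w = q" using Q q by (auto simp: c_def)
    have cy: "(\<Sum>p\<in>I. (s * c * y w p)\<^sup>2) = \<eta> * real n * q" if "s\<^sup>2 = 1" for s
    proof -
      have "(\<Sum>p\<in>I. (s * c * y w p)\<^sup>2) = c\<^sup>2 * (\<Sum>p\<in>I. (y w p)\<^sup>2)"
        using that by (simp add: power_mult_distrib sum_distrib_left)
      also have "\<dots> = \<eta> * real n * (c\<^sup>2 * Q w)" by (simp add: yz)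
      finally show ?thesis by (simp add: c)
    qed
    have half: "ennreal (?e / 2) \<le>
        (\<integral>\<^sup>+g. ennreal (exp (\<Sum>p\<in>I. (s * c * y w p) * g p)) * indicator ball g \<partial>gauss_pi I)"
      if "s\<^sup>2 = 1" for s
      using gauss_pi_ball_lower_bound[OF I, of "\<lambda>p. s * c * y w p" R] cy[OF that]
      by (simp add: R_def ball_def)
    have mm: "(\<lambda>g. ennreal (exp (\<Sum>p\<in>I. a p * g p)) * indicator ball g) \<in> borel_measurable (gauss_pi I)"
      for a :: "bool \<times> int \<Rightarrow> real"
      using ball_m by (intro borel_measurable_times_ennreal) auto
    have "ennreal ?e = ennreal (?e / 2) + ennreal (?e / 2)"
      by (subst ennreal_plus[symmetric]) auto
    also have "\<dots> \<le> (\<integral>\<^sup>+g. ennreal (exp (\<Sum>p\<in>I. (1 * c * y w p) * g p)) * indicator ball g \<partial>gauss_pi I) +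
        (\<integral>\<^sup>+g. ennreal (exp (\<Sum>p\<in>I. (-1 * c * y w p) * g p)) * indicator ball g \<partial>gauss_pi I)"
      by (intro add_mono half) auto
    also have "\<dots> = (\<integral>\<^sup>+g. (ennreal (exp (\<Sum>p\<in>I. (1 * c * y w p) * g p)) +
        ennreal (exp (\<Sum>p\<in>I. (-1 * c * y w p) * g p))) * indicator ball g \<partial>gauss_pi I)"
      using mm by (subst nn_integral_add[symmetric]) (auto simp: distrib_right)
    also have "\<dots> \<le> F w"
      unfolding F_def
    proof (intro nn_integral_mono mult_right_mono)
      fix g
      let ?x = "\<Sum>p\<in>I. y w p * g p"
      have "exp (c * ?x) + exp (- (c * ?x)) = 2 * cosh (c * ?x)" by (simp add: cosh_field_def)
      also have "\<dots> \<le> 2 * cosh ?x"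
      proof -
        have "\<bar>c * ?x\<bar> \<le> \<bar>?x\<bar>" using c by (simp add: abs_mult mult_left_le_one_le)
        thus ?thesis using cosh_real_nonneg_le_iff[of "\<bar>c * ?x\<bar>" "\<bar>?x\<bar>"] by simp
      qed
      also have "\<dots> = exp ?x + exp (- ?x)" by (simp add: cosh_field_def)
      finally have "ennreal (exp (c * ?x) + exp (- (c * ?x))) \<le> ennreal (exp ?x + exp (- ?x))"
        by (rule ennreal_leI)
      thus "ennreal (exp (\<Sum>p\<in>I. (1 * c * y w p) * g p)) + ennreal (exp (\<Sum>p\<in>I. (-1 * c * y w p) * g p)) \<le>
          ?cosh w g"
        by (simp add: sum_negf sum_distrib_left mult.assoc)
    qed auto
    finally show ?thesis .
  qed
  have Fm: "(\<lambda>z. ?cosh (fst z) (snd z) *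
    indicator ball (snd z)) \<in> borel_measurable (M \<Otimes>\<^sub>M gauss_pi I)"
    by measurable
  let ?T = "exp (real (card I) * \<eta> * L)"
  have quad: "(\<integral>\<^sup>+g. ?q g \<partial>gauss_pi I) \<le> ennreal ?T"
  proof -
    \<comment> \<open>\<open>r\<close> bounds the row sums, and \<open>Bd\<close> the diagonal with
      the correction for elimination, where 4 * r dominates the constant \<open>c\<close> of the
      quadratic form lemma. The condition \<eta> \<le> 1 / (25 B^2) makes 4 * r^2 at most \<eta> /
      4, so \<open>Bd\<close> is at most (5/4 + 1/4) \<eta> L: the row-sum bound \<open>B\<close>
      disappears from the estimate.\<close>
    define r where "r = 5 / 4 * \<eta> * B"
    define Bd where "Bd = 5 / 4 * \<eta> * mass + 4 * r\<^sup>2"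
    have \<eta>B: "\<eta> * B\<^sup>2 \<le> 1 / 25" using \<eta>(2) B by (simp add: field_simps)
    have "\<eta> * B \<le> \<eta> * B\<^sup>2" using \<eta>(1) B by (simp add: power2_eq_square)
    hence "\<eta> * B \<le> 1 / 25" using \<eta>B by linarith
    hence r: "0 \<le> r" "r \<le> 1 / 20" using \<eta>(1) B by (simp_all add: r_def mult_ac)
    have "4 * r\<^sup>2 = 25 / 4 * \<eta> * (\<eta> * B\<^sup>2)" by (simp add: r_def power2_eq_square)
    also have "\<dots> \<le> 25 / 4 * \<eta> * (1 / 25)" using \<eta>(1) \<eta>B by (intro mult_left_mono) auto
    also have "\<dots> \<le> \<eta> / 4 * L" using \<eta>(1) L by simp
    finally have "4 * r\<^sup>2 \<le> \<eta> / 4 * L" .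
    moreover have "5 / 4 * \<eta> * mass \<le> 5 / 4 * \<eta> * L" using \<eta>(1) L by (intro mult_left_mono) auto
    ultimately have Bd: "Bd \<le> 3 / 2 * (\<eta> * L)" unfolding Bd_def by (simp add: algebra_simps)
    have "\<eta> * L \<le> 1 / 6" using \<eta>(3) L by (simp add: field_simps)
    hence Bd4: "Bd \<le> 1 / 4" using Bd by simp
    have Bd0: "Bd \<ge> 0" unfolding Bd_def using \<eta>(1) by simp
    have mass0: "mass \<ge> 0" by simp
    have c: "r * (1 + r) / (1 - r)\<^sup>2 \<le> 4 * r"
    proof -
      have "1 + r \<le> 4 * (1 - 2 * r)" using r by simp
      also have "\<dots> \<le> 4 * (1 - r)\<^sup>2" by (simp add: power2_diff)
      finally have "1 + r \<le> 4 * (1 - r)\<^sup>2" .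
      hence "r * (1 + r) \<le> r * (4 * (1 - r)\<^sup>2)" using r by (intro mult_left_mono) auto
      thus ?thesis using r by (simp add: divide_le_eq mult_ac)
    qed
    have rowA: "(\<Sum>q\<in>I. \<bar>A p q\<bar>) \<le> r" if "p \<in> I" for p
    proof -
      have "(\<Sum>q\<in>I. \<bar>A p q\<bar>) = 5 / 4 * \<eta> * (\<Sum>q\<in>I. \<bar>LINT t|\<mu>. \<phi> p t * \<phi> q t\<bar>)"
        using \<eta>(1) by (simp add: A_def abs_mult sum_distrib_left)
      also have "\<dots> \<le> 5 / 4 * \<eta> * B" using row[OF that] \<eta>(1) by (intro mult_left_mono) auto
      finally show ?thesis by (simp add: r_def)
    qed
    have "(\<integral>\<^sup>+g. ?q g \<partial>gauss_pi I) \<le>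
        ennreal ((1 - Bd) powr (- real (card I) / 2))"
    proof (rule nn_integral_gauss_pi_exp_quadratic_form[OF I(1) r(1) _ _ refl])
      show "A p q = A q p" for p q by (simp add: A_def mult.commute)
      fix p assume p: "p \<in> I"
      have "(LINT t|\<mu>. \<phi> p t * \<phi> p t) \<le> (LINT t|\<mu>. 1)"
      proof (rule integral_mono)
        have *: "\<bar>\<phi> p t * \<phi> p t\<bar> \<le> 1" for t
          unfolding abs_mult using \<phi>1[OF p, of t] by (intro mult_le_one) auto
        thus "integrable \<mu> (\<lambda>t. \<phi> p t * \<phi> p t)"
          using \<phi>[OF p] by (intro integrable_base[of _ 1]) auto
        show "\<phi> p t * \<phi> p t \<le> 1" for t using *[of t] by linarith
      qed simp
      hence "A p p \<le> 5 / 4 * \<eta> * mass" unfolding A_def using \<eta>(1) by (intro mult_left_mono) auto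
      moreover have "r * (1 + r) / (1 - r)\<^sup>2 * (\<Sum>q\<in>I. \<bar>A p q\<bar>) \<le> 4 * r * r"
        using c rowA[OF p] r by (intro mult_mono) (auto simp: sum_nonneg)
      ultimately show "A p p + r * (1 + r) / (1 - r)\<^sup>2 * (\<Sum>q\<in>I. \<bar>A p q\<bar>) \<le> Bd"
        by (simp add: Bd_def power2_eq_square)
    qed (use r Bd4 rowA in auto)
    also have "\<dots> \<le> ennreal ?T"
    proof (rule ennreal_leI)
      \<comment> \<open>Since \<open>Bd\<close> \<le> 1/4, this chain gives - ln (1 - Bd) \<le> 4/3
        * Bd \<le> 2 \<eta> L, and multiplication by card I / 2 gives the exponent of
        \<open>?T\<close>.\<close>
      have "- ln (1 - Bd) = ln (1 / (1 - Bd))" using Bd4 by (simp add: ln_div)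
      also have "\<dots> \<le> 1 / (1 - Bd) - 1" using Bd4 by (intro ln_le_minus_one) auto
      also have "\<dots> = Bd / (1 - Bd)" using Bd4 by (simp add: field_simps)
      also have "\<dots> \<le> Bd / (3 / 4)" using Bd4 Bd0 by (intro divide_left_mono) auto
      also have "\<dots> \<le> 2 * (\<eta> * L)"
      proof -
        have "a / (3 / 4) \<le> 2 * b" if "a \<le> 3 / 2 * b" for a b :: real using that by simp
        from this[OF Bd] show ?thesis .
      qed
      finally have "real (card I) / 2 * - ln (1 - Bd) \<le> real (card I) / 2 * (2 * (\<eta> * L))"
        by (intro mult_left_mono) auto
      thus "(1 - Bd) powr (- real (card I) / 2) \<le> ?T" using Bd4 by (simp add: powr_def)
    qed
    finally show ?thesis .
  qed
  have "ennreal ?e * emeasure M {w \<in> space M. q \<le> Q w} =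
      (\<integral>\<^sup>+w. ennreal ?e * indicator {w \<in> space M. q \<le> Q w} w \<partial>M)"
    by (simp add: nn_integral_cmult_indicator)
  also have "\<dots> \<le> (\<integral>\<^sup>+w. F w \<partial>M)"
    using lower by (intro nn_integral_mono) (auto simp: indicator_def)
  also have "\<dots> = (\<integral>\<^sup>+g. \<integral>\<^sup>+w. ?cosh w g *
    indicator ball g \<partial>M \<partial>gauss_pi I)"
    unfolding F_def using P.Fubini[OF Fm] by simp
  also have "\<dots> \<le> (\<integral>\<^sup>+g. 2 * ?q g \<partial>gauss_pi I)"
  proof (rule nn_integral_mono)
    fix g
    show "(\<integral>\<^sup>+w. ?cosh w g *
      indicator ball g \<partial>M) \<le> 2 * ?q g"
    proof (cases "g \<in> ball")
      case True
      have bd: "(\<integral>\<^sup>+w. ennreal (exp (s * (\<Sum>p\<in>I. y w p * g p))) \<partial>M) \<le>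
          ?q g" if "\<bar>s\<bar> = 1" for s
        using nn_integral_exp_dev_ball[OF I(1) \<phi> \<phi>1 _ that, where \<eta> = \<eta> and g = g and R = R] True R \<eta>(1)
        by (simp add: y_def A_def ball_def R_def sum_distrib_left mult_ac)
      have "(\<integral>\<^sup>+w. ?cosh w g *
          indicator ball g \<partial>M) =
          (\<integral>\<^sup>+w. ennreal (exp (1 * (\<Sum>p\<in>I. y w p * g p))) + ennreal (exp (-1 * (\<Sum>p\<in>I. y w p * g p))) \<partial>M)"
        using True by (simp add: sum_negf)
      also have "\<dots> = (\<integral>\<^sup>+w. ennreal (exp (1 * (\<Sum>p\<in>I. y w p * g p))) \<partial>M) +
          (\<integral>\<^sup>+w. ennreal (exp (-1 * (\<Sum>p\<in>I. y w p * g p))) \<partial>M)"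
        unfolding y_def by (intro nn_integral_add) measurable
      also have "\<dots> \<le> ?q g +
          ?q g"
        by (intro add_mono bd) auto
      finally show ?thesis by (simp add: mult_2)
    qed simp
  qed
  also have "\<dots> = 2 * (\<integral>\<^sup>+g. ?q g \<partial>gauss_pi I)"
    by (intro nn_integral_cmult) measurable
  also have "\<dots> \<le> 2 * ennreal ?T" using quad by (intro mult_left_mono) auto
  finally have "ennreal ?e * emeasure M {w \<in> space M. q \<le> Q w} \<le> ennreal (2 * ?T)"
    by (simp add: ennreal_mult)
  hence "ennreal (exp (- (\<eta> * real n * q / 2))) * (ennreal ?e * emeasure M {w \<in> space M. q \<le> Q w}) \<le>
      ennreal (exp (- (\<eta> * real n * q / 2))) * ennreal (2 * ?T)"
    by (intro mult_left_mono) auto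
  also have "ennreal (exp (- (\<eta> * real n * q / 2))) * (ennreal ?e * emeasure M {w \<in> space M. q \<le> Q w}) =
      emeasure M {w \<in> space M. q \<le> Q w}"
    by (simp flip: mult.assoc ennreal_mult' exp_add)
  also have "ennreal (exp (- (\<eta> * real n * q / 2))) * ennreal (2 * ?T) =
      ennreal (2 * exp (- (\<eta> * real n * q / 2) + real (card I) * \<eta> * L))"
    unfolding exp_add by (simp add: mult_ac flip: ennreal_mult')
  also have "- (\<eta> * real n * q / 2) + real (card I) * \<eta> * L = \<eta> * (real (card I) * L - real n * q / 2)"
    by (simp add: algebra_simps)
  finally show ?thesis by (simp add: Q_def)
qed

end

section \<open>Trigonometric polynomials\<close>

lemma measurable_exp_basis [measurable]: "exp_basis j \<in> borel_measurable borel"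
  unfolding exp_basis_def[abs_def] by measurable

lemma cmod_exp_basis [simp]: "cmod (exp_basis j t) = 1"
proof -
  have "exp_basis j t = cis (2 * pi * of_int j * t)"
    unfolding exp_basis_def cis_conv_exp by (simp add: mult_ac)
  thus ?thesis by simp
qed

definition trig :: "bool \<times> int \<Rightarrow> real \<Rightarrow> real" where
  "trig p t = (if fst p then sin (2 * pi * of_int (snd p) * t) else cos (2 * pi * of_int (snd p) * t))"

abbreviation band :: "nat \<Rightarrow> int set" where
  "band k \<equiv> {- int k..int k}"

text \<open>Both signs of the frequency are kept, although they give the same functions up to sign,
  and so is the zero function \<open>trig (True, 0)\<close>. In this way the sum of squares over
  \<open>freqs k\<close> is the sum of the squared moduli over the whole band.\<close>

definition freqs :: "nat \<Rightarrow> (bool \<times> int) set" where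
  "freqs k = UNIV \<times> band k"

lemma exp_basis_trig:
  "exp_basis j (- t) = complex_of_real (trig (False, j) t) - \<i> * complex_of_real (trig (True, j) t)"
proof -
  have "exp_basis j (- t) = cis (- (2 * pi * of_int j * t))"
    unfolding exp_basis_def cis_conv_exp by (simp add: mult_ac)
  thus ?thesis by (simp add: trig_def complex_eq_iff)
qed

lemma measurable_trig [measurable]: "trig p \<in> borel_measurable borel"
  unfolding trig_def[abs_def] by measurable

lemma abs_trig_le: "\<bar>trig p t\<bar> \<le> 1"
  by (simp add: trig_def)

lemma finite_freqs [simp]: "finite (freqs k)" by (simp add: freqs_def)

lemma card_freqs: "card (freqs k) = 2 * (2 * k + 1)"
  by (simp add: freqs_def card_cartesian_product)

lemma sum_freqs: "(\<Sum>p\<in>freqs k. f p) = (\<Sum>j\<in>band k. f (False, j) + f (True, j))"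
proof -
  have "(\<Sum>p\<in>freqs k. f p) = (\<Sum>b\<in>UNIV. \<Sum>j\<in>band k. f (b, j))"
    unfolding freqs_def by (simp add: sum.cartesian_product)
  thus ?thesis by (simp add: UNIV_bool sum.distrib add.commute)
qed

context bounded_laplace
begin

definition base_coeff :: "int \<Rightarrow> complex" where
  "base_coeff j = (LINT t|\<mu>. exp_basis j (- t))"

definition noise :: "nat \<Rightarrow> 'w \<Rightarrow> real" where
  "noise k w = (\<Sum>p\<in>freqs k. (dev (trig p) w)\<^sup>2)"

lemma measurable_noise [measurable]: "noise k \<in> borel_measurable M"
  unfolding noise_def[abs_def] by measurable

lemma noise_nonneg [simp]: "0 \<le> noise k w"
  by (simp add: noise_def sum_nonneg)

lemma integrable_trig [simp]: "integrable \<mu> (trig p)"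
  by (rule integrable_base[of _ 1]) (auto simp: abs_trig_le)

lemma base_coeff_trig:
  "base_coeff j = complex_of_real (LINT t|\<mu>. trig (False, j) t) - \<i> * complex_of_real (LINT t|\<mu>. trig (True, j) t)"
  unfolding base_coeff_def exp_basis_trig
  by (subst Bochner_Integration.integral_diff) auto

lemma abs_integral_trig_le: "\<bar>LINT t|\<mu>. trig (b, j) t\<bar> \<le> cmod (base_coeff j)"
  using abs_Re_le_cmod[of "base_coeff j"] abs_Im_le_cmod[of "base_coeff j"]
  by (cases b) (auto simp: base_coeff_trig)

text \<open>The product formulas for sine and cosine express the covariance of two frequencies
  through the Fourier coefficients of the base measure at their difference and sum.\<close>

lemma abs_integral_trig_mult_le:
  "\<bar>LINT t|\<mu>. trig (a, i) t * trig (b, j) t\<bar> \<le> (cmod (base_coeff (i - j)) + cmod (base_coeff (i + j))) / 2"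
proof -
  have tr: "\<exists>c d e. \<bar>c\<bar> = 1 \<and> \<bar>d\<bar> = 1 \<and> (\<forall>t. trig (a, i) t * trig (b, j) t =
      (c * trig (e, i - j) t + d * trig (e, i + j) t) / 2)"
  proof -
    have f: "2 * pi * real_of_int (i - j) * t = 2 * pi * real_of_int i * t - 2 * pi * real_of_int j * t"
      "2 * pi * real_of_int (i + j) * t = 2 * pi * real_of_int i * t + 2 * pi * real_of_int j * t" for t
      by (simp_all add: algebra_simps)
    show ?thesis
    proof (cases a; cases b)
      assume "a" "b" thus ?thesis
        by (intro exI[of _ 1] exI[of _ "-1"] exI[of _ False]) (simp add: trig_def f cos_add cos_diff del: of_int_add of_int_diff)
    next
      assume "a" "\<not> b" thus ?thesis
        by (intro exI[of _ 1] exI[of _ "1"] exI[of _ True]) (simp add: trig_def f sin_add sin_diff del: of_int_add of_int_diff)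
    next
      assume "\<not> a" "b" thus ?thesis
        by (intro exI[of _ "-1"] exI[of _ "1"] exI[of _ True]) (simp add: trig_def f sin_add sin_diff del: of_int_add of_int_diff)
    next
      assume "\<not> a" "\<not> b" thus ?thesis
        by (intro exI[of _ 1] exI[of _ "1"] exI[of _ False]) (simp add: trig_def f cos_add cos_diff del: of_int_add of_int_diff)
    qed
  qed
  then obtain c d e where cd: "\<bar>c\<bar> = 1" "\<bar>d\<bar> = 1" and
    eq: "\<And>t. trig (a, i) t * trig (b, j) t = (c * trig (e, i - j) t + d * trig (e, i + j) t) / 2" by blast
  have "\<bar>LINT t|\<mu>. trig (a, i) t * trig (b, j) t\<bar> =
      \<bar>c * (LINT t|\<mu>. trig (e, i - j) t) + d * (LINT t|\<mu>. trig (e, i + j) t)\<bar> / 2"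
    unfolding eq by simp
  also have "\<dots> \<le> (\<bar>c * (LINT t|\<mu>. trig (e, i - j) t)\<bar> + \<bar>d * (LINT t|\<mu>. trig (e, i + j) t)\<bar>) / 2"
    by (intro divide_right_mono abs_triangle_ineq) auto
  also have "\<dots> \<le> (cmod (base_coeff (i - j)) + cmod (base_coeff (i + j))) / 2"
    using cd by (intro divide_right_mono add_mono) (auto simp: abs_mult abs_integral_trig_le)
  finally show ?thesis .
qed

text \<open>For a fixed frequency i, both i - j and i + j are injective in j, so each of the two
  resulting sums runs over distinct coefficients and is at most \<open>B\<close>.\<close>

lemma row_sum_trig_le:
  assumes B: "\<And>F. finite F \<Longrightarrow> (\<Sum>j\<in>F. cmod (base_coeff j)) \<le> B"
  shows "(\<Sum>q\<in>freqs k. \<bar>LINT t|\<mu>. trig p t * trig q t\<bar>) \<le> 2 * B"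
proof -
  obtain a i where p: "p = (a, i)" by (cases p)
  let ?J = "band k"
  have "(\<Sum>q\<in>freqs k. \<bar>LINT t|\<mu>. trig p t * trig q t\<bar>) \<le>
      (\<Sum>j\<in>?J. cmod (base_coeff (i - j)) + cmod (base_coeff (i + j)))"
    unfolding sum_freqs p
    using abs_integral_trig_mult_le[of a i False] abs_integral_trig_mult_le[of a i True]
    by (intro sum_mono) (smt (verit) field_sum_of_halves)
  also have "\<dots> = (\<Sum>j\<in>(\<lambda>j. i - j) ` ?J. cmod (base_coeff j)) + (\<Sum>j\<in>(\<lambda>j. i + j) ` ?J. cmod (base_coeff j))"
    by (subst (1 2) sum.reindex) (auto simp: sum.distrib inj_on_def)
  also have "\<dots> \<le> B + B" by (intro add_mono B) auto
  finally show ?thesis by simp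
qed

text \<open>The squared modulus of the error of the j-th empirical Fourier coefficient: up to sign,
  the two deviations are its real and imaginary part.\<close>

definition dev2 :: "int \<Rightarrow> 'w \<Rightarrow> real" where
  "dev2 j w = (dev (trig (False, j)) w)\<^sup>2 + (dev (trig (True, j)) w)\<^sup>2"

lemma measurable_dev2 [measurable]: "dev2 j \<in> borel_measurable M"
  unfolding dev2_def[abs_def] by measurable

lemma dev2_nonneg [simp]: "0 \<le> dev2 j w"
  by (simp add: dev2_def)

lemma cmod_base_coeff_le: "cmod (base_coeff j) \<le> mass"
proof -
  have "cmod (base_coeff j) \<le> (LINT t|\<mu>. cmod (exp_basis j (- t)))"
    unfolding base_coeff_def by (rule integral_norm_bound)
  thus ?thesis by simp
qed

lemma noise_dev2: "noise k w = (\<Sum>j\<in>band k. dev2 j w)"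
  unfolding noise_def sum_freqs dev2_def ..

lemma mean_dev2: "mean_le (dev2 j) (8 * exp (2 * mass) / real n)"
  unfolding dev2_def[abs_def]
  using mean_le_add[OF mean_abs_dev_power[OF measurable_trig abs_trig_le, of "(False, j)" 2]
      mean_abs_dev_power[OF measurable_trig abs_trig_le, of "(True, j)" 2]]
  by (simp add: mult.assoc)

lemma mean_dev_power4: "mean_le (\<lambda>w. (dev (trig p) w) ^ 4) (48 * exp (2 * mass) / (real n)\<^sup>2)"
proof -
  have "sqrt (real n) ^ 4 = (sqrt (real n) ^ 2) ^ 2" by (simp add: power_mult[symmetric] del: real_sqrt_pow2)
  thus ?thesis
    using mean_abs_dev_power[OF measurable_trig abs_trig_le, of p 4] by (simp add: fact_numeral)
qed

lemma mean_dev2_square: "mean_le (\<lambda>w. (dev2 j w)\<^sup>2) (192 * exp (2 * mass) / (real n)\<^sup>2)"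
proof -
  from mean_le_cmult[OF mean_le_add[OF mean_dev_power4 mean_dev_power4, of "(False, j)" "(True, j)"], of 2]
  have "mean_le (\<lambda>w. 2 * ((dev (trig (False, j)) w) ^ 4 + (dev (trig (True, j)) w) ^ 4)) (192 * exp (2 * mass) / (real n)\<^sup>2)"
    by simp
  thus ?thesis
  proof (rule mean_le_mono)
    fix w
    have "(a + b)\<^sup>2 \<le> 2 * (a\<^sup>2 + b\<^sup>2)" for a b :: real
      using sum_squares_bound[of a b] by (simp add: power2_sum)
    from this[of "(dev (trig (False, j)) w)\<^sup>2" "(dev (trig (True, j)) w)\<^sup>2"]
    show "(dev2 j w)\<^sup>2 \<le> 2 * ((dev (trig (False, j)) w) ^ 4 + (dev (trig (True, j)) w) ^ 4)"
      by (simp add: dev2_def flip: power_mult)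
  qed auto
qed

lemma mean_dev2_indicator:
  assumes "E \<in> sets M" "emeasure M E \<le> ennreal (p\<^sup>2)" "p > 0"
  shows "mean_le (\<lambda>w. dev2 j w * indicator E w) (14 * exp mass / real n * p)"
proof (rule mean_le_indicator[OF mean_le_trans[OF mean_dev2_square]])
  \<comment> \<open>The second moment has to be bounded by a square for Cauchy-Schwarz, and 14^2 =
    196.\<close>
  show "192 * exp (2 * mass) / (real n)\<^sup>2 \<le> (14 * exp mass / real n)\<^sup>2"
    unfolding exp_double by (simp add: power_mult_distrib power_divide divide_right_mono)
qed (use assms n_pos in auto)

lemma mean_noise: "mean_le (noise k) (8 * real (2 * k + 1) * exp (2 * mass) / real n)"
proof -
  have "mean_le (noise k) (\<Sum>j\<in>band k. 8 * exp (2 * mass) / real n)"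
    unfolding noise_dev2[abs_def] by (intro mean_le_sum mean_dev2) simp
  thus ?thesis by (rule mean_le_trans) (simp add: algebra_simps)
qed

lemma mean_noise_indicator:
  assumes "E \<in> sets M" "emeasure M E \<le> ennreal (p\<^sup>2)" "p > 0"
  shows "mean_le (\<lambda>w. noise k w * indicator E w) (14 * real (2 * k + 1) * exp mass / real n * p)"
proof -
  have "mean_le (\<lambda>w. noise k w * indicator E w) (\<Sum>j\<in>band k. 14 * exp mass / real n * p)"
    unfolding noise_dev2 sum_distrib_right by (intro mean_le_sum mean_dev2_indicator assms) simp
  thus ?thesis by (rule mean_le_trans) (simp add: algebra_simps)
qed

text \<open>The trace contributes 2 (2k + 1) L to the exponent and the threshold subtracts 5/2 L (2k
  + 1) \<Lambda>; as \<Lambda> \<ge> 1, at least half of L (2k + 1) \<Lambda> is left. Hypothesis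
  \<open>D\<close> is the condition that keeps the truncated functions small: the quantity to be
  compared with 1/25 is at most 70/3 * \<eta> V \<le> 7/180. The bound 1 / (100 B^2) on \<eta> is 1
  / (25 (2 B)^2) for the row sums 2 B.\<close>

lemma emeasure_noise_ge:
  assumes B: "\<And>F. finite F \<Longrightarrow> (\<Sum>j\<in>F. cmod (base_coeff j)) \<le> B" "B \<ge> 1" and L: "mass \<le> L" "L \<ge> 1"
    and V: "V > 0" and \<eta>: "\<eta> > 0" "\<eta> \<le> 1 / (100 * B\<^sup>2)" "\<eta> \<le> 1 / (6 * L)" "\<eta> \<le> 1 / (600 * V)"
    and \<Lambda>: "\<Lambda> \<ge> 1" and D: "(real (2 * k + 1))\<^sup>2 * \<Lambda> \<le> V * real n"
  shows "emeasure M {w \<in> space M. 5 * L * real (2 * k + 1) * \<Lambda> / real n \<le> noise k w} \<le>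
    ennreal (2 * exp (- \<eta> / 2 * real (2 * k + 1) * \<Lambda>))"
proof -
  let ?D = "real (2 * k + 1)"
  have n: "real n > 0" using n_pos by simp
  have D0: "?D > 0" by simp
  let ?q = "5 * L * ?D * \<Lambda> / real n"
  have N: "real (card (freqs k)) = 2 * ?D" by (simp add: card_freqs)
  have "freqs k \<noteq> {}" by (simp add: freqs_def)
  moreover have "\<eta> / real n * real (card (freqs k)) * (5 * real (card (freqs k)) + 2 * (\<eta> * real n * ?q)) \<le> 1 / 25"
  proof -
    have \<eta>L: "\<eta> * L \<le> 1 / 6" and \<eta>V: "\<eta> * V \<le> 1 / 600" using \<eta> L V by (simp_all add: field_simps)
    have "\<eta> / real n * (2 * ?D) * (5 * (2 * ?D) + 2 * (\<eta> * real n * ?q)) =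
        \<eta> / real n * (20 * (?D\<^sup>2 * 1) + 20 * (\<eta> * L) * (?D\<^sup>2 * \<Lambda>))"
      using n by (simp add: power2_eq_square algebra_simps add_divide_distrib)
    also have "\<dots> \<le> \<eta> / real n * (20 * (?D\<^sup>2 * \<Lambda>) + 20 * (1 / 6) * (?D\<^sup>2 * \<Lambda>))"
      using \<eta>L \<eta>(1) n \<Lambda> D0 by (intro mult_left_mono add_mono mult_right_mono) auto
    also have "\<dots> = \<eta> / real n * (70 / 3 * (?D\<^sup>2 * \<Lambda>))" by simp
    also have "\<dots> \<le> \<eta> / real n * (70 / 3 * (V * real n))"
      using D \<eta>(1) n by (intro mult_left_mono) auto
    also have "\<dots> = 70 / 3 * (\<eta> * V)" using n by simp
    also have "\<dots> \<le> 1 / 25" using \<eta>V by simp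
    finally show ?thesis unfolding N .
  qed
  moreover have "\<eta> \<le> 1 / (25 * (2 * B)\<^sup>2)" using \<eta>(2) by (simp add: power_mult_distrib)
  ultimately have "emeasure M {w \<in> space M. ?q \<le> noise k w} \<le>
      ennreal (2 * exp (\<eta> * (real (card (freqs k)) * L - real n * ?q / 2)))"
    unfolding noise_def using row_sum_trig_le[OF B(1)] B(2) L \<eta> \<Lambda> n D0
    by (intro emeasure_sum_dev_square_ge[where B = "2 * B"]) (auto simp: abs_trig_le)
  also have "\<dots> \<le> ennreal (2 * exp (- \<eta> / 2 * ?D * \<Lambda>))"
  proof (intro ennreal_leI mult_left_mono iffD2[OF exp_le_cancel_iff])
    have "real (card (freqs k)) * L - real n * ?q / 2 = L * ?D * (2 - 5 / 2 * \<Lambda>)"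
    proof -
      have "real n * ?q = 5 * L * ?D * \<Lambda>" using n by simp
      thus ?thesis unfolding N by (simp add: algebra_simps)
    qed
    also have "\<dots> \<le> L * ?D * (- \<Lambda> / 2)" using \<Lambda> L D0 by (intro mult_left_mono) auto
    also have "\<dots> \<le> 1 * ?D * (- \<Lambda> / 2)"
      using L D0 \<Lambda> by (intro mult_right_mono_neg mult_right_mono) auto
    finally have "\<eta> * (real (card (freqs k)) * L - real n * ?q / 2) \<le> \<eta> * (?D * (- \<Lambda> / 2))"
      using \<eta>(1) by (intro mult_left_mono) auto
    thus "\<eta> * (real (card (freqs k)) * L - real n * ?q / 2) \<le> - \<eta> / 2 * ?D * \<Lambda>"
      by (simp add: mult_ac)
  qed auto
  finally show ?thesis .
qed

end

section \<open>Fourier coefficients\<close>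

lemma exp_basis_add: "exp_basis j (s + t) = exp_basis j s * exp_basis j t"
  unfolding exp_basis_def by (simp add: exp_add[symmetric] algebra_simps)

lemma exp_basis_0 [simp]: "exp_basis 0 t = 1"
  by (simp add: exp_basis_def)

lemma exp_basis_frac: "exp_basis j (- frac t) = exp_basis j (- t)"
proof -
  have "exp_basis j (of_int \<lfloor>t\<rfloor>) = 1"
    unfolding exp_basis_def exp_eq_1 by (auto intro!: exI[of _ "j * \<lfloor>t\<rfloor>"])
  moreover have "- frac t = - t + of_int \<lfloor>t\<rfloor>" by (simp add: frac_def)
  ultimately show ?thesis by (simp only: exp_basis_add) simp
qed

lemma set_integrable_const_bound:
  fixes g :: "real \<Rightarrow> 'b :: {banach, second_countable_topology}"
  assumes "g \<in> borel_measurable borel" "\<And>t. norm (g t) \<le> b"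
  shows "set_integrable lborel {0..<1} g"
proof (rule set_integrable_bound)
  show "set_integrable lborel {0..<1} (\<lambda>_::real. b)"
    unfolding set_integrable_def by (intro integrable_indicator) auto
  show "set_borel_measurable lborel {0..<1} g"
    unfolding set_borel_measurable_def using assms(1) by (intro borel_measurable_scaleR borel_measurable_indicator) auto
  show "AE t in lborel. t \<in> {0..<1} \<longrightarrow> norm (g t) \<le> norm b"
    using assms(2) order.trans[OF assms(2) abs_ge_self] by auto
qed

lemma square_integrable_imp_set_integrable:
  assumes "square_integrable g"
  shows "set_integrable lborel {0..<1} g"
proof (rule set_integrable_bound)
  show "set_integrable lborel {0..<1} (\<lambda>t. 1 + (g t)\<^sup>2)"
  proof (intro set_integral_add)
    show "set_integrable lborel {0..<1} (\<lambda>_::real. 1 :: real)"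
      by (rule set_integrable_const_bound[of _ 1]) auto
    show "set_integrable lborel {0..<1} (\<lambda>t. (g t)\<^sup>2)" using assms by (simp add: square_integrable_def)
  qed
  show "set_borel_measurable lborel {0..<1} g" using assms by (simp add: square_integrable_def)
  have "\<bar>y\<bar> \<le> 1 + y\<^sup>2" for y :: real
    using sum_squares_bound[of 1 "\<bar>y\<bar>"] zero_le_power2[of y] by simp
  thus "AE t in lborel. t \<in> {0..<1} \<longrightarrow> norm (g t) \<le> norm (1 + (g t)\<^sup>2)"
    by (auto intro: order.trans abs_ge_self)
qed

lemma integral_intensity_exp_basis:
  assumes "set_integrable lborel {0..<1} g" "AE t in lborel. t \<in> {0..<1} \<longrightarrow> 0 \<le> g t"
  shows "(LINT t|intensity_measure g. exp_basis j (- t)) = fourier_coeff (\<lambda>t. complex_of_real (g t)) j"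
  unfolding fourier_coeff_def
  by (subst integral_intensity_measure[OF assms]) (auto simp: scaleR_conv_of_real)

text \<open>Reduction modulo 1 is invisible to integer frequencies, so the integrand of the double
  integral factorises.\<close>

lemma integral_convolution_exp_basis:
  assumes g: "set_integrable lborel {0..<1} g" "AE t in lborel. t \<in> {0..<1} \<longrightarrow> 0 \<le> g t"
    and f: "set_integrable lborel {0..<1} f" "AE t in lborel. t \<in> {0..<1} \<longrightarrow> 0 \<le> f t"
  shows "(LINT t|convolution_measure g f. exp_basis j (- t)) =
    fourier_coeff (\<lambda>t. complex_of_real (g t)) j * fourier_coeff (\<lambda>t. complex_of_real (f t)) j"
proof -
  have "(LINT t|convolution_measure g f. exp_basis j (- t)) =
      (\<integral>s. (\<integral>e. exp_basis j (- frac (s + e)) \<partial>intensity_measure f) \<partial>intensity_measure g)"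
    by (rule integral_convolution_measure[where b = 1])
      (auto intro: finite_measure_intensity_measure g f)
  also have "\<dots> = (\<integral>s. exp_basis j (- s) * (\<integral>e. exp_basis j (- e) \<partial>intensity_measure f) \<partial>intensity_measure g)"
  proof -
    have "exp_basis j (- frac (s + e)) = exp_basis j (- s) * exp_basis j (- e)" for s e
      unfolding exp_basis_frac exp_basis_add[symmetric] by simp
    thus ?thesis by simp
  qed
  also have "\<dots> = (\<integral>s. exp_basis j (- s) \<partial>intensity_measure g) * (\<integral>e. exp_basis j (- e) \<partial>intensity_measure f)"
    by simp
  finally show ?thesis
    by (simp only: integral_intensity_exp_basis[OF g] integral_intensity_exp_basis[OF f])
qed

lemma integral_dirac_sum:
  fixes g :: "real \<Rightarrow> complex"
  assumes [measurable]: "g \<in> borel_measurable borel" and y: "\<And>j. j < k \<Longrightarrow> y j \<in> {0..<1}"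
  shows "(LINT t:{0..<1}|dirac_sum k y. g t) = (\<Sum>j<k. g (y j))"
proof -
  have "(LINT t:{0..<1}|dirac_sum k y. g t) = (LINT j|count_space {..<k}. indicator {0..<1} (y j) *\<^sub>R g (y j))"
    unfolding set_lebesgue_integral_def dirac_sum_def by (subst integral_distr) auto
  also have "\<dots> = (\<Sum>j<k. indicator {0..<1} (y j) *\<^sub>R g (y j))"
    by (rule lebesgue_integral_count_space_finite) simp
  also have "\<dots> = (\<Sum>j<k. g (y j))" using y by (intro sum.cong) (auto simp: indicator_def)
  finally show ?thesis .
qed

lemma sum_le_wnorm2:
  assumes "\<And>j. \<omega> j > 0" and "wnorm2 \<omega> g \<le> ennreal c" and "c \<ge> 0" and "finite F"
  shows "(\<Sum>j\<in>F. \<omega> j * (cmod (fourier_coeff g j))\<^sup>2) \<le> c"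
proof -
  have "(\<Sum>j\<in>F. ennreal (\<omega> j * (cmod (fourier_coeff g j))\<^sup>2)) \<le> wnorm2 \<omega> g"
    unfolding wnorm2_def using assms(4) by (subst nonneg_infsum_complete) (auto intro!: SUP_upper)
  also note assms(2)
  finally have "ennreal (\<Sum>j\<in>F. \<omega> j * (cmod (fourier_coeff g j))\<^sup>2) \<le> ennreal c"
    using assms(1) by (subst (asm) sum_ennreal) (auto simp: less_imp_le)
  thus ?thesis using assms(3) by simp
qed

lemma wnorm2_le:
  assumes "\<And>j. \<omega> j > 0" and "\<And>F. finite F \<Longrightarrow> (\<Sum>j\<in>F. \<omega> j * (cmod (fourier_coeff g j))\<^sup>2) \<le> c"
  shows "wnorm2 \<omega> g \<le> ennreal c"
  unfolding wnorm2_def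
proof (rule infsum_le_finite_sums)
  fix F :: "int set" assume "finite F"
  thus "(\<Sum>j\<in>F. ennreal (\<omega> j * (cmod (fourier_coeff g j))\<^sup>2)) \<le> ennreal c"
    using assms by (subst sum_ennreal) (auto simp: less_imp_le intro!: ennreal_leI)
qed (auto intro: nonneg_summable_on_complete)

lemma set_integral_exp_basis: "(LINT t:{0..<1}|lborel. exp_basis j t) = (if j = 0 then 1 else 0)"
proof (cases "j = 0")
  case True
  thus ?thesis by (simp add: set_lebesgue_integral_def)
next
  case False
  let ?c = "2 * complex_of_real pi * \<i> * of_int j"
  have c: "?c \<noteq> 0" using False by simp
  have "(LBINT t=ereal 0..ereal 1. exp_basis j t) = exp_basis j 1 / ?c - exp_basis j 0 / ?c"
  proof (rule interval_integral_FTC_finite)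
    show "continuous_on {min 0 1..max 0 1} (exp_basis j)"
      unfolding exp_basis_def by (intro continuous_intros)
    fix t :: real
    have "((\<lambda>t. exp (?c * complex_of_real t) / ?c) has_vector_derivative (exp (?c * complex_of_real t) * (?c * 1)) / ?c) (at t within {min 0 1..max 0 1})"
      by (rule has_vector_derivative_real_field derivative_eq_intros refl | simp add: c)+
    thus "((\<lambda>t. exp_basis j t / ?c) has_vector_derivative exp_basis j t) (at t within {min 0 1..max 0 1})"
      using c unfolding exp_basis_def by simp
  qed
  also have "exp_basis j 1 = 1" unfolding exp_basis_def exp_eq_1 by (auto intro!: exI[of _ j])
  also have "exp_basis j 0 = 1" by (simp add: exp_basis_def)
  finally have "(LBINT t=ereal 0..ereal 1. exp_basis j t) = 0" by simp
  moreover have "(LBINT t=ereal 0..ereal 1. exp_basis j t) = (LINT t:{0..<1}|lborel. exp_basis j t)"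
    by (subst interval_integral_Ico) auto
  ultimately show ?thesis using False by simp
qed

lemma fourier_coeff_trig_poly_minus:
  assumes g: "set_integrable lborel {0..<1} g"
  shows "fourier_coeff (\<lambda>t. (\<Sum>j\<in>band k. c j * exp_basis j t) - complex_of_real (g t)) i =
    (if i \<in> band k then c i else 0) - fourier_coeff (\<lambda>t. complex_of_real (g t)) i"
proof -
  have e: "exp_basis j t * exp_basis i (- t) = exp_basis (j - i) t" for j t
    unfolding exp_basis_def by (simp add: exp_add[symmetric] algebra_simps)
  have i1: "set_integrable lborel {0..<1} (\<lambda>t. c j * exp_basis (j - i) t)" for j
    by (intro set_integrable_mult_right set_integrable_const_bound[of _ 1]) auto
  have i2: "set_integrable lborel {0..<1} (\<lambda>t. complex_of_real (g t) * exp_basis i (- t))"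
  proof -
    have gi: "integrable lborel (\<lambda>t. indicat_real {0..<1} t * g t)"
      using g by (simp add: set_integrable_def)
    have "(\<lambda>t. complex_of_real (indicat_real {0..<1} t * g t)) \<in> borel_measurable lborel"
      using measurable_compose[OF borel_measurable_integrable[OF gi], of complex_of_real borel] by simp
    hence "integrable lborel (\<lambda>t. complex_of_real (indicat_real {0..<1} t * g t) * exp_basis i (- t))"
      by (intro Bochner_Integration.integrable_bound[OF gi] borel_measurable_times)
        (auto simp del: of_real_mult simp: norm_mult)
    thus ?thesis by (simp add: set_integrable_def scaleR_conv_of_real mult_ac)
  qed
  have i3: "integrable lborel (\<lambda>t. indicat_real {0..<1} t *\<^sub>R (c j * exp_basis (j - i) t))" for j
    using i1 unfolding set_integrable_def .
  have i4: "set_integrable lborel {0..<1} (\<lambda>t. \<Sum>j\<in>band k. c j * exp_basis (j - i) t)"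
    unfolding set_integrable_def scaleR_sum_right by (intro Bochner_Integration.integrable_sum i3)
  have "fourier_coeff (\<lambda>t. (\<Sum>j\<in>band k. c j * exp_basis j t) - complex_of_real (g t)) i =
      (LINT t:{0..<1}|lborel. (\<Sum>j\<in>band k. c j * exp_basis (j - i) t) - complex_of_real (g t) * exp_basis i (- t))"
    unfolding fourier_coeff_def by (simp add: left_diff_distrib sum_distrib_right mult.assoc e)
  also have "\<dots> = (LINT t:{0..<1}|lborel. (\<Sum>j\<in>band k. c j * exp_basis (j - i) t)) -
      fourier_coeff (\<lambda>t. complex_of_real (g t)) i"
    unfolding fourier_coeff_def by (intro set_integral_diff i2 i4)
  also have "(LINT t:{0..<1}|lborel. (\<Sum>j\<in>band k. c j * exp_basis (j - i) t)) =
      (\<Sum>j\<in>band k. c j * (if j - i = 0 then 1 else 0))"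
  proof -
    have "(LINT t:{0..<1}|lborel. c j * exp_basis (j - i) t) = c j * (if j - i = 0 then 1 else 0)" for j
      unfolding set_integral_exp_basis[symmetric] by simp
    thus ?thesis
      unfolding set_lebesgue_integral_def scaleR_sum_right
      by (subst Bochner_Integration.integral_sum) (auto intro: i3)
  qed
  also have "\<dots> = (if i \<in> band k then c i else 0)"
    by (simp add: if_distrib[of "(*) _"] eq_commute[of _ i] cong: if_cong)
  finally show ?thesis .
qed

section \<open>Model selection and the weight sequences\<close>

text \<open>Every index up to the minimum is at most \<open>Inf - 1\<close> and so lies strictly
  below all members of \<open>A\<close>. The index 0 is excluded because 0 - 1 = 0 for extended
  naturals.\<close>

lemma le_the_enat_Inf:
  assumes "j \<le> the_enat (min (Inf (enat ` A) - 1) (enat n))"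
  shows "j \<le> n" and "1 \<le> j \<Longrightarrow> j \<notin> A"
proof -
  obtain N where N: "min (Inf (enat ` A) - 1) (enat n) = enat N"
    using enat_ile[OF min.cobounded2] by blast
  hence j: "j \<le> N" using assms by simp
  have "enat N \<le> enat n" unfolding N[symmetric] by (rule min.cobounded2)
  thus "j \<le> n" using j by simp
  show "j \<notin> A" if "1 \<le> j"
  proof
    assume "j \<in> A"
    hence "Inf (enat ` A) \<le> enat j" by (intro Inf_lower) auto
    moreover have "enat N \<le> Inf (enat ` A) - 1" unfolding N[symmetric] by (rule min.cobounded1)
    ultimately have "enat N \<le> enat (j - 1)"
      by (cases "Inf (enat ` A)") (auto simp: one_enat_def)
    thus False using j that by simp
  qed
qed

lemma cmod_add_square_le:
  assumes "c > 0"
  shows "(cmod (x + y))\<^sup>2 \<le> (1 + c) * (cmod x)\<^sup>2 + (1 + 1 / c) * (cmod y)\<^sup>2"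
proof -
  have "(cmod (x + y))\<^sup>2 \<le> (cmod x + cmod y)\<^sup>2" by (intro power_mono norm_triangle_ineq) auto
  also have "\<dots> = (cmod x)\<^sup>2 + (cmod y)\<^sup>2 + 2 * (sqrt c * cmod x) * (cmod y / sqrt c)"
    using assms by (simp add: power2_sum)
  also have "2 * (sqrt c * cmod x) * (cmod y / sqrt c) \<le> (sqrt c * cmod x)\<^sup>2 + (cmod y / sqrt c)\<^sup>2"
    by (rule sum_squares_bound)
  also have "(sqrt c * cmod x)\<^sup>2 + (cmod y / sqrt c)\<^sup>2 = c * (cmod x)\<^sup>2 + (1 / c) * (cmod y)\<^sup>2"
    using assms by (simp add: power_mult_distrib power_divide)
  finally show ?thesis by (simp add: algebra_simps)
qed

text \<open>The model selection argument for one realisation: \<open>a\<close> and \<open>l\<close> are the estimated and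
  the true coefficients, and \<open>E\<close> bounds how much the loss in any model exceeds half of its penalty.\<close>

lemma model_selection_bound:
  fixes a l :: "int \<Rightarrow> complex" and \<omega> :: "int \<Rightarrow> real" and pen :: "nat \<Rightarrow> real"
  defines "A \<equiv> \<lambda>k. \<Sum>j\<in>band k. \<omega> j * (cmod (a j))\<^sup>2"
  defines "V \<equiv> \<lambda>k. \<Sum>j\<in>band k. \<omega> j * (cmod (a j - l j))\<^sup>2"
  assumes \<omega>: "\<And>j. \<omega> j > 0" and k: "k \<le> K" and kt: "kt \<le> K"
    and pen: "\<And>k. pen k \<ge> 0" and sel: "pen kt - A kt \<le> pen k - A k"
    and \<beta>: "\<And>F. finite F \<Longrightarrow> F \<inter> band k = {} \<Longrightarrow> (\<Sum>j\<in>F. \<omega> j * (cmod (l j))\<^sup>2) \<le> \<beta>"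
    and E: "E \<ge> 0" "\<And>k. k \<le> K \<Longrightarrow> V k \<le> E + pen k / 2" and F: "finite F"
  shows "(\<Sum>j\<in>F. \<omega> j * (cmod ((if j \<in> band kt then a j else 0) - l j))\<^sup>2) \<le> 2 * pen k + 2 * V k + 7 * \<beta> + 4 * E"
proof -
  have \<beta>0: "\<beta> \<ge> 0" using \<beta>[of "{}"] by simp
  have V0: "V k \<ge> 0" for k unfolding V_def using \<omega> by (intro sum_nonneg) (simp add: less_imp_le)
  have Jmono: "band k \<subseteq> band k'" if "k \<le> k'" for k k' using that by auto
  have A_diff: "A k' - A k = (\<Sum>j\<in>band k' - band k. \<omega> j * (cmod (a j))\<^sup>2)"
    and V_diff: "V k' - V k = (\<Sum>j\<in>band k' - band k. \<omega> j * (cmod (a j - l j))\<^sup>2)" if "k \<le> k'" for k k'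
    using Jmono[OF that] by (simp_all add: A_def V_def sum_diff)
  have "(\<Sum>j\<in>F. \<omega> j * (cmod ((if j \<in> band kt then a j else 0) - l j))\<^sup>2) =
      (\<Sum>j\<in>F \<inter> band kt. \<omega> j * (cmod (a j - l j))\<^sup>2) + (\<Sum>j\<in>F - band kt. \<omega> j * (cmod (l j))\<^sup>2)"
    using F by (subst sum.Int_Diff[of F _ "band kt"]) (auto intro!: arg_cong2[of _ _ _ _ "(+)"] sum.cong)
  also have "(\<Sum>j\<in>F \<inter> band kt. \<omega> j * (cmod (a j - l j))\<^sup>2) \<le> V kt"
    unfolding V_def using \<omega> by (intro sum_mono2) (auto simp: less_imp_le)
  finally have main: "(\<Sum>j\<in>F. \<omega> j * (cmod ((if j \<in> band kt then a j else 0) - l j))\<^sup>2) \<le>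
      V kt + (\<Sum>j\<in>F - band kt. \<omega> j * (cmod (l j))\<^sup>2)" by simp
  show ?thesis
  proof (cases "kt \<le> k")
    case True
    have "(\<Sum>j\<in>F - band kt. \<omega> j * (cmod (l j))\<^sup>2) \<le>
        (\<Sum>j\<in>(band k - band kt) \<union> (F - band k). \<omega> j * (cmod (l j))\<^sup>2)"
      using \<omega> F by (intro sum_mono2) (auto simp: less_imp_le)
    also have "\<dots> = (\<Sum>j\<in>band k - band kt. \<omega> j * (cmod (l j))\<^sup>2) + (\<Sum>j\<in>F - band k. \<omega> j * (cmod (l j))\<^sup>2)"
      using F by (intro sum.union_disjoint) auto
    also have "(\<Sum>j\<in>F - band k. \<omega> j * (cmod (l j))\<^sup>2) \<le> \<beta>" using F by (intro \<beta>) auto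
    also have "(\<Sum>j\<in>band k - band kt. \<omega> j * (cmod (l j))\<^sup>2) \<le>
        (\<Sum>j\<in>band k - band kt. 2 * (\<omega> j * (cmod (a j))\<^sup>2) + 2 * (\<omega> j * (cmod (a j - l j))\<^sup>2))"
    proof (rule sum_mono)
      fix j
      have "(cmod (l j))\<^sup>2 \<le> 2 * (cmod (a j))\<^sup>2 + 2 * (cmod (a j - l j))\<^sup>2"
        using cmod_add_square_le[of 1 "a j" "l j - a j"] by (simp add: norm_minus_commute)
      hence "\<omega> j * (cmod (l j))\<^sup>2 \<le> \<omega> j * (2 * (cmod (a j))\<^sup>2 + 2 * (cmod (a j - l j))\<^sup>2)"
        using \<omega>[of j] by (intro mult_left_mono) auto
      thus "\<omega> j * (cmod (l j))\<^sup>2 \<le> 2 * (\<omega> j * (cmod (a j))\<^sup>2) + 2 * (\<omega> j * (cmod (a j - l j))\<^sup>2)"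
        by (simp add: algebra_simps)
    qed
    also have "\<dots> = 2 * (A k - A kt) + 2 * (V k - V kt)"
      by (simp add: A_diff[OF True] V_diff[OF True] sum.distrib sum_distrib_left)
    finally show ?thesis using main sel pen[of kt] V0[of kt] \<beta>0 E(1) by simp
  next
    case False
    hence kk: "k \<le> kt" by simp
    have "pen kt - pen k \<le> A kt - A k" using sel by simp
    also have "\<dots> \<le> (\<Sum>j\<in>band kt - band k. 3 / 2 * (\<omega> j * (cmod (a j - l j))\<^sup>2) + 3 * (\<omega> j * (cmod (l j))\<^sup>2))"
      unfolding A_diff[OF kk]
    proof (rule sum_mono)
      fix j
      have "(cmod (a j))\<^sup>2 \<le> 3 / 2 * (cmod (a j - l j))\<^sup>2 + 3 * (cmod (l j))\<^sup>2"
        using cmod_add_square_le[of "1/2" "a j - l j" "l j"] by simp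
      hence "\<omega> j * (cmod (a j))\<^sup>2 \<le> \<omega> j * (3 / 2 * (cmod (a j - l j))\<^sup>2 + 3 * (cmod (l j))\<^sup>2)"
        using \<omega>[of j] by (intro mult_left_mono) auto
      thus "\<omega> j * (cmod (a j))\<^sup>2 \<le> 3 / 2 * (\<omega> j * (cmod (a j - l j))\<^sup>2) + 3 * (\<omega> j * (cmod (l j))\<^sup>2)"
        by (simp add: algebra_simps)
    qed
    also have "\<dots> = 3 / 2 * (V kt - V k) + 3 * (\<Sum>j\<in>band kt - band k. \<omega> j * (cmod (l j))\<^sup>2)"
      by (simp add: V_diff[OF kk] sum.distrib sum_distrib_left)
    also have "(\<Sum>j\<in>band kt - band k. \<omega> j * (cmod (l j))\<^sup>2) \<le> \<beta>" by (intro \<beta>) auto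
    finally have "pen kt - pen k \<le> 3 / 2 * (V kt - V k) + 3 * \<beta>" by simp
    \<comment> \<open>The factor 3/2 has to stay below 2. Inserted into V kt \<le> E + pen kt / 2,
      this inequality gives V kt \<le> E + pen k / 2 + 3/4 V kt + 3/2 \<beta>, hence V kt \<le> 4 E
      + 2 pen k + 6 \<beta>. The seventh \<beta> is the bias outside the selected band.\<close>
    hence "pen kt \<le> pen k + 3 / 2 * V kt + 3 * \<beta>"
      using V0[of k] unfolding right_diff_distrib by linarith
    moreover have "(\<Sum>j\<in>F - band kt. \<omega> j * (cmod (l j))\<^sup>2) \<le> \<beta>"
      using F Jmono[OF kk] by (intro \<beta>) auto
    ultimately show ?thesis using main E(2)[OF kt] V0[of k] by simp
  qed
qed

section \<open>Consequences of the assumptions on the weight sequences\<close>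

locale weight_sequences =
  fixes r d :: real and \<gamma> \<alpha> \<omega> :: "int \<Rightarrow> real"
  assumes r_pos: "r > 0" and d_ge_1: "d \<ge> 1"
    and \<gamma>_pos: "\<And>j. \<gamma> j > 0" and \<alpha>_pos: "\<And>j. \<alpha> j > 0" and \<omega>_pos: "\<And>j. \<omega> j > 0"
    and \<gamma>_sym: "\<And>j. \<gamma> (- j) = \<gamma> j" and \<alpha>_sym: "\<And>j. \<alpha> (- j) = \<alpha> j" and \<omega>_sym: "\<And>j. \<omega> (- j) = \<omega> j"
    and \<gamma>_0: "\<gamma> 0 = 1" and \<omega>_0: "\<omega> 0 = 1" and \<alpha>_0: "\<alpha> 0 = 1"
    and \<gamma>_ge_1: "\<And>j. \<gamma> j \<ge> 1"
    and dec_\<omega>\<gamma>: "decseq (\<lambda>n::nat. \<omega> (int n) / \<gamma> (int n))"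
    and dec_\<alpha>: "decseq (\<lambda>n::nat. \<alpha> (int n))"
    and summable_\<alpha>: "\<alpha> summable_on UNIV"
begin

abbreviation "\<Delta> \<equiv> Delta_alpha \<omega> \<alpha>"
abbreviation "\<delta> \<equiv> delta_alpha \<omega> \<alpha>"

definition A :: real where "A = infsum \<alpha> UNIV"

definition logratio :: "nat \<Rightarrow> real" where
  "logratio k = ln (max (\<Delta> k) (real k + 3)) / ln (real k + 3)"

lemma \<omega>_nat: "\<omega> j = \<omega> (int (nat \<bar>j\<bar>))" and \<alpha>_nat: "\<alpha> j = \<alpha> (int (nat \<bar>j\<bar>))" and \<gamma>_nat: "\<gamma> j = \<gamma> (int (nat \<bar>j\<bar>))"
  using \<omega>_sym[of j] \<alpha>_sym[of j] \<gamma>_sym[of j] by (auto simp: abs_if)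

lemma \<alpha>_antimono: "\<bar>i\<bar> \<le> \<bar>j\<bar> \<Longrightarrow> \<alpha> j \<le> \<alpha> i"
  using decseqD[OF dec_\<alpha>, of "nat \<bar>i\<bar>" "nat \<bar>j\<bar>"] \<alpha>_nat[of i] \<alpha>_nat[of j] by (simp add: nat_mono)

lemma \<omega>\<gamma>_antimono: "\<bar>i\<bar> \<le> \<bar>j\<bar> \<Longrightarrow> \<omega> j / \<gamma> j \<le> \<omega> i / \<gamma> i"
  using decseqD[OF dec_\<omega>\<gamma>, of "nat \<bar>i\<bar>" "nat \<bar>j\<bar>"] \<omega>_nat[of i] \<omega>_nat[of j] \<gamma>_nat[of i] \<gamma>_nat[of j]
  by (simp add: nat_mono)

lemma sum_\<alpha>_le: "finite F \<Longrightarrow> sum \<alpha> F \<le> A"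
  unfolding A_def using \<alpha>_pos by (intro finite_sum_le_infsum summable_\<alpha>) (auto simp: less_imp_le)

lemma A_ge_1: "A \<ge> 1"
  using sum_\<alpha>_le[of "{0}"] by (simp add: \<alpha>_0)

text \<open>All 2k + 1 summands up to |j| = k are at least \<alpha> k. This decay bounds the
  admissible dimensions and lets the truncation work.\<close>

lemma \<alpha>_le: "real (2 * k + 1) * \<alpha> (int k) \<le> A"
proof -
  have "real (2 * k + 1) * \<alpha> (int k) = (\<Sum>j\<in>band k. \<alpha> (int k))" by simp
  also have "\<dots> \<le> sum \<alpha> (band k)" by (intro sum_mono \<alpha>_antimono) auto
  also have "\<dots> \<le> A" by (rule sum_\<alpha>_le) simp
  finally show ?thesis .
qed

lemma \<Delta>_ge: "\<bar>j\<bar> \<le> int k \<Longrightarrow> \<omega> j / \<alpha> j \<le> \<Delta> k"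
  unfolding Delta_alpha_def using \<omega>_nat[of j] \<alpha>_nat[of j]
  by (intro Max_ge) (auto intro!: image_eqI[of _ _ "nat \<bar>j\<bar>"])

lemma \<Delta>_ge_1: "\<Delta> k \<ge> 1"
  using \<Delta>_ge[of 0 k] by (simp add: \<omega>_0 \<alpha>_0)

lemma \<Delta>_nonneg: "0 \<le> \<Delta> k"
  using \<Delta>_ge_1[of k] by simp

lemma \<Delta>_mono: "k \<le> k' \<Longrightarrow> \<Delta> k \<le> \<Delta> k'"
  unfolding Delta_alpha_def by (intro Max_mono) auto

lemma ln_k3: "ln (real k + 3) \<ge> 1"
proof -
  have "exp 1 \<le> real k + 3" using exp_le by simp
  thus ?thesis by (subst ln_ge_iff) auto
qed

lemma logratio_ge_1: "logratio k \<ge> 1"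
  unfolding logratio_def using ln_k3[of k] by (subst le_divide_eq_1_pos) (auto simp: ln_ge_iff)

lemma delta_eq: "\<delta> k = real (2 * k + 1) * \<Delta> k * logratio k"
  by (simp add: delta_alpha_def logratio_def)

lemma delta_ge: "real (2 * k + 1) * \<Delta> k \<le> \<delta> k"
  unfolding delta_eq using mult_left_mono[OF logratio_ge_1[of k], of "real (2 * k + 1) * \<Delta> k"] \<Delta>_ge_1[of k]
  by simp

lemma delta_pos: "\<delta> k > 0"
proof -
  have "0 < real (2 * k + 1) * \<Delta> k" using \<Delta>_ge_1[of k] by simp
  thus ?thesis using delta_ge[of k] by linarith
qed

lemma omega_plus_ge: "i \<le> j \<Longrightarrow> \<omega> (int i) \<le> omega_plus \<omega> j"
  unfolding omega_plus_def by (intro Max_ge) auto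

lemma N_alpha_le: "k \<le> N_alpha \<omega> \<alpha> n \<Longrightarrow> k \<le> n"
  unfolding N_alpha_def by (rule le_the_enat_Inf)

lemma M_alpha_le: "k \<le> M_alpha \<alpha> d m \<Longrightarrow> k \<le> m"
  unfolding M_alpha_def by (rule le_the_enat_Inf)

lemma N_alphaD:
  assumes "1 \<le> k" "k \<le> N_alpha \<omega> \<alpha> n" "n \<ge> 1"
  shows "real (2 * k + 1) * (ln (real n + 3) * omega_plus \<omega> k) \<le> real n * \<alpha> (int k)"
proof -
  have "\<alpha> (int k) / (2 * real k + 1) \<ge> ln (real n + 3) * omega_plus \<omega> k / real n"
    using le_the_enat_Inf[OF assms(2)[unfolded N_alpha_def]] assms(1) by auto
  thus ?thesis using assms(3) by (simp add: field_simps)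
qed

lemma M_alphaD:
  assumes "1 \<le> k" "k \<le> M_alpha \<alpha> d m"
  shows "640 * d * (1 / real m) * ln (real m + 1) \<le> \<alpha> (int k)"
  using le_the_enat_Inf[OF assms(2)[unfolded M_alpha_def]] assms(1) by auto

lemma \<Delta>_le:
  assumes "1 \<le> k" "k \<le> N_alpha \<omega> \<alpha> n" "n \<ge> 1"
  shows "real (2 * k + 1) * \<Delta> k * ln (real n + 3) \<le> real n"
proof -
  have "\<Delta> k \<le> omega_plus \<omega> k / \<alpha> (int k)"
    unfolding Delta_alpha_def
  proof (rule Max.boundedI)
    fix z assume "z \<in> (\<lambda>j. \<omega> (int j) / \<alpha> (int j)) ` {0..k}"
    then obtain j where j: "j \<le> k" "z = \<omega> (int j) / \<alpha> (int j)" by auto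
    have "\<omega> (int j) / \<alpha> (int j) \<le> omega_plus \<omega> k / \<alpha> (int k)"
    proof (rule frac_le)
      show "0 \<le> omega_plus \<omega> k" using omega_plus_ge[of 0 k] by (simp add: \<omega>_0)
      show "\<omega> (int j) \<le> omega_plus \<omega> k" using j by (intro omega_plus_ge)
      show "\<alpha> (int k) \<le> \<alpha> (int j)" using j by (intro \<alpha>_antimono) auto
    qed (rule \<alpha>_pos)
    thus "z \<le> omega_plus \<omega> k / \<alpha> (int k)" using j by simp
  qed auto
  hence "real (2 * k + 1) * \<Delta> k * ln (real n + 3) \<le> real (2 * k + 1) * (omega_plus \<omega> k / \<alpha> (int k)) * ln (real n + 3)"
    by (intro mult_right_mono mult_left_mono) auto
  also have "\<dots> \<le> real n"
    using N_alphaD[OF assms] \<alpha>_pos[of "int k"] by (simp add: field_simps)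
  finally show ?thesis .
qed

lemma \<Delta>_le_n:
  assumes "k \<le> N_alpha \<omega> \<alpha> n" "n \<ge> 1"
  shows "real (2 * k + 1) * \<Delta> k \<le> real n"
proof (cases "k = 0")
  case True
  thus ?thesis using assms by (simp add: Delta_alpha_def \<omega>_0 \<alpha>_0)
next
  case False
  have "real (2 * k + 1) * \<Delta> k * 1 \<le> real (2 * k + 1) * \<Delta> k * ln (real n + 3)"
    using ln_k3[of n] \<Delta>_ge_1[of k] by (intro mult_left_mono) auto
  thus ?thesis using \<Delta>_le[of k n] False assms by linarith
qed

text \<open>Up to constants, \<open>(2k + 1) log (n + 3) / n \<le> \<alpha> k \<le> 1 / (2k + 1)\<close>.  This bound keeps the linear
  term of the deviation inequality harmless.\<close>

lemma dimension_bound: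
  assumes "1 \<le> k" "k \<le> N_alpha \<omega> \<alpha> n" "n \<ge> 1"
  shows "(real (2 * k + 1))\<^sup>2 * logratio k \<le> A * real n"
proof -
  have kn: "k \<le> n" using N_alpha_le assms by blast
  have ln3: "ln (real n + 3) \<ge> 1" by (rule ln_k3)
  have "real (2 * k + 1) \<ge> 1" by simp
  hence "\<Delta> k * 1 \<le> real (2 * k + 1) * \<Delta> k"
    using \<Delta>_ge_1[of k] by (simp add: mult_le_cancel_right1)
  hence "\<Delta> k \<le> real n" using \<Delta>_le_n[OF assms(2,3)] by linarith
  hence "max (\<Delta> k) (real k + 3) \<le> real n + 3" using kn by simp
  hence "ln (max (\<Delta> k) (real k + 3)) \<le> ln (real n + 3)" by (subst ln_le_cancel_iff) auto
  hence "logratio k \<le> ln (real n + 3) / 1"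
    unfolding logratio_def using ln_k3[of k] ln3 by (intro frac_le) auto
  hence "(real (2 * k + 1))\<^sup>2 * logratio k \<le> (real (2 * k + 1))\<^sup>2 * ln (real n + 3)"
    by (intro mult_left_mono) auto
  also have "\<dots> = real (2 * k + 1) * (real (2 * k + 1) * (ln (real n + 3) * 1))"
    by (simp add: power2_eq_square)
  also have "\<dots> \<le> real (2 * k + 1) * (real (2 * k + 1) * (ln (real n + 3) * omega_plus \<omega> k))"
    using omega_plus_ge[of 0 k] ln3 by (intro mult_left_mono) (auto simp: \<omega>_0)
  also have "\<dots> \<le> real (2 * k + 1) * (real n * \<alpha> (int k))"
    using N_alphaD[OF assms] by (intro mult_left_mono) auto
  also have "\<dots> = (real (2 * k + 1) * \<alpha> (int k)) * real n" by simp
  also have "\<dots> \<le> A * real n" using \<alpha>_le[of k] by (intro mult_right_mono) auto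
  finally show ?thesis .
qed

text \<open>Below \<open>N_alpha\<close> each \<omega> j is at most n \<alpha> j, and \<alpha> is
  summable. For a bad sample the weights 1 / |f_hat j|^2 are only known to be at most m; this bound
  then cancels the 1/n of the variances.\<close>

lemma sum_\<omega>_le:
  assumes "K \<le> N_alpha \<omega> \<alpha> n" "n \<ge> 1"
  shows "(\<Sum>j\<in>band K. \<omega> j) \<le> A * real n"
proof -
  have "\<omega> j \<le> real n * \<alpha> j" if "j \<in> band K" for j
  proof (cases "j = 0")
    case True thus ?thesis using assms by (simp add: \<omega>_0 \<alpha>_0)
  next
    case False
    let ?k = "nat \<bar>j\<bar>"
    have k: "1 \<le> ?k" "?k \<le> N_alpha \<omega> \<alpha> n" using that False assms(1) by auto
    have "1 * (1 * \<omega> (int ?k)) \<le> real (2 * ?k + 1) * (ln (real n + 3) * omega_plus \<omega> ?k)"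
      using ln_k3[of n] omega_plus_ge[of ?k ?k] \<omega>_pos[of "int ?k"] by (intro mult_mono) auto
    also have "\<dots> \<le> real n * \<alpha> (int ?k)" by (rule N_alphaD[OF k assms(2)])
    finally show ?thesis using \<omega>_nat[of j] \<alpha>_nat[of j] by simp
  qed
  hence "(\<Sum>j\<in>band K. \<omega> j) \<le> (\<Sum>j\<in>band K. real n * \<alpha> j)" by (rule sum_mono)
  also have "\<dots> = real n * sum \<alpha> (band K)" by (simp add: sum_distrib_left)
  also have "\<dots> \<le> real n * A" by (intro mult_left_mono sum_\<alpha>_le) auto
  finally show ?thesis by (simp add: mult.commute)
qed

text \<open>\<open>Phi\<close> is a supremum over k \<ge> 1, and the additional 1/m pays for j = 0.
  The family is bounded by 1 because \<omega> / \<gamma> decreases from 1, so the supremum is an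
  upper bound.\<close>

lemma Phi_ge: "\<omega> j / \<gamma> j * min 1 (1 / (real m * \<alpha> j)) \<le> Phi \<omega> \<gamma> \<alpha> m + 1 / real m"
  and Phi_nonneg: "Phi \<omega> \<gamma> \<alpha> m \<ge> 0"
proof -
  let ?g = "\<lambda>k::nat. \<omega> (int k) / \<gamma> (int k) * min 1 (1 / (real m * \<alpha> (int k)))"
  have g0: "?g k \<ge> 0" for k
    using \<omega>_pos[of "int k"] \<gamma>_pos[of "int k"] \<alpha>_pos[of "int k"] by (simp add: less_imp_le)
  have "?g k \<le> 1" for k
  proof -
    have "?g k \<le> 1 * 1"
      using \<omega>\<gamma>_antimono[of 0 "int k"] \<omega>_pos[of "int k"] \<gamma>_pos[of "int k"] \<alpha>_pos[of "int k"] \<omega>_0 \<gamma>_0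
      by (intro mult_mono) (auto simp: less_imp_le)
    thus ?thesis by simp
  qed
  hence bdd: "bdd_above (?g ` {1..})" by (intro bdd_aboveI[of _ 1]) auto
  have ge: "?g k \<le> Phi \<omega> \<gamma> \<alpha> m" if "k \<ge> 1" for k
    unfolding Phi_def using that bdd by (intro cSUP_upper) auto
  show 0: "Phi \<omega> \<gamma> \<alpha> m \<ge> 0" using ge[of 1] g0[of 1] by linarith
  show "\<omega> j / \<gamma> j * min 1 (1 / (real m * \<alpha> j)) \<le> Phi \<omega> \<gamma> \<alpha> m + 1 / real m"
  proof (cases "j = 0")
    case True
    have "min 1 (1 / real m) \<le> 1 / real m" by simp
    thus ?thesis using 0 True by (simp add: \<omega>_0 \<gamma>_0 \<alpha>_0 del: min_less_iff_disj)
  next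
    case False
    hence "?g (nat \<bar>j\<bar>) \<le> Phi \<omega> \<gamma> \<alpha> m" by (intro ge) auto
    moreover have "1 / real m \<ge> 0" by simp
    ultimately show ?thesis unfolding \<omega>_nat[of j] \<gamma>_nat[of j] \<alpha>_nat[of j] by linarith
  qed
qed

end

section \<open>The estimator\<close>

definition estimate :: "nat \<Rightarrow> nat \<Rightarrow> (nat \<Rightarrow> real measure) \<Rightarrow> (nat \<Rightarrow> real) \<Rightarrow> int \<Rightarrow> complex" where
  "estimate n m N Y j = ell_hat n N j / f_hat m Y j *
     (if (cmod (f_hat m Y j))\<^sup>2 \<ge> 1 / real m then 1 else 0)"

lemma lambda_hat_estimate:
  "lambda_hat n m N Y k = (\<lambda>t. \<Sum>j\<in>band k. estimate n m N Y j * exp_basis j t)"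
  by (simp add: lambda_hat_def estimate_def fun_eq_iff)

lemma fourier_coeff_lambda_hat:
  "fourier_coeff (lambda_hat n m N Y k) i = (if i \<in> band k then estimate n m N Y i else 0)"
proof -
  have z: "set_integrable lborel {0..<1} (\<lambda>_::real. 0 :: real)" by (simp add: set_integrable_def)
  show ?thesis
    unfolding lambda_hat_estimate
    using fourier_coeff_trig_poly_minus[OF z, where k = k and c = "estimate n m N Y" and i = i]
    by (simp add: fourier_coeff_def[of "\<lambda>_. 0"] set_lebesgue_integral_def)
qed

text \<open>For k \<le> min n m the estimator of order min n m has the same coefficients on the band
  of k, so the inner product is the squared norm of the estimator itself, and it is subtracted
  twice.\<close>

lemma contrast_lambda_hat:
  assumes \<omega>: "\<And>j. \<omega> j > 0" and k: "k \<le> min n m"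
  shows "contrast \<omega> n m N Y (lambda_hat n m N Y k) =
    - (\<Sum>j\<in>band k. \<omega> j * (cmod (estimate n m N Y j))\<^sup>2)"
proof -
  let ?J = "band k" and ?c = "estimate n m N Y"
  have "wnorm2 \<omega> (lambda_hat n m N Y k) = (\<Sum>\<^sub>\<infinity>j\<in>?J. ennreal (\<omega> j * (cmod (?c j))\<^sup>2))"
    unfolding wnorm2_def fourier_coeff_lambda_hat by (rule infsum_cong_neutral) auto
  also have "\<dots> = ennreal (\<Sum>j\<in>?J. \<omega> j * (cmod (?c j))\<^sup>2)"
    using \<omega> by (simp add: sum_ennreal less_imp_le)
  finally have 1: "enn2real (wnorm2 \<omega> (lambda_hat n m N Y k)) = (\<Sum>j\<in>?J. \<omega> j * (cmod (?c j))\<^sup>2)"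
    using \<omega> by (simp add: sum_nonneg less_imp_le)
  have "winner \<omega> (lambda_hat n m N Y (min n m)) (lambda_hat n m N Y k) =
      (\<Sum>\<^sub>\<infinity>j\<in>?J. of_real (\<omega> j) * ?c j * cnj (?c j))"
    unfolding winner_def fourier_coeff_lambda_hat using k by (intro infsum_cong_neutral) auto
  also have "\<dots> = of_real (\<Sum>j\<in>?J. \<omega> j * (cmod (?c j))\<^sup>2)"
    by (simp add: mult.assoc flip: complex_norm_square)
  finally show ?thesis unfolding contrast_def 1 by simp
qed

definition (in deconvolution_model) observed_sum :: "(real \<Rightarrow> real) \<Rightarrow> 'w \<Rightarrow> real" where
  "observed_sum u w = (\<Sum>i=1..n. \<Sum>j<\<nu> i w. u (frac (x i j w + \<epsilon> i j w)))"

definition (in deconvolution_model) sample_sum :: "(real \<Rightarrow> real) \<Rightarrow> 'w \<Rightarrow> real" where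
  "sample_sum u w = (\<Sum>l=1..m. u (Y l w))"

locale adaptive_deconvolution =
  weight_sequences r d \<gamma> \<alpha> \<omega> + deconvolution_model M n m lam f \<nu> x \<epsilon> Y
  for r d :: real and \<gamma> \<alpha> \<omega> :: "int \<Rightarrow> real"
    and M :: "'w measure" and n m :: nat and lam f :: "real \<Rightarrow> real"
    and \<nu> :: "nat \<Rightarrow> 'w \<Rightarrow> nat" and x \<epsilon> :: "nat \<Rightarrow> nat \<Rightarrow> 'w \<Rightarrow> real" and Y :: "nat \<Rightarrow> 'w \<Rightarrow> real" +
  assumes n_ge_1: "n \<ge> 1" and m_ge_1: "m \<ge> 1"
    and lam_class: "lam \<in> intensity_class \<gamma> r" and f_class: "f \<in> density_class \<alpha> d"
begin

abbreviation lam_coeff :: "int \<Rightarrow> complex" where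
  "lam_coeff j \<equiv> fourier_coeff (\<lambda>t. complex_of_real (lam t)) j"

abbreviation f_coeff :: "int \<Rightarrow> complex" where
  "f_coeff j \<equiv> fourier_coeff (\<lambda>t. complex_of_real (f t)) j"

abbreviation N_obs :: "'w \<Rightarrow> nat \<Rightarrow> real measure" where
  "N_obs w \<equiv> \<lambda>i. observed_process \<nu> x \<epsilon> i w"

abbreviation Y_obs :: "'w \<Rightarrow> nat \<Rightarrow> real" where
  "Y_obs w \<equiv> \<lambda>l. Y l w"

abbreviation "est w \<equiv> estimate n m (N_obs w) (Y_obs w)"

abbreviation "ell w \<equiv> ell_hat n (N_obs w)"

abbreviation "fhat w \<equiv> f_hat m (Y_obs w)"

abbreviation "lam_hat w \<equiv> lambda_hat n m (N_obs w) (Y_obs w)"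

lemma lam_integrable: "set_integrable lborel {0..<1} lam"
  and lam_nonneg: "AE t in lborel. t \<in> {0..<1} \<longrightarrow> 0 \<le> lam t"
  and f_integrable: "set_integrable lborel {0..<1} f"
  and f_nonneg: "AE t in lborel. t \<in> {0..<1} \<longrightarrow> 0 \<le> f t"
  using lam_class f_class
  by (auto simp: intensity_class_def density_class_def intro: square_integrable_imp_set_integrable)

lemma f_coeff_0: "f_coeff 0 = 1"
  using f_class by (simp add: density_class_def)

lemma f_coeff_bounds: "\<alpha> j / d \<le> (cmod (f_coeff j))\<^sup>2" "(cmod (f_coeff j))\<^sup>2 \<le> d * \<alpha> j"
proof -
  have "1 / d \<le> (cmod (f_coeff j))\<^sup>2 / \<alpha> j" "(cmod (f_coeff j))\<^sup>2 / \<alpha> j \<le> d"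
    using f_class by (auto simp: density_class_def)
  thus "\<alpha> j / d \<le> (cmod (f_coeff j))\<^sup>2" "(cmod (f_coeff j))\<^sup>2 \<le> d * \<alpha> j"
    using \<alpha>_pos[of j] d_ge_1 by (simp_all add: field_simps)
qed

lemma f_coeff_pos: "cmod (f_coeff j) > 0"
proof -
  have "\<alpha> j / d > 0" using \<alpha>_pos[of j] d_ge_1 by simp
  hence "(cmod (f_coeff j))\<^sup>2 > 0" using f_coeff_bounds(1)[of j] by linarith
  thus ?thesis by simp
qed

lemma sum_lam_le: "finite F \<Longrightarrow> (\<Sum>j\<in>F. \<gamma> j * (cmod (lam_coeff j))\<^sup>2) \<le> r"
  using lam_class r_pos \<gamma>_pos by (intro sum_le_wnorm2) (auto simp: intensity_class_def)

lemma prob_space_intensity_f: "prob_space (intensity_measure f)"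
proof -
  have "\<epsilon> 1 0 \<in> borel_measurable M" using measurable_model(3)[of 1 0] n_ge_1 by simp
  thus ?thesis using prob_space_distr[of "\<epsilon> 1 0" lborel] distr_error[of 1 0] n_ge_1 by simp
qed

sublocale obs: bounded_laplace M "convolution_measure lam f" n observed_sum
proof (intro bounded_laplace.intro bounded_laplace_axioms.intro)
  interpret F: prob_space "intensity_measure f" by (rule prob_space_intensity_f)
  show "prob_space M" by (rule prob_space_axioms)
  show "finite_measure (convolution_measure lam f)"
    by (intro finite_measure_convolution_measure finite_measure_intensity_measure lam_integrable lam_nonneg F.finite_measure_axioms)
  show "1 \<le> n" by (rule n_ge_1)
  show "sets (convolution_measure lam f) = sets borel" by simp
  fix u :: "real \<Rightarrow> real" assume u [measurable]: "u \<in> borel_measurable borel"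
  show "observed_sum u \<in> borel_measurable M"
    unfolding observed_sum_def[abs_def]
  proof (rule borel_measurable_sum)
    fix i assume i: "i \<in> {1..n}"
    note [measurable] = measurable_model[OF i]
    show "(\<lambda>w. \<Sum>j<\<nu> i w. u (frac (x i j w + \<epsilon> i j w))) \<in> borel_measurable M"
      by (rule measurable_compose_countable[of "\<lambda>k w. \<Sum>j<k. u (frac (x i j w + \<epsilon> i j w))"]) measurable
  qed
  fix b assume "\<And>t. \<bar>u t\<bar> \<le> b"
  thus "(\<integral>\<^sup>+w. ennreal (exp (observed_sum u w)) \<partial>M) \<le>
      ennreal (exp (real n * (LINT t|convolution_measure lam f. exp (u t) - 1)))"
    unfolding observed_sum_def using nn_integral_exp_observed[OF n_ge_1 lam_integrable lam_nonneg u] by blast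
next
  fix I :: "(bool \<times> int) set" and c :: "bool \<times> int \<Rightarrow> real" and \<phi> w assume "finite I"
  show "observed_sum (\<lambda>t. \<Sum>i\<in>I. c i * \<phi> i t) w = (\<Sum>i\<in>I. c i * observed_sum (\<phi> i) w)"
    unfolding observed_sum_def sum_distrib_left
    by (rule trans[OF sum.cong[OF refl sum.swap] sum.swap])
qed

text \<open>For an i.i.d. sample the Laplace transform is the m-th power of 1 plus the integral of
  exp u - 1; by 1 + x \<le> exp x it is at most its Poisson counterpart.\<close>

sublocale samp: bounded_laplace M "intensity_measure f" m sample_sum
proof (intro bounded_laplace.intro bounded_laplace_axioms.intro)
  interpret F: prob_space "intensity_measure f" by (rule prob_space_intensity_f)
  show "prob_space M" by (rule prob_space_axioms)
  show "finite_measure (intensity_measure f)" by (rule F.finite_measure_axioms)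
  show "1 \<le> m" by (rule m_ge_1)
  show "sets (intensity_measure f) = sets borel" by simp
  have Ym [measurable]: "Y l \<in> borel_measurable M" if "l \<in> {1..m}" for l
    using distributed_measurable[OF sample_density[OF that]] by simp
  fix u :: "real \<Rightarrow> real" assume u [measurable]: "u \<in> borel_measurable borel"
  show "sample_sum u \<in> borel_measurable M"
    unfolding sample_sum_def[abs_def] by (intro borel_measurable_sum) measurable
  fix b assume b: "\<And>t. \<bar>u t\<bar> \<le> b"
  let ?I = "LINT t|intensity_measure f. exp (u t) - 1"
  have int: "integrable (intensity_measure f) (\<lambda>t. exp (u t))"
    by (rule F.integrable_const_bound[of _ "exp b"]) (use b in \<open>auto simp: abs_le_iff\<close>)
  have "(\<integral>\<^sup>+w. ennreal (exp (sample_sum u w)) \<partial>M) = (\<integral>\<^sup>+w. (\<Prod>l=1..m. ennreal (exp (u (Y l w)))) \<partial>M)"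
    by (simp add: sample_sum_def exp_sum prod_ennreal)
  also have "\<dots> = (\<Prod>l=1..m. \<integral>\<^sup>+w. ennreal (exp (u (Y l w))) \<partial>M)"
  proof (rule indep_vars_nn_integral)
    show "indep_vars (\<lambda>_. borel) (\<lambda>l w. ennreal (exp (u (Y l w)))) {1..m}"
      by (rule indep_vars_compose2[OF sample_indep, where Y = "\<lambda>_ y. ennreal (exp (u y))"]) measurable
  qed auto
  also have "\<dots> \<le> (\<Prod>l=1..m. ennreal (exp ?I))"
  proof (rule prod_mono_ennreal)
    fix l assume l: "l \<in> {1..m}"
    have "(\<integral>\<^sup>+w. ennreal (exp (u (Y l w))) \<partial>M) = (\<integral>\<^sup>+t. ennreal (exp (u t)) \<partial>distr M lborel (Y l))"
      using Ym[OF l] by (subst nn_integral_distr) auto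
    also have "distr M lborel (Y l) = intensity_measure f"
      using distributed_distr_eq_density[OF sample_density[OF l]] by (simp add: intensity_measure_def)
    also have "(\<integral>\<^sup>+t. ennreal (exp (u t)) \<partial>intensity_measure f) = ennreal (LINT t|intensity_measure f. exp (u t))"
      by (rule nn_integral_eq_integral[OF int]) simp
    also have "(LINT t|intensity_measure f. exp (u t)) = 1 + ?I"
      using int F.prob_space by (subst Bochner_Integration.integral_diff) auto
    also have "ennreal (1 + ?I) \<le> ennreal (exp ?I)"
      by (intro ennreal_leI exp_ge_add_one_self)
    finally show "(\<integral>\<^sup>+w. ennreal (exp (u (Y l w))) \<partial>M) \<le> ennreal (exp ?I)" .
  qed
  also have "\<dots> = ennreal (exp (real m * ?I))"
    by (simp add: ennreal_power exp_of_nat_mult)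
  finally show "(\<integral>\<^sup>+w. ennreal (exp (sample_sum u w)) \<partial>M) \<le> ennreal (exp (real m * ?I))" .
next
  fix I :: "(bool \<times> int) set" and c :: "bool \<times> int \<Rightarrow> real" and \<phi> w assume "finite I"
  show "sample_sum (\<lambda>t. \<Sum>i\<in>I. c i * \<phi> i t) w = (\<Sum>i\<in>I. c i * sample_sum (\<phi> i) w)"
    unfolding sample_sum_def sum_distrib_left by (rule sum.swap)
qed

lemma samp_mass: "samp.mass = 1"
  using prob_space.prob_space[OF prob_space_intensity_f] by simp

lemma samp_base_coeff: "samp.base_coeff j = f_coeff j"
  unfolding samp.base_coeff_def by (rule integral_intensity_exp_basis[OF f_integrable f_nonneg])

lemma obs_base_coeff: "obs.base_coeff j = lam_coeff j * f_coeff j"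
  unfolding obs.base_coeff_def
  by (rule integral_convolution_exp_basis[OF lam_integrable lam_nonneg f_integrable f_nonneg])

lemma f_hat_minus: "fhat w j - f_coeff j =
    complex_of_real (samp.dev (trig (False, j)) w) - \<i> * complex_of_real (samp.dev (trig (True, j)) w)"
proof -
  have "fhat w j = complex_of_real (sample_sum (trig (False, j)) w / real m) -
      \<i> * complex_of_real (sample_sum (trig (True, j)) w / real m)"
    by (simp add: f_hat_def sample_sum_def exp_basis_trig sum_subtractf sum_distrib_left diff_divide_distrib)
  thus ?thesis
    unfolding samp_base_coeff[symmetric] samp.base_coeff_trig samp.dev_def by (simp add: algebra_simps)
qed

lemma ell_hat_minus: 
  assumes "w \<in> space M"
  shows "ell w j - obs.base_coeff j =
    complex_of_real (obs.dev (trig (False, j)) w) - \<i> * complex_of_real (obs.dev (trig (True, j)) w)"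
proof -
  have "(LINT t:{0..<1}|observed_process \<nu> x \<epsilon> i w. exp_basis j (- t)) =
      (\<Sum>k<\<nu> i w. exp_basis j (- frac (x i k w + \<epsilon> i k w)))" for i
    unfolding observed_process_def by (rule integral_dirac_sum) (auto simp: frac_lt_1)
  hence "ell w j = complex_of_real (observed_sum (trig (False, j)) w / real n) -
      \<i> * complex_of_real (observed_sum (trig (True, j)) w / real n)"
    by (simp add: ell_hat_def observed_sum_def exp_basis_trig sum_subtractf sum_distrib_left diff_divide_distrib)
  thus ?thesis
    unfolding obs.base_coeff_trig obs.dev_def by (simp add: algebra_simps)
qed

lemma cmod_square_trig: "(cmod (complex_of_real a - \<i> * complex_of_real b))\<^sup>2 = a\<^sup>2 + b\<^sup>2"
  by (simp add: cmod_def)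

lemma cmod_lam_0: "cmod (lam_coeff 0) = obs.mass"
proof -
  have "lam_coeff 0 = obs.base_coeff 0" by (simp add: obs_base_coeff f_coeff_0)
  thus ?thesis by (simp add: obs.base_coeff_def)
qed

lemma mass_le: "obs.mass \<le> sqrt r"
proof -
  have "(cmod (lam_coeff 0))\<^sup>2 \<le> r" using sum_lam_le[of "{0}"] by (simp add: \<gamma>_0)
  hence "sqrt ((cmod (lam_coeff 0))\<^sup>2) \<le> sqrt r" by (rule real_sqrt_le_mono)
  thus ?thesis by (simp add: cmod_lam_0)
qed

text \<open>The coefficients of the observed intensity are products, and both factors are square
  summable with bounds depending on the classes only: \<gamma> \<ge> 1 for the intensity,
  summability of \<alpha> for the density. This gives uniform row sums for the deviation
  inequality.\<close>

lemma sum_base_coeff_le: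
  assumes "finite F"
  shows "(\<Sum>j\<in>F. cmod (obs.base_coeff j)) \<le> sqrt (r * (d * A))"
proof -
  have "(\<Sum>j\<in>F. cmod (obs.base_coeff j))\<^sup>2 = (\<Sum>j\<in>F. cmod (lam_coeff j) * cmod (f_coeff j))\<^sup>2"
    by (simp add: obs_base_coeff norm_mult)
  also have "\<dots> \<le> (\<Sum>j\<in>F. (cmod (lam_coeff j))\<^sup>2) * (\<Sum>j\<in>F. (cmod (f_coeff j))\<^sup>2)"
    by (rule Cauchy_Schwarz_ineq_sum)
  also have "\<dots> \<le> r * (d * A)"
  proof (rule mult_mono)
    have "(\<Sum>j\<in>F. 1 * (cmod (lam_coeff j))\<^sup>2) \<le> (\<Sum>j\<in>F. \<gamma> j * (cmod (lam_coeff j))\<^sup>2)"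
      using \<gamma>_ge_1 by (intro sum_mono mult_right_mono) auto
    thus "(\<Sum>j\<in>F. (cmod (lam_coeff j))\<^sup>2) \<le> r" using sum_lam_le[OF assms] by simp
    have "(\<Sum>j\<in>F. (cmod (f_coeff j))\<^sup>2) \<le> (\<Sum>j\<in>F. d * \<alpha> j)"
      by (intro sum_mono f_coeff_bounds)
    also have "\<dots> = d * sum \<alpha> F" by (simp add: sum_distrib_left)
    also have "\<dots> \<le> d * A" using d_ge_1 by (intro mult_left_mono sum_\<alpha>_le assms) auto
    finally show "(\<Sum>j\<in>F. (cmod (f_coeff j))\<^sup>2) \<le> d * A" .
  qed (use r_pos in \<open>auto intro!: sum_nonneg\<close>)
  finally show ?thesis by (rule real_le_rsqrt)
qed

end

text \<open>Where the cutoff is passed, 1 / |b|^2 \<le> M, which gives the first bound. For the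
  second, |a|^2 \<le> 2 |b|^2 + 2 |b - a|^2 replaces the random denominator by |a|^2. Where the
  cutoff fails, R = 1 and |b|^2 < 1 / M, so the same inequality shows that the quotient is at least
  1. Together the bounds lead to the minimum in \<open>Phi\<close>.\<close>

lemma ratio_bounds:
  fixes a b :: complex and M :: real
  assumes M: "M > 0" and a: "a \<noteq> 0"
  defines "R \<equiv> (cmod (a / b * (if (cmod b)\<^sup>2 \<ge> 1 / M then 1 else 0) - 1))\<^sup>2"
  shows "R \<le> 1 + M * (cmod (b - a))\<^sup>2"
    and "R \<le> (2 / M + 2 * (cmod (b - a))\<^sup>2 + 2 * M * ((cmod (b - a))\<^sup>2)\<^sup>2) / (cmod a)\<^sup>2"
proof -
  let ?e = "(cmod (b - a))\<^sup>2"
  have ab: "(cmod a)\<^sup>2 \<le> 2 * (cmod b)\<^sup>2 + 2 * ?e"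
    using cmod_add_square_le[of 1 b "a - b"] by (simp add: norm_minus_commute)
  have a2: "(cmod a)\<^sup>2 > 0" using a by simp
  have "R \<le> 1 + M * ?e \<and> R \<le> (2 / M + 2 * ?e + 2 * M * ?e\<^sup>2) / (cmod a)\<^sup>2"
  proof (cases "(cmod b)\<^sup>2 \<ge> 1 / M")
    case True
    have b2: "(cmod b)\<^sup>2 > 0" using True M by (smt (verit) divide_pos_pos)
    hence b0: "b \<noteq> 0" by auto
    have "a / b - 1 = (a - b) / b" using b0 by (simp add: diff_divide_distrib)
    hence R: "R = ?e / (cmod b)\<^sup>2"
      using True unfolding R_def by (simp add: norm_divide power_divide norm_minus_commute)
    have inv: "1 / (cmod b)\<^sup>2 \<le> M" using True M b2 by (simp add: field_simps)
    have "R \<le> M * ?e" unfolding R using mult_right_mono[OF inv, of ?e] by simp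
    moreover have "R \<le> (2 * ?e + 2 * M * ?e\<^sup>2) / (cmod a)\<^sup>2"
    proof -
      have "(cmod a)\<^sup>2 / (cmod b)\<^sup>2 \<le> (2 * (cmod b)\<^sup>2 + 2 * ?e) / (cmod b)\<^sup>2"
        using ab by (intro divide_right_mono) auto
      also have "\<dots> = 2 + 2 * ?e * (1 / (cmod b)\<^sup>2)" using b2 by (simp add: add_divide_distrib)
      also have "\<dots> \<le> 2 + 2 * ?e * M" using inv by (intro add_left_mono mult_left_mono) auto
      finally have "?e * ((cmod a)\<^sup>2 / (cmod b)\<^sup>2) \<le> ?e * (2 + 2 * ?e * M)" by (intro mult_left_mono) auto
      hence "R * (cmod a)\<^sup>2 \<le> 2 * ?e + 2 * M * ?e\<^sup>2" unfolding R by (simp add: algebra_simps power2_eq_square)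
      thus ?thesis using a2 by (simp add: pos_le_divide_eq)
    qed
    moreover have "(2 * ?e + 2 * M * ?e\<^sup>2) / (cmod a)\<^sup>2 \<le> (2 / M + 2 * ?e + 2 * M * ?e\<^sup>2) / (cmod a)\<^sup>2"
      using M by (intro divide_right_mono) auto
    ultimately show ?thesis by linarith
  next
    case False
    hence R: "R = 1" by (simp add: R_def)
    have "(cmod a)\<^sup>2 \<le> 2 / M + 2 * ?e" using ab False by simp
    also have "\<dots> \<le> 2 / M + 2 * ?e + 2 * M * ?e\<^sup>2" using M by simp
    finally have "1 \<le> (2 / M + 2 * ?e + 2 * M * ?e\<^sup>2) / (cmod a)\<^sup>2" using a2 by (simp add: pos_le_divide_eq)
    thus ?thesis using R M by simp
  qed
  thus "R \<le> 1 + M * ?e" "R \<le> (2 / M + 2 * ?e + 2 * M * ?e\<^sup>2) / (cmod a)\<^sup>2" by auto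
qed

section \<open>Relative errors of the inverted coefficients and exceptional events\<close>

context adaptive_deconvolution
begin

lemma samp_dev2_eq: "samp.dev2 j w = (cmod (fhat w j - f_coeff j))\<^sup>2"
  unfolding f_hat_minus cmod_square_trig samp.dev2_def ..

lemma obs_dev2_eq:
  "w \<in> space M \<Longrightarrow> obs.dev2 j w = (cmod (ell w j - obs.base_coeff j))\<^sup>2"
  by (simp add: ell_hat_minus cmod_square_trig obs.dev2_def)

text \<open>Not the relative error itself but its majorant, a function of \<open>samp.dev2\<close>
  alone, whose mean follows from the second and fourth moments of the deviations.\<close>

definition ratio_error :: "int \<Rightarrow> 'w \<Rightarrow> real" where
  "ratio_error j w = min (1 + real m * samp.dev2 j w)
    (d / \<alpha> j * (2 / real m + 2 * samp.dev2 j w + 2 * real m * (samp.dev2 j w)\<^sup>2))"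

lemma ratio_error_ge:
  "(cmod (f_coeff j / fhat w j * (if (cmod (fhat w j))\<^sup>2 \<ge> 1 / real m then 1 else 0) - 1))\<^sup>2
    \<le> ratio_error j w" (is "?R \<le> _")
proof -
  have m: "real m > 0" using m_ge_1 by simp
  let ?N = "2 / real m + 2 * samp.dev2 j w + 2 * real m * (samp.dev2 j w)\<^sup>2"
  have f0: "f_coeff j \<noteq> 0" using f_coeff_pos[of j] by auto
  have "1 / (cmod (f_coeff j))\<^sup>2 \<le> d / \<alpha> j"
    using f_coeff_bounds(1)[of j] f_coeff_pos[of j] \<alpha>_pos[of j] d_ge_1 by (simp add: field_simps)
  hence "1 / (cmod (f_coeff j))\<^sup>2 * ?N \<le> d / \<alpha> j * ?N"
    using m by (intro mult_right_mono) auto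
  moreover have "?R \<le> 1 / (cmod (f_coeff j))\<^sup>2 * ?N"
    using ratio_bounds(2)[OF m f0, of "fhat w j"] by (simp add: samp_dev2_eq)
  moreover have "?R \<le> 1 + real m * samp.dev2 j w"
    using ratio_bounds(1)[OF m f0, of "fhat w j"] by (simp add: samp_dev2_eq)
  ultimately show ?thesis unfolding ratio_error_def by linarith
qed

lemma ratio_error_nonneg: "0 \<le> ratio_error j w"
  using ratio_error_ge[of j w] by (rule order.trans[rotated]) simp

lemma mean_ratio_error:
  "mean_le (ratio_error j) ((2 + 400 * exp 2) * d * min 1 (1 / (real m * \<alpha> j)))"
proof -
  have m: "real m > 0" using m_ge_1 by simp
  have [measurable]: "ratio_error j \<in> borel_measurable M" unfolding ratio_error_def[abs_def] by measurable
  let ?e = "8 * exp 2 / real m" and ?e2 = "192 * exp 2 / (real m)\<^sup>2"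
  have e: "mean_le (samp.dev2 j) ?e" "mean_le (\<lambda>w. (samp.dev2 j w)\<^sup>2) ?e2"
    using samp.mean_dev2[of j] samp.mean_dev2_square[of j]
    by (simp_all add: samp_mass[unfolded space_intensity_measure])
  have "mean_le (\<lambda>w. 1 + real m * samp.dev2 j w) (1 + real m * ?e)"
    using m by (intro mean_le_add mean_le_cmult mean_le_const e) auto
  hence "mean_le (ratio_error j) (1 + real m * ?e)"
    by (rule mean_le_mono) (auto simp: ratio_error_nonneg, simp add: ratio_error_def)
  moreover have "1 + real m * ?e \<le> (2 + 400 * exp 2) * d"
  proof -
    have "1 + real m * ?e \<le> 2 + 400 * exp 2" using m by (simp add: add_mono)
    also have "\<dots> \<le> (2 + 400 * exp 2) * d"
      using mult_left_mono[OF d_ge_1, of "2 + 400 * exp 2"] by (simp add: add_nonneg_nonneg)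
    finally show ?thesis .
  qed
  ultimately have 1: "mean_le (ratio_error j) ((2 + 400 * exp 2) * d)" by (rule mean_le_trans)
  have "mean_le (\<lambda>w. d / \<alpha> j * (2 / real m + 2 * samp.dev2 j w + 2 * real m * (samp.dev2 j w)\<^sup>2))
      (d / \<alpha> j * (2 / real m + 2 * ?e + 2 * real m * ?e2))"
    using m d_ge_1 \<alpha>_pos[of j] by (intro mean_le_cmult[OF mean_le_add] mean_le_add mean_le_cmult mean_le_const e) auto
  hence "mean_le (ratio_error j) (d / \<alpha> j * (2 / real m + 2 * ?e + 2 * real m * ?e2))"
    by (rule mean_le_mono) (auto simp: ratio_error_nonneg, simp add: ratio_error_def)
  \<comment> \<open>Here 400 = 2 * 8 + 2 * 192.\<close>
  moreover have "2 / real m + 2 * ?e + 2 * real m * ?e2 = (2 + 400 * exp 2) / real m"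
    using m by (simp add: power2_eq_square add_divide_distrib)
  ultimately have 2: "mean_le (ratio_error j) ((2 + 400 * exp 2) * d * (1 / (real m * \<alpha> j)))"
    by (simp add: mult_ac)
  show ?thesis using 1 2 by (simp add: min_def)
qed

definition bias_noise :: "nat \<Rightarrow> 'w \<Rightarrow> real" where
  "bias_noise K w = (\<Sum>j\<in>band K. \<omega> j * (cmod (lam_coeff j))\<^sup>2 * ratio_error j w)"

text \<open>Writing \<omega> as \<gamma> times \<omega> / \<gamma> separates the ellipsoid
  constraint, which sums to r, from a factor that \<open>Phi_ge\<close> bounds uniformly in
  j.\<close>

lemma mean_bias_noise:
  "mean_le (bias_noise K) ((2 + 400 * exp 2) * d * r * (Phi \<omega> \<gamma> \<alpha> m + 1 / real m))"
proof -
  let ?c = "(2 + 400 * exp 2) * d" and ?J = "band K" and ?P = "Phi \<omega> \<gamma> \<alpha> m + 1 / real m"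
  have "mean_le (bias_noise K) (\<Sum>j\<in>?J. \<omega> j * (cmod (lam_coeff j))\<^sup>2 * (?c * min 1 (1 / (real m * \<alpha> j))))"
    unfolding bias_noise_def[abs_def]
    using \<omega>_pos by (intro mean_le_sum mean_le_cmult mean_ratio_error) (auto simp: less_imp_le)
  moreover have "(\<Sum>j\<in>?J. \<omega> j * (cmod (lam_coeff j))\<^sup>2 * (?c * min 1 (1 / (real m * \<alpha> j)))) \<le> ?c * r * ?P"
  proof -
    have c0: "?c \<ge> 0" using d_ge_1 by (simp add: add_nonneg_nonneg)
    have "(\<Sum>j\<in>?J. \<omega> j * (cmod (lam_coeff j))\<^sup>2 * (?c * min 1 (1 / (real m * \<alpha> j)))) =
        (\<Sum>j\<in>?J. ?c * (\<gamma> j * (cmod (lam_coeff j))\<^sup>2) * (\<omega> j / \<gamma> j * min 1 (1 / (real m * \<alpha> j))))"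
      using \<gamma>_pos by (intro sum.cong refl) (simp add: less_imp_neq[THEN not_sym])
    also have "\<dots> \<le> (\<Sum>j\<in>?J. ?c * (\<gamma> j * (cmod (lam_coeff j))\<^sup>2) * ?P)"
      using c0 \<gamma>_pos by (intro sum_mono mult_left_mono Phi_ge mult_nonneg_nonneg[OF c0] mult_nonneg_nonneg) (auto simp: less_imp_le)
    also have "\<dots> = ?c * (\<Sum>j\<in>?J. \<gamma> j * (cmod (lam_coeff j))\<^sup>2) * ?P"
      by (simp add: sum_distrib_left sum_distrib_right)
    also have "\<dots> \<le> ?c * r * ?P"
      using c0 Phi_nonneg[of m] by (intro mult_right_mono mult_left_mono sum_lam_le) auto
    finally show ?thesis .
  qed
  ultimately show ?thesis by (rule mean_le_trans)
qed

text \<open>The constant 32 makes \<open>\<bar>f_hat j - f j\<bar> \<le> \<bar>f j\<bar> / 4\<close> off this event; \<open>f_hat 0 = f 0 = 1\<close> always.\<close>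

definition bad_sample :: "nat \<Rightarrow> 'w set" where
  "bad_sample K = (\<Union>p\<in>{p \<in> freqs K. snd p \<noteq> 0}.
     {w \<in> space M. cmod (f_coeff (snd p)) / sqrt 32 \<le> \<bar>samp.dev (trig p) w\<bar>})"

lemma bad_sample_sets [measurable]: "bad_sample K \<in> sets M"
  unfolding bad_sample_def by (intro sets.finite_UN) auto

lemma samp_dev2_le:
  assumes w: "w \<in> space M" "w \<notin> bad_sample K" and j: "\<bar>j\<bar> \<le> int K"
  shows "samp.dev2 j w \<le> (cmod (f_coeff j))\<^sup>2 / 16"
proof (cases "j = 0")
  case True
  have "fhat w 0 = 1" using m_ge_1 by (simp add: f_hat_def)
  thus ?thesis by (simp add: True samp_dev2_eq f_coeff_0)
next
  case False
  have "(samp.dev (trig (b, j)) w)\<^sup>2 \<le> (cmod (f_coeff j) / sqrt 32)\<^sup>2" for b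
  proof -
    have "(b, j) \<in> {p \<in> freqs K. snd p \<noteq> 0}" using j False by (auto simp: freqs_def)
    hence "\<not> cmod (f_coeff j) / sqrt 32 \<le> \<bar>samp.dev (trig (b, j)) w\<bar>"
      using w unfolding bad_sample_def by force
    thus ?thesis by (subst abs_le_square_iff[symmetric]) auto
  qed
  from add_mono[OF this this, of False True] show ?thesis
    by (simp add: samp.dev2_def power_divide)
qed

text \<open>The frequencies j \<noteq> 0 up to K give 4 K events, each of probability at most 2 (m +
  1)^(-5) by the choice of 640 in \<open>M_alpha\<close>. As K \<le> m, the total is at most 8 (m +
  1)^(-4); it is stated as a square for the later use of Cauchy-Schwarz.\<close>

lemma emeasure_bad_sample:
  assumes K: "K \<le> M_alpha \<alpha> d m"
  shows "emeasure M (bad_sample K) \<le> ennreal ((3 / (real m)\<^sup>2)\<^sup>2)"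
proof -
  have m: "real m > 0" using m_ge_1 by simp
  let ?P = "{p \<in> freqs K. snd p \<noteq> 0}"
  let ?b = "\<lambda>p. {w \<in> space M. cmod (f_coeff (snd p)) / sqrt 32 \<le> \<bar>samp.dev (trig p) w\<bar>}"
  have one: "emeasure M (?b p) \<le> ennreal (2 / (real m + 1) ^ 5)" if p: "p \<in> ?P" for p
  proof -
    obtain j where j: "snd p = j" "\<bar>j\<bar> \<le> int K" "j \<noteq> 0" using p by (auto simp: freqs_def)
    have "cmod (f_coeff j) \<le> 1"
      using samp.cmod_base_coeff_le[of j] by (simp add: samp_base_coeff samp_mass[unfolded space_intensity_measure])
    also have "1 \<le> sqrt (32::real)" by simp
    finally have "cmod (f_coeff j) / sqrt 32 \<le> 1" by (simp add: divide_le_eq)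
    hence "emeasure M (?b p) \<le> ennreal (2 * exp (- real m * (cmod (f_coeff j) / sqrt 32)\<^sup>2 / 4))"
      unfolding j(1) using samp_mass by (intro samp.emeasure_dev_ge) (auto simp: abs_trig_le)
    also have "\<dots> \<le> ennreal (2 / (real m + 1) ^ 5)"
    proof (rule ennreal_leI)
      have "640 * d * (1 / real m) * ln (real m + 1) \<le> \<alpha> (int (nat \<bar>j\<bar>))"
        using j K by (intro M_alphaD) auto
      hence "d * (640 * (1 / real m) * ln (real m + 1)) \<le> d * (cmod (f_coeff j))\<^sup>2"
        using f_coeff_bounds(1)[of j] \<alpha>_nat[of j] d_ge_1 by (simp add: field_simps)
      hence "640 * (1 / real m) * ln (real m + 1) \<le> (cmod (f_coeff j))\<^sup>2"
        using d_ge_1 by (subst (asm) mult_le_cancel_left_pos) auto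
      hence "exp (- real m * (cmod (f_coeff j) / sqrt 32)\<^sup>2 / 4) \<le> exp (- (5 * ln (real m + 1)))"
        using m by (simp add: power_divide field_simps)
      also have "\<dots> = 1 / (real m + 1) ^ 5"
        using m exp_of_nat_mult[of 5 "ln (real m + 1)"] by (simp add: exp_minus inverse_eq_divide)
      finally show "2 * exp (- real m * (cmod (f_coeff j) / sqrt 32)\<^sup>2 / 4) \<le> 2 / (real m + 1) ^ 5" by simp
    qed
    finally show ?thesis .
  qed
  have "emeasure M (bad_sample K) \<le> (\<Sum>p\<in>?P. emeasure M (?b p))"
    unfolding bad_sample_def by (rule emeasure_subadditive_finite) auto
  also have "\<dots> \<le> (\<Sum>p\<in>?P. ennreal (2 / (real m + 1) ^ 5))" by (intro sum_mono one)
  also have "\<dots> = ennreal (real (card ?P) * (2 / (real m + 1) ^ 5))"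
    by (subst sum_ennreal) simp_all
  also have "\<dots> \<le> ennreal ((3 / (real m)\<^sup>2)\<^sup>2)"
  proof (rule ennreal_leI)
    have "?P = UNIV \<times> (band K - {0})" by (auto simp: freqs_def)
    hence "card ?P = 4 * K" by (simp add: card_cartesian_product card_Diff_subset)
    moreover have "K \<le> m" using K M_alpha_le by blast
    ultimately have "real (card ?P) * (2 / (real m + 1) ^ 5) \<le> (4 * (real m + 1)) * (2 / (real m + 1) ^ 5)"
      by (intro mult_right_mono) auto
    also have "\<dots> = 8 / (real m + 1) ^ 4"
    proof -
      have "4 * z * (2 / z ^ 5) = 8 / z ^ 4" if "z > 0" for z :: real
        using that by (simp add: eval_nat_numeral)
      from this[of "real m + 1"] m show ?thesis by simp
    qed
    also have "\<dots> \<le> 9 / (real m) ^ 4" using m by (intro frac_le power_mono) auto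
    also have "\<dots> = (3 / (real m)\<^sup>2)\<^sup>2" by (simp add: power_divide flip: power_mult)
    finally show "real (card ?P) * (2 / (real m + 1) ^ 5) \<le> (3 / (real m)\<^sup>2)\<^sup>2" .
  qed
  finally show ?thesis .
qed

text \<open>As \<open>trig (False, 0)\<close> is constantly 1, this is the event that the mean
  number of observed points misses its expectation by more than 1. Off it, the random factor of the
  penalty is comparable with the true mass.\<close>

definition bad_count :: "'w set" where
  "bad_count = {w \<in> space M. 1 < \<bar>obs.dev (trig (False, 0)) w\<bar>}"

lemma bad_count_sets [measurable]: "bad_count \<in> sets M"
  unfolding bad_count_def by measurable

lemma emeasure_bad_count: "emeasure M bad_count \<le> ennreal ((7 * exp obs.mass / real n)\<^sup>2)"
proof -
  have "emeasure M bad_count = (\<integral>\<^sup>+w. indicator bad_count w \<partial>M)" by simp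
  also have "\<dots> \<le> (\<integral>\<^sup>+w. ennreal ((obs.dev (trig (False, 0)) w) ^ 4) \<partial>M)"
  proof (rule nn_integral_mono)
    fix w
    have "1 \<le> (obs.dev (trig (False, 0)) w) ^ 4" if "w \<in> bad_count"
      using that one_le_power[of "\<bar>obs.dev (trig (False, 0)) w\<bar>" 4] by (simp add: bad_count_def)
    thus "indicator bad_count w \<le> ennreal ((obs.dev (trig (False, 0)) w) ^ 4)"
      by (auto simp: indicator_def)
  qed
  also have "\<dots> \<le> ennreal (48 * exp (2 * obs.mass) / (real n)\<^sup>2)"
    using obs.mean_dev_power4 by (simp add: mean_le_def)
  also have "\<dots> \<le> ennreal ((7 * exp obs.mass / real n)\<^sup>2)"
    unfolding exp_double by (intro ennreal_leI) (simp add: power_mult_distrib power_divide divide_right_mono)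
  finally show ?thesis .
qed

end

section \<open>The risk bound\<close>

context weight_sequences
begin

definition L1 :: real where "L1 = max 1 (sqrt r)"

definition B1 :: real where "B1 = max 1 (sqrt (r * (d * A)))"

text \<open>The rate in the exponential bound: the three constraints are those of the deviation
  inequality with row sums \<open>B1\<close>, mass \<open>L1\<close> and dimension constant
  \<open>A\<close>, uniform over both classes.\<close>

definition \<eta> :: real where
  "\<eta> = min (1 / (100 * B1\<^sup>2)) (min (1 / (6 * L1)) (1 / (600 * A)))"

text \<open>From this dimension on, the linear exponent dominates the logarithm that has to be
  compensated. The finitely many smaller models, including k = 0, to which \<open>N_alpha\<close>
  gives no information, are treated by their mean noise alone.\<close>

definition cutoff :: nat where
  "cutoff = (SOME k0. k0 \<ge> 1 \<and> (\<forall>k\<ge>k0. 16 * ln (real k + 3) \<le> \<eta> * real (2 * k + 1)))"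

text \<open>The factor (k + 3)^2 lets the small models obey the same summable bound, proportional to
  1 / (k + 3)^2, as all others.\<close>

definition small_models :: real where
  "small_models = (\<Sum>k<cutoff. real (2 * k + 1) * \<Delta> k * (real k + 3)\<^sup>2)"

definition tail_const :: real where
  "tail_const = 8 * exp (2 * L1) * small_models + 56 * exp L1"

lemma L1_ge_1: "L1 \<ge> 1" and B1_ge_1: "B1 \<ge> 1"
  by (simp_all add: L1_def B1_def)

lemma \<eta>: "\<eta> > 0" "\<eta> \<le> 1 / (100 * B1\<^sup>2)" "\<eta> \<le> 1 / (6 * L1)" "\<eta> \<le> 1 / (600 * A)"
proof -
  have "B1 > 0" "L1 > 0" "A > 0" using B1_ge_1 L1_ge_1 A_ge_1 by linarith+
  thus "\<eta> > 0" by (simp add: \<eta>_def)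
qed (auto simp: \<eta>_def)

lemma cutoff: "cutoff \<ge> 1" "k \<ge> cutoff \<Longrightarrow> 16 * ln (real k + 3) \<le> \<eta> * real (2 * k + 1)"
proof -
  have "\<forall>\<^sub>F n in sequentially. ln (real n) / real n < \<eta> / 16"
    using lim_ln_over_n \<eta>(1) by (intro order_tendstoD(2)) auto
  then obtain N where N: "ln (real n) / real n < \<eta> / 16" if "n \<ge> N" for n
    by (auto simp: eventually_sequentially)
  have "16 * ln (real k + 3) \<le> \<eta> * real (2 * k + 1)" if "k \<ge> max N 2" for k
  proof -
    have "ln (real (k + 3)) / real (k + 3) < \<eta> / 16" using that by (intro N) auto
    hence "16 * ln (real k + 3) \<le> \<eta> * (real k + 3)" by (simp add: field_simps)
    also have "\<dots> \<le> \<eta> * real (2 * k + 1)" using that \<eta>(1) by (intro mult_left_mono) auto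
    finally show ?thesis .
  qed
  hence "\<exists>k0. k0 \<ge> 1 \<and> (\<forall>k\<ge>k0. 16 * ln (real k + 3) \<le> \<eta> * real (2 * k + 1))"
    by (intro exI[of _ "max N 2"]) auto
  from someI_ex[OF this] show "cutoff \<ge> 1" "k \<ge> cutoff \<Longrightarrow> 16 * ln (real k + 3) \<le> \<eta> * real (2 * k + 1)"
    unfolding cutoff_def by auto
qed

lemma small_models_nonneg: "small_models \<ge> 0"
  unfolding small_models_def by (intro sum_nonneg mult_nonneg_nonneg \<Delta>_nonneg) auto

lemma small_models_ge: "k < cutoff \<Longrightarrow> real (2 * k + 1) * \<Delta> k * (real k + 3)\<^sup>2 \<le> small_models"
  unfolding small_models_def
  by (rule member_le_sum) (auto intro!: mult_nonneg_nonneg \<Delta>_nonneg)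

text \<open>This is what the logarithmic factor of the penalty is for: the exponential has to compensate
  \<open>\<Delta> k\<close> even if the latter grows faster than any power of \<open>k\<close>.\<close>

lemma exp_logratio_le:
  assumes "k \<ge> cutoff"
  shows "real (2 * k + 1) * \<Delta> k * exp (- \<eta> / 4 * real (2 * k + 1) * logratio k) \<le> 2 / (real k + 3)\<^sup>2"
proof -
  define X where "X = max (\<Delta> k) (real k + 3)"
  have X: "X > 0" "\<Delta> k \<le> X" "real k + 3 \<le> X" by (auto simp: X_def)
  have l: "ln (real k + 3) > 0" using ln_k3[of k] by linarith
  have "4 * ln X = 4 * ln (real k + 3) * logratio k" using l by (simp add: logratio_def X_def)
  also have "\<dots> \<le> \<eta> / 4 * real (2 * k + 1) * logratio k"
    using cutoff(2)[OF assms] logratio_ge_1[of k] by (intro mult_right_mono) auto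
  finally have "exp (- \<eta> / 4 * real (2 * k + 1) * logratio k) \<le> exp (- (4 * ln X))" by simp
  also have "\<dots> = 1 / X ^ 4" using X(1) exp_of_nat_mult[of 4 "ln X"] by (simp add: exp_minus inverse_eq_divide)
  finally have "real (2 * k + 1) * \<Delta> k * exp (- \<eta> / 4 * real (2 * k + 1) * logratio k) \<le> (2 * X) * X * (1 / X ^ 4)"
    using X \<Delta>_ge_1[of k] by (intro mult_mono) auto
  also have "\<dots> = 2 / X\<^sup>2" using X(1) by (simp add: eval_nat_numeral)
  also have "\<dots> \<le> 2 / (real k + 3)\<^sup>2" using X by (intro divide_left_mono power_mono) auto
  finally show ?thesis .
qed

end

lemma sum_inverse_square_le: "(\<Sum>k\<le>K::nat. 1 / (real k + 3)\<^sup>2) \<le> 1 - 1 / (real K + 3)"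
proof (induction K)
  case (Suc K)
  have "1 / (z + 1)\<^sup>2 \<le> 1 / z - 1 / (z + 1)" if "z > 0" for z :: real
  proof -
    have "1 / (z + 1)\<^sup>2 \<le> 1 / (z * (z + 1))"
      using that by (intro divide_left_mono) (auto simp: power2_eq_square)
    also have "\<dots> = 1 / z - 1 / (z + 1)" using that by (simp add: field_simps)
    finally show ?thesis .
  qed
  from this[of "real K + 3"] show ?case using Suc.IH by (simp add: add_ac)
qed simp

section \<open>Tails of the noise, and the loss on good and bad samples\<close>

context adaptive_deconvolution
begin

text \<open>The threshold scales with the true mass, which the random penalty estimates, and not
  with the bound \<open>L1\<close> of the class; the penalty could not dominate the latter.\<close>

definition L :: real where "L = max 1 obs.mass"

lemma L: "1 \<le> L" "obs.mass \<le> L" "L \<le> L1" "obs.mass \<le> L1"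
  using mass_le by (auto simp: L_def L1_def)

text \<open>The factor 5 has to exceed 2 for the deviation inequality, and \<open>32 / 9 * 5 \<le> 165 / 8\<close> makes the
  noise below the threshold smaller than half of the penalty.\<close>

definition big_noise :: "nat \<Rightarrow> 'w set" where
  "big_noise k = {w \<in> space M. 5 * L * real (2 * k + 1) * logratio k / real n \<le> obs.noise k w}"

lemma big_noise_sets [measurable]: "big_noise k \<in> sets M"
  unfolding big_noise_def by measurable

abbreviation tail :: "nat \<Rightarrow> 'w \<Rightarrow> real" where
  "tail k w \<equiv> \<Delta> k * (obs.noise k w * indicator (big_noise k) w)"

lemma emeasure_big_noise:
  assumes "1 \<le> k" "k \<le> N_alpha \<omega> \<alpha> n"
  shows "emeasure M (big_noise k) \<le> ennreal (2 * exp (- \<eta> / 2 * real (2 * k + 1) * logratio k))"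
  unfolding big_noise_def
proof (rule obs.emeasure_noise_ge[where B = B1 and V = A])
  show "(\<Sum>j\<in>F. cmod (obs.base_coeff j)) \<le> B1" if "finite F" for F
    using sum_base_coeff_le[OF that] by (simp add: B1_def)
  have "1 / (6 * L1) \<le> 1 / (6 * L)" using L by (intro divide_left_mono) auto
  thus "\<eta> \<le> 1 / (6 * L)" using \<eta>(3) by linarith
  show "(real (2 * k + 1))\<^sup>2 * logratio k \<le> A * real n"
    by (rule dimension_bound[OF assms n_ge_1])
qed (use \<eta> L B1_ge_1 A_ge_1 logratio_ge_1 in auto)

text \<open>Below \<open>cutoff\<close> the tail is bounded by the full noise; from
  \<open>cutoff\<close> on, Cauchy-Schwarz combines the fourth moments with the small probability of
  \<open>big_noise k\<close>. The weight 1 / (k + 3)^2 makes the sum over all models finite.\<close>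

lemma mean_tail:
  assumes k: "k \<le> N_alpha \<omega> \<alpha> n"
  shows "mean_le (tail k) (tail_const / real n * (1 / (real k + 3)\<^sup>2))"
proof -
  have n: "real n > 0" using n_ge_1 by simp
  have k3: "(real k + 3)\<^sup>2 > 0" by simp
  have "\<exists>c. mean_le (tail k) (c / real n) \<and> c * (real k + 3)\<^sup>2 \<le> tail_const"
  proof (cases "k < cutoff")
    case True
    let ?c = "8 * exp (2 * obs.mass) * (real (2 * k + 1) * \<Delta> k)"
    have "mean_le (\<lambda>w. \<Delta> k * obs.noise k w) (\<Delta> k * (8 * real (2 * k + 1) * exp (2 * obs.mass) / real n))"
      by (intro mean_le_cmult obs.mean_noise \<Delta>_nonneg)
    hence "mean_le (\<lambda>w. \<Delta> k * obs.noise k w) (?c / real n)"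
      by (rule mean_le_trans) (simp add: algebra_simps)
    hence "mean_le (tail k) (?c / real n)"
      by (rule mean_le_mono) (use \<Delta>_nonneg in \<open>auto simp: indicator_def\<close>)
    moreover have "?c * (real k + 3)\<^sup>2 \<le> tail_const"
    proof -
      have "?c * (real k + 3)\<^sup>2 \<le> 8 * exp (2 * L1) * small_models"
        unfolding mult.assoc[of "8 * exp (2 * obs.mass)"]
        using small_models_ge[OF True] L \<Delta>_nonneg by (intro mult_mono) auto
      thus ?thesis unfolding tail_const_def by (rule order.trans) simp
    qed
    ultimately show ?thesis by blast
  next
    case False
    \<comment> \<open>Half of the exponent in the probability of \<open>big_noise k\<close>, since
      Cauchy-Schwarz takes the square root.\<close>
    define e where "e = exp (- \<eta> / 4 * real (2 * k + 1) * logratio k)"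
    let ?c = "28 * exp obs.mass * (real (2 * k + 1) * \<Delta> k * e)"
    have "2 * exp (- \<eta> / 2 * real (2 * k + 1) * logratio k) \<le> (2 * e)\<^sup>2"
    proof -
      have "(2 * e)\<^sup>2 = 4 * exp (2 * (- \<eta> / 4 * real (2 * k + 1) * logratio k))"
        unfolding e_def power_mult_distrib exp_double by simp
      also have "2 * (- \<eta> / 4 * real (2 * k + 1) * logratio k) = - \<eta> / 2 * real (2 * k + 1) * logratio k"
        by simp
      finally show ?thesis by simp
    qed
    moreover have "1 \<le> k" using False cutoff(1) by linarith
    ultimately have "emeasure M (big_noise k) \<le> ennreal ((2 * e)\<^sup>2)"
      using emeasure_big_noise[OF _ k] by (auto intro: order.trans ennreal_leI)
    hence "mean_le (tail k) (\<Delta> k * (14 * real (2 * k + 1) * exp obs.mass / real n * (2 * e)))"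
      by (intro mean_le_cmult obs.mean_noise_indicator \<Delta>_nonneg) (auto simp: e_def)
    hence "mean_le (tail k) (?c / real n)" by (rule mean_le_trans) (simp add: algebra_simps)
    moreover have "?c * (real k + 3)\<^sup>2 \<le> tail_const"
    proof -
      have "?c \<le> 28 * exp L1 * (2 / (real k + 3)\<^sup>2)"
        unfolding e_def using L \<Delta>_nonneg False by (intro mult_mono exp_logratio_le) auto
      hence "?c * (real k + 3)\<^sup>2 \<le> 28 * exp L1 * (2 / (real k + 3)\<^sup>2) * (real k + 3)\<^sup>2"
        by (rule mult_right_mono) simp
      also have "\<dots> = 56 * exp L1" using k3 by simp
      also have "\<dots> \<le> tail_const" using small_models_nonneg by (simp add: tail_const_def)
      finally show ?thesis .
    qed
    ultimately show ?thesis by blast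
  qed
  then obtain c where c: "mean_le (tail k) (c / real n)" "c * (real k + 3)\<^sup>2 \<le> tail_const" by blast
  from c(2) k3 have "c \<le> tail_const / (real k + 3)\<^sup>2" by (simp only: pos_le_divide_eq)
  from divide_right_mono[OF this, of "real n"] n c(1) show ?thesis
    by (intro mean_le_trans[OF c(1)]) (simp add: mult.commute)
qed

lemma mean_sum_tail:
  assumes K: "K \<le> N_alpha \<omega> \<alpha> n"
  shows "mean_le (\<lambda>w. \<Sum>k\<le>K. tail k w) (tail_const / real n)"
proof (rule mean_le_trans)
  show "mean_le (\<lambda>w. \<Sum>k\<le>K. tail k w) (\<Sum>k\<le>K. tail_const / real n * (1 / (real k + 3)\<^sup>2))"
    using K by (intro mean_le_sum mean_tail) auto
  have "tail_const / real n \<ge> 0" using small_models_nonneg by (simp add: tail_const_def)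
  moreover have "(\<Sum>k\<le>K. 1 / (real k + 3)\<^sup>2) \<le> 1"
    using sum_inverse_square_le[of K] by (rule order.trans) simp
  ultimately show "(\<Sum>k\<le>K. tail_const / real n * (1 / (real k + 3)\<^sup>2)) \<le> tail_const / real n"
    unfolding sum_distrib_left[symmetric] by (simp only: mult_left_le)
qed

definition loss :: "nat \<Rightarrow> 'w \<Rightarrow> real" where
  "loss k w = (\<Sum>j\<in>band k. \<omega> j * (cmod (est w j - lam_coeff j))\<^sup>2)"

definition inv_f :: "'w \<Rightarrow> int \<Rightarrow> real" where
  "inv_f w j = (if (cmod (fhat w j))\<^sup>2 \<ge> 1 / real m then 1 / (cmod (fhat w j))\<^sup>2 else 0)"

text \<open>With the cutoff indicator in both terms, the error is (ell_hat - ell) / f_hat plus lam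
  (f / f_hat - 1), because ell = lam * f coefficientwise. The two terms are squared separately, and
  no independence between them is involved.\<close>

lemma loss_term_le:
  assumes w: "w \<in> space M"
  shows "(cmod (est w j - lam_coeff j))\<^sup>2 \<le>
    2 * inv_f w j * obs.dev2 j w + 2 * (cmod (lam_coeff j))\<^sup>2 * ratio_error j w"
proof -
  let ?b = "fhat w j" and ?l = "ell w j"
  let ?i = "if (cmod ?b)\<^sup>2 \<ge> 1 / real m then 1 else 0 :: complex"
  let ?p = "(?l - obs.base_coeff j) / ?b * ?i" and ?q = "lam_coeff j * (f_coeff j / ?b * ?i - 1)"
  have "est w j - lam_coeff j = ?p + ?q"
    unfolding estimate_def obs_base_coeff
    by (simp add: diff_divide_distrib left_diff_distrib right_diff_distrib)
  hence "(cmod (est w j - lam_coeff j))\<^sup>2 \<le> 2 * (cmod ?p)\<^sup>2 + 2 * (cmod ?q)\<^sup>2"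
    using cmod_add_square_le[of 1 ?p ?q] by simp
  also have "(cmod ?p)\<^sup>2 = inv_f w j * obs.dev2 j w"
    unfolding obs_dev2_eq[OF w] by (auto simp: inv_f_def norm_mult norm_divide power_divide)
  also have "(cmod ?q)\<^sup>2 = (cmod (lam_coeff j))\<^sup>2 * (cmod (f_coeff j / ?b * ?i - 1))\<^sup>2"
    by (simp add: norm_mult power_mult_distrib del: times_divide_eq_left)
  also have "\<dots> \<le> (cmod (lam_coeff j))\<^sup>2 * ratio_error j w"
    using ratio_error_ge[of j w] by (intro mult_left_mono) auto
  finally show ?thesis by simp
qed

lemma loss_le:
  assumes w: "w \<in> space M" and k: "k \<le> K" and c: "\<And>j. \<bar>j\<bar> \<le> int k \<Longrightarrow> inv_f w j \<le> c j"
  shows "loss k w \<le> 2 * (\<Sum>j\<in>band k. \<omega> j * c j * obs.dev2 j w) + 2 * bias_noise K w"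
proof -
  have "loss k w \<le> (\<Sum>j\<in>band k. 2 * (\<omega> j * c j * obs.dev2 j w) + 2 * (\<omega> j * (cmod (lam_coeff j))\<^sup>2 * ratio_error j w))"
    unfolding loss_def
  proof (rule sum_mono)
    fix j assume "j \<in> band k"
    hence "inv_f w j * obs.dev2 j w \<le> c j * obs.dev2 j w" by (intro mult_right_mono c) auto
    hence "(cmod (est w j - lam_coeff j))\<^sup>2 \<le>
        2 * (c j * obs.dev2 j w) + 2 * ((cmod (lam_coeff j))\<^sup>2 * ratio_error j w)"
      using loss_term_le[OF w, of j] by simp
    from mult_left_mono[OF this, of "\<omega> j"] \<omega>_pos[of j]
    show "\<omega> j * (cmod (est w j - lam_coeff j))\<^sup>2 \<le>
        2 * (\<omega> j * c j * obs.dev2 j w) + 2 * (\<omega> j * (cmod (lam_coeff j))\<^sup>2 * ratio_error j w)"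
      by (simp add: algebra_simps)
  qed
  also have "\<dots> = 2 * (\<Sum>j\<in>band k. \<omega> j * c j * obs.dev2 j w) +
      2 * (\<Sum>j\<in>band k. \<omega> j * (cmod (lam_coeff j))\<^sup>2 * ratio_error j w)"
    by (simp add: sum.distrib sum_distrib_left)
  also have "(\<Sum>j\<in>band k. \<omega> j * (cmod (lam_coeff j))\<^sup>2 * ratio_error j w) \<le> bias_noise K w"
    unfolding bias_noise_def using k \<omega>_pos ratio_error_nonneg
    by (intro sum_mono2) (auto intro!: mult_nonneg_nonneg simp: less_imp_le)
  finally show ?thesis by simp
qed

text \<open>The factor m is the bound on 1 / |f_hat j|^2 that the cutoff guarantees for every
  sample.\<close>

definition bad_loss :: "nat \<Rightarrow> 'w \<Rightarrow> real" where
  "bad_loss K w = real m * (\<Sum>j\<in>band K. \<omega> j * (obs.dev2 j w * indicator (bad_sample K) w))"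

lemma loss_bad:
  assumes w: "w \<in> bad_sample K" and k: "k \<le> K"
  shows "loss k w \<le> 2 * bad_loss K w + 2 * bias_noise K w"
proof -
  have m: "real m > 0" using m_ge_1 by simp
  have sp: "w \<in> space M" using w by (auto simp: bad_sample_def)
  have "inv_f w j \<le> real m" for j
    using m by (auto simp: inv_f_def divide_le_eq) (smt (verit) divide_le_eq mult.commute zero_less_divide_1_iff)+
  hence "loss k w \<le> 2 * (\<Sum>j\<in>band k. \<omega> j * real m * obs.dev2 j w) + 2 * bias_noise K w"
    by (intro loss_le[OF sp k])
  also have "(\<Sum>j\<in>band k. \<omega> j * real m * obs.dev2 j w) \<le> (\<Sum>j\<in>band K. \<omega> j * real m * obs.dev2 j w)"
    using k \<omega>_pos by (intro sum_mono2) (auto intro!: mult_nonneg_nonneg simp: less_imp_le)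
  also have "\<dots> = bad_loss K w"
    using w by (simp add: bad_loss_def sum_distrib_left mult_ac)
  finally show ?thesis by simp
qed

text \<open>Off \<open>bad_sample\<close> the modulus of f_hat is at least 3/4 of that of f, so 1 /
  |f_hat j|^2 \<le> (4/3)^2 d / \<alpha> j; doubling from \<open>loss_le\<close> gives 32/9.\<close>

lemma loss_good:
  assumes w: "w \<in> space M" "w \<notin> bad_sample K" and k: "k \<le> K"
  shows "loss k w \<le> 32 / 9 * d * (\<Delta> k * obs.noise k w) + 2 * bias_noise K w"
proof -
  have "inv_f w j \<le> 16 / 9 * d / \<alpha> j" if j: "\<bar>j\<bar> \<le> int k" for j
  proof -
    let ?b = "fhat w j"
    have pos: "16 / 9 * d / \<alpha> j \<ge> 0" using d_ge_1 \<alpha>_pos[of j] by simp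
    have "samp.dev2 j w \<le> (cmod (f_coeff j))\<^sup>2 / 16"
      using j k by (intro samp_dev2_le[OF w]) simp
    hence "(cmod (?b - f_coeff j))\<^sup>2 \<le> (cmod (f_coeff j) / 4)\<^sup>2"
      by (simp add: samp_dev2_eq power_divide)
    hence "cmod (?b - f_coeff j) \<le> cmod (f_coeff j) / 4" by (rule power2_le_imp_le) simp
    hence "3 / 4 * cmod (f_coeff j) \<le> cmod ?b"
      using norm_triangle_ineq2[of "f_coeff j" "f_coeff j - ?b"] by (simp add: norm_minus_commute)
    hence "(3 / 4 * cmod (f_coeff j))\<^sup>2 \<le> (cmod ?b)\<^sup>2" by (intro power_mono) auto
    hence "9 / 16 * (\<alpha> j / d) \<le> (cmod ?b)\<^sup>2"
      using f_coeff_bounds(1)[of j] by (simp add: power_mult_distrib power_divide)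
    moreover have "9 / 16 * (\<alpha> j / d) > 0" using d_ge_1 \<alpha>_pos[of j] by simp
    ultimately have "1 / (cmod ?b)\<^sup>2 \<le> 1 / (9 / 16 * (\<alpha> j / d))"
      by (rule frac_le[OF zero_le_one order.refl, rotated])
    thus ?thesis using pos by (simp add: inv_f_def)
  qed
  hence "loss k w \<le> 2 * (\<Sum>j\<in>band k. \<omega> j * (16 / 9 * d / \<alpha> j) * obs.dev2 j w) + 2 * bias_noise K w"
    by (intro loss_le[OF w(1) k])
  also have "(\<Sum>j\<in>band k. \<omega> j * (16 / 9 * d / \<alpha> j) * obs.dev2 j w) \<le>
      (\<Sum>j\<in>band k. 16 / 9 * d * (\<Delta> k * obs.dev2 j w))"
  proof (rule sum_mono)
    fix j assume "j \<in> band k"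
    hence "\<omega> j / \<alpha> j * obs.dev2 j w \<le> \<Delta> k * obs.dev2 j w" by (intro mult_right_mono \<Delta>_ge) auto
    from mult_left_mono[OF this, of "16 / 9 * d"] d_ge_1
    show "\<omega> j * (16 / 9 * d / \<alpha> j) * obs.dev2 j w \<le> 16 / 9 * d * (\<Delta> k * obs.dev2 j w)" by (simp add: mult_ac)
  qed
  also have "\<dots> = 16 / 9 * d * (\<Delta> k * obs.noise k w)"
    by (simp add: obs.noise_dev2 sum_distrib_left)
  finally show ?thesis by simp
qed

end

text \<open>The sum of the coefficients in \<open>mean_risk\<close>. It is built from the weight
  sequences, r and d, and thus is the same for all n, m and all members of the classes.\<close>

definition (in weight_sequences) risk_const :: real where
  "risk_const = 165 * d * (1 + L1 + 2 * exp (2 * L1)) + 7 * r + 64 * d * exp (2 * L1) + 504 * A * exp L1 +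
     12 * ((2 + 400 * exp 2) * d * r) + 1568 * d * exp (2 * L1) +
     16 * d * tail_const"

section \<open>The excess over the penalty, and the risk compared with a fixed model\<close>

context adaptive_deconvolution
begin

abbreviation K where "K \<equiv> K_alpha \<omega> \<alpha> d n m"

lemma K_le: "K \<le> N_alpha \<omega> \<alpha> n" "K \<le> M_alpha \<alpha> d m" "K \<le> min n m"
  using N_alpha_le[of K n] M_alpha_le[of K m] by (auto simp: K_alpha_def)

abbreviation count_tail :: "'w \<Rightarrow> real" where
  "count_tail w \<equiv> \<Delta> K * (obs.noise K w * indicator bad_count w)"

abbreviation dev0 :: "'w \<Rightarrow> real" where
  "dev0 \<equiv> obs.dev (trig (False, 0))"

text \<open>The \<open>E\<close> of \<open>model_selection_bound\<close>: \<open>bias_noise\<close>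
  comes from the estimation of f, and each other summand pays for one exceptional event.\<close>

definition excess :: "'w \<Rightarrow> real" where
  "excess w = 2 * bias_noise K w + 2 * bad_loss K w + 4 * d * count_tail w +
     4 * d * (\<Sum>k\<le>K. tail k w)"

abbreviation pen :: "nat \<Rightarrow> 'w \<Rightarrow> real" where
  "pen k w \<equiv> pen_tilde \<omega> \<alpha> d n (N_obs w) k"

lemma bias_noise_nonneg: "0 \<le> bias_noise k w"
  unfolding bias_noise_def using \<omega>_pos ratio_error_nonneg
  by (intro sum_nonneg mult_nonneg_nonneg) (auto simp: less_imp_le)

lemma bad_loss_nonneg: "0 \<le> bad_loss k w"
  unfolding bad_loss_def using \<omega>_pos by (intro mult_nonneg_nonneg sum_nonneg) (auto simp: less_imp_le)

lemma big_sum_ge: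
  "k \<le> K \<Longrightarrow> tail k w \<le>
    (\<Sum>k\<le>K. tail k w)"
  by (intro member_le_sum) (auto intro!: mult_nonneg_nonneg \<Delta>_nonneg)

lemma excess_ge: "2 * bias_noise K w + 2 * bad_loss K w \<le> excess w"
  "2 * bias_noise K w + 4 * d * count_tail w \<le> excess w"
  "2 * bias_noise K w + 4 * d * (\<Sum>k\<le>K. tail k w) \<le> excess w"
  "0 \<le> excess w"
proof -
  have 1: "0 \<le> 4 * d * count_tail w"
    using d_ge_1 by (intro mult_nonneg_nonneg \<Delta>_nonneg) auto
  have 2: "0 \<le> 4 * d * (\<Sum>k\<le>K. tail k w)"
    using d_ge_1 by (intro mult_nonneg_nonneg sum_nonneg \<Delta>_nonneg) auto
  show "2 * bias_noise K w + 2 * bad_loss K w \<le> excess w"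
    "2 * bias_noise K w + 4 * d * count_tail w \<le> excess w"
    "2 * bias_noise K w + 4 * d * (\<Sum>k\<le>K. tail k w) \<le> excess w"
    "0 \<le> excess w"
    using 1 2 bias_noise_nonneg[of K w] bad_loss_nonneg[of K w] unfolding excess_def by linarith+
qed

lemma pen_eq:
  assumes "w \<in> space M"
  shows "pen k w = 165 / 2 * d * max (obs.mass + dev0 w) 1 * (\<delta> k / real n)"
proof -
  have "obs.base_coeff 0 = complex_of_real obs.mass" by (simp add: obs.base_coeff_def scaleR_conv_of_real)
  hence "Re (ell w 0) = obs.mass + dev0 w"
    using arg_cong[OF ell_hat_minus[OF assms, of 0], of Re] by simp
  thus ?thesis by (simp add: pen_tilde_def)
qed

lemma delta_n_pos: "\<delta> k / real n > 0"
  using delta_pos[of k] n_ge_1 by simp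

lemma pen_nonneg: "0 \<le> pen k w"
  unfolding pen_tilde_def using d_ge_1 delta_n_pos[of k] by (intro mult_nonneg_nonneg) (auto simp: less_imp_le)

lemma pen_le:
  assumes "w \<in> space M"
  shows "pen k w \<le> 165 / 2 * d * (\<delta> k / real n) * (1 + L1 + \<bar>dev0 w\<bar>)"
proof -
  have "max (obs.mass + dev0 w) 1 \<le> 1 + L1 + \<bar>dev0 w\<bar>"
    using L L1_ge_1 by auto
  hence "165 / 2 * d * max (obs.mass + dev0 w) 1 * (\<delta> k / real n) \<le>
      165 / 2 * d * (1 + L1 + \<bar>dev0 w\<bar>) * (\<delta> k / real n)"
    using d_ge_1 delta_n_pos[of k] by (intro mult_right_mono mult_left_mono) auto
  thus ?thesis unfolding pen_eq[OF assms] by (simp add: mult_ac)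
qed

text \<open>A bad sample, a bad count and a big noise in model k are each covered by a summand of
  \<open>excess\<close>. In the remaining case the noise is below its threshold, and the threshold
  is below half of the random penalty.\<close>

lemma loss_le_excess:
  assumes w: "w \<in> space M" and k: "k \<le> K"
  shows "loss k w \<le> excess w + pen k w / 2"
proof (cases "w \<in> bad_sample K")
  case True
  from loss_bad[OF True k] excess_ge(1)[of w] pen_nonneg[where k = k and w = w] show ?thesis by simp
next
  case False
  note good = loss_good[OF w False k]
  have dn: "0 \<le> d * (\<Delta> k * obs.noise k w)"
    using d_ge_1 by (intro mult_nonneg_nonneg \<Delta>_nonneg) auto
  hence d4: "32 / 9 * d * (\<Delta> k * obs.noise k w) \<le> 4 * d * (\<Delta> k * obs.noise k w)" by simp
  show ?thesis
  proof (cases "w \<in> bad_count")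
    case True
    \<comment> \<open>The event \<open>bad_count\<close> does not depend on k, so the largest model
      serves for all of them and no sum over k arises.\<close>
    have "\<Delta> k * obs.noise k w \<le> \<Delta> K * obs.noise K w"
    proof (rule mult_mono[OF \<Delta>_mono[OF k]])
      show "obs.noise k w \<le> obs.noise K w"
        unfolding obs.noise_dev2 using k by (intro sum_mono2) auto
    qed (auto simp: \<Delta>_nonneg)
    hence "4 * d * (\<Delta> k * obs.noise k w) \<le> 4 * d * (\<Delta> K * obs.noise K w)"
      using d_ge_1 by (intro mult_left_mono) auto
    thus ?thesis using good d4 excess_ge(2)[of w] pen_nonneg[where k = k and w = w] True by simp
  next
    case count: False
    show ?thesis
    proof (cases "w \<in> big_noise k")
      case True
      have "4 * d * (\<Delta> k * obs.noise k w) \<le> 4 * d * (\<Sum>k\<le>K. tail k w)"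
        using big_sum_ge[OF k, of w] True d_ge_1 by (intro mult_left_mono) auto
      thus ?thesis using good d4 excess_ge(3)[of w] pen_nonneg[where k = k and w = w] by linarith
    next
      case False
      hence "obs.noise k w \<le> 5 * L * real (2 * k + 1) * logratio k / real n"
        using w by (simp add: big_noise_def)
      hence "32 / 9 * d * (\<Delta> k * obs.noise k w) \<le> 32 / 9 * d * (\<Delta> k * (5 * L * real (2 * k + 1) * logratio k / real n))"
        using d_ge_1 by (intro mult_left_mono \<Delta>_nonneg) auto
      also have "\<dots> = 160 / 9 * (d * L * (\<delta> k / real n))"
        by (simp add: delta_eq)
      \<comment> \<open>The slack between 160/9 = 32/9 * 5 and 165/8 is what permits the threshold
        factor 5.\<close>
      also have "\<dots> \<le> 165 / 8 * (d * L * (\<delta> k / real n))"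
        using d_ge_1 L(1) delta_n_pos[of k] by (intro mult_right_mono mult_nonneg_nonneg) auto
      also have "\<dots> = 165 / 4 * d * (L / 2) * (\<delta> k / real n)" by simp
      also have "\<dots> \<le> 165 / 4 * d * max (obs.mass + dev0 w) 1 * (\<delta> k / real n)"
      proof (intro mult_right_mono mult_left_mono)
        have "\<bar>dev0 w\<bar> \<le> 1" using count w by (simp add: bad_count_def)
        \<comment> \<open>The right-hand side is at least max (mass - 1) 1, and this is at least
          half of max 1 mass: consider mass \<le> 2 and mass > 2 separately.\<close>
        thus "L / 2 \<le> max (obs.mass + dev0 w) 1" unfolding L_def by linarith
      qed (use d_ge_1 delta_n_pos[of k] in auto)
      also have "\<dots> = pen k w / 2" unfolding pen_eq[OF w] by simp
      finally show ?thesis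
        using good excess_ge(1)[of w] bad_loss_nonneg[of K w] by simp
    qed
  qed
qed

text \<open>Meant for the fixed competitor k, where no comparison with the penalty is made: the mean
  of the noise term is itself of order \<delta> k / n.\<close>

lemma loss_le_simple:
  assumes w: "w \<in> space M" and k: "k \<le> K"
  shows "loss k w \<le> 4 * d * (\<Delta> k * obs.noise k w) + 2 * bad_loss K w + 2 * bias_noise K w"
proof -
  have "0 \<le> d * (\<Delta> k * obs.noise k w)"
    using d_ge_1 by (intro mult_nonneg_nonneg \<Delta>_nonneg) auto
  thus ?thesis
    using loss_bad[of w K k] loss_good[of w K k] w k bad_loss_nonneg[of K w]
    by (cases "w \<in> bad_sample K") auto
qed

text \<open>A majorant of the loss that does not mention the selected dimension, only a fixed
  competitor k, so its mean can be taken term by term.\<close>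

definition risk :: "nat \<Rightarrow> 'w \<Rightarrow> real" where
  "risk k w = 165 * d * (\<delta> k / real n) * (1 + L1 + \<bar>dev0 w\<bar>) +
     7 * (r * (\<omega> (int k) / \<gamma> (int k))) + 8 * d * (\<Delta> k * obs.noise k w) + 12 * bad_loss K w +
     12 * bias_noise K w + 16 * d * count_tail w +
     16 * d * (\<Sum>k\<le>K. tail k w)"

lemma bias_le:
  assumes F: "finite F" "F \<inter> band k = {}"
  shows "(\<Sum>j\<in>F. \<omega> j * (cmod (lam_coeff j))\<^sup>2) \<le> r * (\<omega> (int k) / \<gamma> (int k))"
proof -
  have "(\<Sum>j\<in>F. \<omega> j * (cmod (lam_coeff j))\<^sup>2) \<le>
      (\<Sum>j\<in>F. \<omega> (int k) / \<gamma> (int k) * (\<gamma> j * (cmod (lam_coeff j))\<^sup>2))"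
  proof (rule sum_mono)
    fix j assume "j \<in> F"
    hence "j \<notin> band k" using F(2) by blast
    hence "\<omega> j / \<gamma> j \<le> \<omega> (int k) / \<gamma> (int k)" by (intro \<omega>\<gamma>_antimono) auto
    from mult_right_mono[OF this, of "\<gamma> j * (cmod (lam_coeff j))\<^sup>2"] \<gamma>_pos[of j]
    show "\<omega> j * (cmod (lam_coeff j))\<^sup>2 \<le> \<omega> (int k) / \<gamma> (int k) * (\<gamma> j * (cmod (lam_coeff j))\<^sup>2)"
      by simp
  qed
  also have "\<dots> = \<omega> (int k) / \<gamma> (int k) * (\<Sum>j\<in>F. \<gamma> j * (cmod (lam_coeff j))\<^sup>2)"
    by (simp add: sum_distrib_left)
  also have "\<dots> \<le> \<omega> (int k) / \<gamma> (int k) * r"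
    using \<omega>_pos \<gamma>_pos by (intro mult_left_mono sum_lam_le F) (simp add: less_imp_le)
  finally show ?thesis by (simp add: mult.commute)
qed

lemma wnorm2_le_risk:
  assumes w: "w \<in> space M" and k: "k \<le> K"
    and sel: "is_k_tilde \<omega> \<alpha> d n m (N_obs w) (Y_obs w) kt"
  shows "wnorm2 \<omega> (\<lambda>t. lam_hat w kt t - complex_of_real (lam t)) \<le> ennreal (risk k w)"
proof (rule wnorm2_le[OF \<omega>_pos])
  fix F :: "int set" assume F: "finite F"
  let ?a = "est w"
  let ?A = "\<lambda>k. \<Sum>j\<in>band k. \<omega> j * (cmod (?a j))\<^sup>2"
  have kt: "kt \<le> K" using sel by (simp add: is_k_tilde_def is_arg_min_def)
  have con: "contrast \<omega> n m (N_obs w) (Y_obs w) (lam_hat w k) = - ?A k" if "k \<le> K" for k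
    using that K_le(3) by (intro contrast_lambda_hat \<omega>_pos) simp
  have "contrast \<omega> n m (N_obs w) (Y_obs w) (lam_hat w kt) + pen kt w \<le>
      contrast \<omega> n m (N_obs w) (Y_obs w) (lam_hat w k) + pen k w"
    using sel k unfolding is_k_tilde_def is_arg_min_def by (meson not_less)
  hence min: "pen kt w - ?A kt \<le> pen k w - ?A k" unfolding con[OF kt] con[OF k] by simp
  have coeff: "fourier_coeff (\<lambda>t. lam_hat w kt t - complex_of_real (lam t)) j =
      (if j \<in> band kt then ?a j else 0) - lam_coeff j" for j
    unfolding lambda_hat_estimate by (rule fourier_coeff_trig_poly_minus[OF lam_integrable])
  have "(\<Sum>j\<in>F. \<omega> j * (cmod (fourier_coeff (\<lambda>t. lam_hat w kt t - complex_of_real (lam t)) j))\<^sup>2) \<le>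
      2 * pen k w + 2 * loss k w + 7 * (r * (\<omega> (int k) / \<gamma> (int k))) + 4 * excess w"
    unfolding coeff loss_def
    by (rule model_selection_bound[OF \<omega>_pos k kt pen_nonneg min bias_le excess_ge(4)
        loss_le_excess[OF w, unfolded loss_def] F])
  also have "\<dots> \<le> risk k w"
    using pen_le[OF w, of k] loss_le_simple[OF w k] unfolding risk_def excess_def by simp
  finally show "(\<Sum>j\<in>F. \<omega> j * (cmod (fourier_coeff (\<lambda>t. lam_hat w kt t - complex_of_real (lam t)) j))\<^sup>2) \<le> risk k w" .
qed

text \<open>Four factors meet: m from the cutoff, 3 / m^2 as the root of the probability of a bad
  sample, 1/n from the variance, and the sum of the \<omega> j, at most A n. The result is of order
  1/m.\<close>

lemma mean_bad_loss: "mean_le (bad_loss K) (42 * A * exp L1 / real m)"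
proof -
  have n: "real n > 0" and m: "real m > 0" using n_ge_1 m_ge_1 by simp_all
  let ?b = "14 * exp obs.mass / real n * (3 / (real m)\<^sup>2)"
  have "mean_le (bad_loss K) (real m * (\<Sum>j\<in>band K. \<omega> j * ?b))"
    unfolding bad_loss_def[abs_def] using \<omega>_pos m emeasure_bad_sample[OF K_le(2)]
    by (intro mean_le_cmult mean_le_sum obs.mean_dev2_indicator) (auto simp: less_imp_le)
  moreover have "real m * (\<Sum>j\<in>band K. \<omega> j * ?b) \<le> 42 * A * exp L1 / real m"
  proof -
    have "real m * (\<Sum>j\<in>band K. \<omega> j * ?b) = real m * ?b * (\<Sum>j\<in>band K. \<omega> j)"
      by (simp only: sum_distrib_right[symmetric] mult_ac)
    also have "\<dots> \<le> real m * ?b * (A * real n)"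
      using sum_\<omega>_le[OF K_le(1) n_ge_1] by (intro mult_left_mono) auto
    also have "\<dots> = 42 * A * exp obs.mass / real m" using n m by (simp add: power2_eq_square)
    also have "\<dots> \<le> 42 * A * exp L1 / real m"
      using L A_ge_1 by (intro divide_right_mono mult_left_mono) auto
    finally show ?thesis .
  qed
  ultimately show ?thesis by (rule mean_le_trans)
qed

text \<open>The root of the probability of \<open>bad_count\<close> is of order 1/n, while (2 K + 1)
  * \<open>\<Delta> K\<close> / n is at most 1 by the definition of \<open>N_alpha\<close>.\<close>

lemma mean_count_tail: "mean_le count_tail (98 * exp (2 * L1) / real n)"
proof -
  have n: "real n > 0" using n_ge_1 by simp
  have "mean_le count_tail
      (\<Delta> K * (14 * real (2 * K + 1) * exp obs.mass / real n * (7 * exp obs.mass / real n)))"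
    using n by (intro mean_le_cmult obs.mean_noise_indicator emeasure_bad_count \<Delta>_nonneg) auto
  moreover have "\<Delta> K * (14 * real (2 * K + 1) * exp obs.mass / real n * (7 * exp obs.mass / real n)) \<le> 98 * exp (2 * L1) / real n"
  proof -
    have "\<Delta> K * (14 * real (2 * K + 1) * exp obs.mass / real n * (7 * exp obs.mass / real n)) =
        98 * exp (2 * obs.mass) / (real n)\<^sup>2 * (real (2 * K + 1) * \<Delta> K)"
      unfolding exp_double by (simp add: power2_eq_square)
    also have "\<dots> \<le> 98 * exp (2 * obs.mass) / (real n)\<^sup>2 * real n"
      using \<Delta>_le_n[OF K_le(1) n_ge_1] by (intro mult_left_mono) auto
    also have "\<dots> = 98 * exp (2 * obs.mass) / real n" using n by (simp add: power2_eq_square)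
    also have "\<dots> \<le> 98 * exp (2 * L1) / real n" using L by (intro divide_right_mono) auto
    finally show ?thesis .
  qed
  ultimately show ?thesis by (rule mean_le_trans)
qed

lemma mean_noise_delta:
  "mean_le (\<lambda>w. \<Delta> k * obs.noise k w) (8 * exp (2 * L1) * (\<delta> k / real n))"
proof -
  have "mean_le (\<lambda>w. \<Delta> k * obs.noise k w) (\<Delta> k * (8 * real (2 * k + 1) * exp (2 * obs.mass) / real n))"
    by (intro mean_le_cmult obs.mean_noise \<Delta>_nonneg)
  moreover have "\<Delta> k * (8 * real (2 * k + 1) * exp (2 * obs.mass) / real n) \<le> 8 * exp (2 * L1) * (\<delta> k / real n)"
  proof -
    have "\<Delta> k * (8 * real (2 * k + 1) * exp (2 * obs.mass) / real n) =
        8 * exp (2 * obs.mass) * (real (2 * k + 1) * \<Delta> k / real n)" by simp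
    also have "\<dots> \<le> 8 * exp (2 * L1) * (\<delta> k / real n)"
      using L delta_ge[of k] \<Delta>_nonneg[of k] by (intro mult_mono divide_right_mono) auto
    finally show ?thesis .
  qed
  ultimately show ?thesis by (rule mean_le_trans)
qed

lemma mean_abs_dev: "mean_le (\<lambda>w. \<bar>dev0 w\<bar>) (2 * exp (2 * L1))"
proof -
  have "mean_le (\<lambda>w. \<bar>dev0 w\<bar>) (2 * exp (2 * obs.mass) / sqrt (real n))"
    using obs.mean_abs_dev_power[OF measurable_trig abs_trig_le, of "(False, 0)" 1] by simp
  moreover have "2 * exp (2 * obs.mass) / sqrt (real n) \<le> 2 * exp (2 * L1) / 1"
    using L n_ge_1 by (intro frac_le) auto
  ultimately show ?thesis by (simp add: mean_le_trans)
qed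

lemma mean_risk:
  assumes k: "k \<le> K"
  shows "mean_le (risk k) (risk_const * (max (\<omega> (int k) / \<gamma> (int k)) (\<delta> k / real n) +
    Phi \<omega> \<gamma> \<alpha> m + 1 / real m + 1 / real n))"
proof -
  let ?\<delta> = "\<delta> k / real n" and ?\<omega>\<gamma> = "\<omega> (int k) / \<gamma> (int k)" and ?P = "Phi \<omega> \<gamma> \<alpha> m"
  define X where "X = max ?\<omega>\<gamma> ?\<delta> + ?P + 1 / real m + 1 / real n"
  have d0: "d \<ge> 0" using d_ge_1 by simp
  have \<omega>\<gamma>0: "?\<omega>\<gamma> \<ge> 0" using \<omega>_pos[of "int k"] \<gamma>_pos[of "int k"] by simp
  have c0: "165 * d * ?\<delta> \<ge> 0"
    by (intro mult_nonneg_nonneg d0 less_imp_le[OF delta_n_pos]) simp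
  have t0: "tail_const \<ge> 0" using small_models_nonneg by (simp add: tail_const_def)
  have "1 / real m \<ge> 0" "1 / real n \<ge> 0" by simp_all
  hence X: "?\<delta> \<le> X" "?\<omega>\<gamma> \<le> X" "1 / real m \<le> X" "?P + 1 / real m \<le> X" "1 / real n \<le> X"
    unfolding X_def using Phi_nonneg[of m] \<omega>\<gamma>0 by linarith+
  have "mean_le (risk k) (165 * d * ?\<delta> * (1 + L1 + 2 * exp (2 * L1)) + 7 * (r * ?\<omega>\<gamma>) + 8 * d * (8 * exp (2 * L1) * ?\<delta>) +
     12 * (42 * A * exp L1 / real m) + 12 * ((2 + 400 * exp 2) * d * r * (?P + 1 / real m)) +
     16 * d * (98 * exp (2 * L1) / real n) + 16 * d * (tail_const / real n))"
    unfolding risk_def[abs_def]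
    using d0 r_pos \<omega>\<gamma>0 delta_n_pos[of k] L1_ge_1
    by (intro mean_le_add mean_le_cmult mean_le_const mean_abs_dev mean_noise_delta mean_bad_loss
        mean_bias_noise mean_count_tail mean_sum_tail K_le(1) c0) (auto intro!: mult_nonneg_nonneg)
  hence "mean_le (risk k) (165 * d * (1 + L1 + 2 * exp (2 * L1)) * ?\<delta> + 7 * r * ?\<omega>\<gamma> + 64 * d * exp (2 * L1) * ?\<delta> +
       504 * A * exp L1 * (1 / real m) + 12 * ((2 + 400 * exp 2) * d * r) * (?P + 1 / real m) +
       1568 * d * exp (2 * L1) * (1 / real n) + 16 * d * tail_const * (1 / real n))"
    by (rule mean_le_trans) (simp add: algebra_simps add_divide_distrib)
  hence "mean_le (risk k) (165 * d * (1 + L1 + 2 * exp (2 * L1)) * X + 7 * r * X + 64 * d * exp (2 * L1) * X +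
       504 * A * exp L1 * X + 12 * ((2 + 400 * exp 2) * d * r) * X +
       1568 * d * exp (2 * L1) * X + 16 * d * tail_const * X)"
    by (rule mean_le_trans) (use X d0 r_pos L1_ge_1 A_ge_1 t0 in
      \<open>intro add_mono mult_left_mono, auto intro!: mult_nonneg_nonneg add_nonneg_nonneg\<close>)
  thus ?thesis unfolding risk_const_def X_def by (simp only: distrib_right)
qed

end

lemma (in weight_sequences) risk_const_pos: "risk_const > 0"
  unfolding risk_const_def tail_const_def using r_pos d_ge_1 L1_ge_1 A_ge_1 small_models_nonneg
  by (intro add_nonneg_pos add_pos_nonneg mult_nonneg_nonneg mult_pos_pos add_nonneg_nonneg) auto

lemma (in weight_sequences) risk_bound:
  assumes n: "n \<ge> 1" and m: "m \<ge> 1"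
    and lam: "lam \<in> intensity_class \<gamma> r" and f: "f \<in> density_class \<alpha> d"
    and model: "deconvolution_model P n m lam f \<nu> x \<epsilon> Y"
    and sel: "\<And>w. w \<in> space P \<Longrightarrow>
      is_k_tilde \<omega> \<alpha> d n m (\<lambda>i. observed_process \<nu> x \<epsilon> i w) (\<lambda>l. Y l w) (k_tilde w)"
  shows "(\<integral>\<^sup>+ w. wnorm2 \<omega> (\<lambda>t. lambda_hat n m (\<lambda>i. observed_process \<nu> x \<epsilon> i w) (\<lambda>l. Y l w)
        (k_tilde w) t - complex_of_real (lam t)) \<partial>P) \<le>
    ennreal (risk_const * (Min ((\<lambda>k. max (\<omega> (int k) / \<gamma> (int k)) (\<delta> k / real n))
      ` {0..K_alpha \<omega> \<alpha> d n m}) + Phi \<omega> \<gamma> \<alpha> m + 1 / real m + 1 / real n))"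
proof -
  interpret deconvolution_model P n m lam f \<nu> x \<epsilon> Y by (rule model)
  interpret adaptive_deconvolution r d \<gamma> \<alpha> \<omega> P n m lam f \<nu> x \<epsilon> Y
    using n m lam f by unfold_locales
  let ?g = "\<lambda>k. max (\<omega> (int k) / \<gamma> (int k)) (\<delta> k / real n)"
  have "Min (?g ` {0..K}) \<in> ?g ` {0..K}" by (intro Min_in) auto
  \<comment> \<open>The minimum is deterministic, so a model attaining it may serve as the fixed
    competitor.\<close>
  then obtain k where "Min (?g ` {0..K}) = ?g k" "k \<in> {0..K}" by (rule imageE)
  hence k: "k \<le> K" "Min (?g ` {0..K}) = ?g k" by simp_all
  have "(\<integral>\<^sup>+ w. wnorm2 \<omega> (\<lambda>t. lam_hat w (k_tilde w) t - complex_of_real (lam t)) \<partial>P) \<le>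
      (\<integral>\<^sup>+ w. ennreal (risk k w) \<partial>P)"
    using sel k(1) by (intro nn_integral_mono wnorm2_le_risk)
  also have "\<dots> \<le> ennreal (risk_const * (Min (?g ` {0..K}) + Phi \<omega> \<gamma> \<alpha> m + 1 / real m + 1 / real n))"
    using mean_risk[OF k(1)] unfolding k(2) mean_le_def by blast
  finally show ?thesis .
qed

theorem theorem4p1:
  fixes r d :: real and \<gamma> \<alpha> \<omega> :: "int \<Rightarrow> real"
  assumes "r > 0" and "d \<ge> 1"
    and "\<And>j. \<gamma> j > 0" and "\<And>j. \<alpha> j > 0" and "\<And>j. \<omega> j > 0"
    and "\<And>j. \<gamma> (- j) = \<gamma> j" and "\<And>j. \<alpha> (- j) = \<alpha> j" and "\<And>j. \<omega> (- j) = \<omega> j"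
    and "\<gamma> 0 = 1" and "\<omega> 0 = 1" and "\<alpha> 0 = 1"
    and "\<And>j. \<gamma> j \<ge> 1"
    and "decseq (\<lambda>n::nat. \<omega> (int n) / \<gamma> (int n))"
    and "decseq (\<lambda>n::nat. \<alpha> (int n))"
    and "\<alpha> summable_on UNIV"
  shows "\<exists>C>0. \<forall>n\<ge>1. \<forall>m\<ge>1.
    \<forall>(P :: (real \<Rightarrow> real) \<Rightarrow> (real \<Rightarrow> real) \<Rightarrow> 'w measure) \<nu> x \<epsilon> Y k_tilde.
      (\<forall>lam\<in>intensity_class \<gamma> r. \<forall>f\<in>density_class \<alpha> d.
         deconvolution_model (P lam f) n m lam f \<nu> x \<epsilon> Y \<and>
         k_tilde \<in> measurable (P lam f) (count_space UNIV) \<and>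
         (\<forall>w\<in>space (P lam f).
            is_k_tilde \<omega> \<alpha> d n m (\<lambda>i. observed_process \<nu> x \<epsilon> i w) (\<lambda>l. Y l w) (k_tilde w)))
      \<longrightarrow>
      (SUP lam\<in>intensity_class \<gamma> r. SUP f\<in>density_class \<alpha> d.
         \<integral>\<^sup>+ w. wnorm2 \<omega> (\<lambda>t. lambda_hat n m (\<lambda>i. observed_process \<nu> x \<epsilon> i w) (\<lambda>l. Y l w)
                                (k_tilde w) t - complex_of_real (lam t)) \<partial>P lam f)
      \<le> ennreal (C * (Min ((\<lambda>k. max (\<omega> (int k) / \<gamma> (int k)) (delta_alpha \<omega> \<alpha> k / real n))
                             ` {0..K_alpha \<omega> \<alpha> d n m})
                       + Phi \<omega> \<gamma> \<alpha> m + 1 / real m + 1 / real n))"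
proof -
  interpret W: weight_sequences r d \<gamma> \<alpha> \<omega>
    using assms by unfold_locales
  show ?thesis
  proof (intro exI[of _ W.risk_const] conjI allI impI)
    show "W.risk_const > 0" by (rule W.risk_const_pos)
  qed (intro SUP_least, rule W.risk_bound, auto)
qed

end
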